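(* Let $\Sigma$ be a signature, $\mathcal{L}_{\Sigma}$ its Lawvere theory, and let $P_{ff}$ be the endofunctor on $\mathit{Lax}_{\mathit{Inj}}(\mathcal{L}_{\Sigma}^{op},\mathit{Poset})$ defined below. Then $P_{ff}$ induces a cofree comonad $C(P_{ff})$ on $\mathit{Lax}_{\mathit{Inj}}(\mathcal{L}_{\Sigma}^{op},\mathit{Poset})$. Moreover, for any logic program $P$ over $\Sigma$ (with no restriction on variables occurring in clause bodies but not heads), regarded as a $P_{ff}$-coalgebra $p:\mathit{At}\to P_{ff}(\mathit{At})$, the corresponding $C(P_{ff})$-coalgebra $\overline{p}:\mathit{At}\to C(P_{ff})(\mathit{At})$ sends each atom $A(x_1,\dots,x_n)\in\mathit{At}(n)$ to (an element identified with) the coinductive tree for $A(x_1,\dots,x_n)$.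
   Context: Syntax: a signature $\Sigma$ is a set of function symbols with arities; terms are variables or $f(t_1,\dots,t_n)$ for $n$-ary $f$; with a set of predicate symbols with arities, atoms are $Q(t_1,\dots,t_k)$; a (Horn) clause is $A\gets A_1,\dots,A_n$ with atoms $A,A_i$ (head $A$, body/tail $A_1,\dots,A_n$; body variables need not occur in the head); a logic program is a finite list of clauses. A substitution $\sigma$ is a matcher of $t$ against $u$ if $\sigma(t)=u$; a most general matcher (mgm) is a matcher more general than all others. Lawvere theory $\mathcal{L}_{\Sigma}$: objects are natural numbers; for each $n$ fix distinct variables $x_1,\dots,x_n$; $\mathcal{L}_{\Sigma}(n,m)$ is the set of $m$-tuples of terms over $\Sigma$ in $x_1,\dots,x_n$; composition is substitution. $\mathit{At}:\mathcal{L}_{\Sigma}^{op}\to\mathit{Poset}$ sends $n$ to the discrete poset of atoms (built from $\Sigma$ and the predicate symbols of $P$) with variables among $x_1,\dots,x_n$, and sends $f=(f_1,\dots,f_m):n\to m$ to the substitution map $A(x_1,\dots,x_m)\mapsto A(f_1/x_1,\dots,f_m/x_m)$. $P_f$ on $\mathit{Poset}$: finite subsets, ordered by $A\le B$ iff every $a\in A$ has some $b\in B$ with $a\le b$; direct image on maps. A lax transformation $\alpha:H\to K$ between functors $\mathcal{L}_{\Sigma}^{op}\to\mathit{Poset}$ is a family of monotone maps $\alpha_n$ with $(Kf)\alpha_m\le\alpha_n(Hf)$ for all $f:n\to m$. $\mathit{Inj}$ is the category of injections between natural numbers, with canonical identity-on-objects functor $J:\mathit{Inj}\to\mathcal{L}_{\Sigma}^{op}$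 (injections act as renamings of variables). $\mathit{Lax}_{\mathit{Inj}}(\mathcal{L}_{\Sigma}^{op},\mathit{Poset})$ has as objects functors $\mathcal{L}_{\Sigma}^{op}\to\mathit{Poset}$ and as maps lax transformations that are strictly natural with respect to all maps $J(i)$, $i$ an injection; composition is pointwise. $P_{ff}(H)(n)=\int^{m\in n/\mathit{Inj}}P_fP_fHJ(m)$ (colimit in $\mathit{Poset}$ over injections $n\to m$; informally $(\sum_{m\ge n}P_fP_fH(m))/\!\equiv$ with $\equiv$ generated by injections); on $f:n\to n'$ it acts, writing each $m\in n'/\mathit{Inj}$ uniquely (up to coherent iso) as $n'+k$, by $P_fP_fH(f+k)$; on maps $\alpha$ it acts by $P_fP_f(\alpha_{n+k})$ on the summand indexed by $n+k$. The coalgebra $p$ of $P$: $p_n$ sends an atom $A\in\mathit{At}(n)$ to the set, over all clauses $B\gets B_1,\dots,B_k$ of $P$ whose head matches $A$ via an mgm $\theta$ (so $A=B\theta$), of the sets $\{B_1\theta,\dots,B_k\theta\}$, where variables of the body not in the head are treated as fresh variables $x_{n+1},\dots$; this is an element of $P_{ff}(\mathit{At})(n)$. Coinductive tree for an atom $A$: the possibly infinite tree with root $A$, whose nodes are and-nodes (atoms) or or-nodes ($\bullet$), such that for every and-node $A'$, if exactly $m>0$ distinct clauses $C_i=(B_i\gets B^i_1,\dots,B^i_{n_i})$ of $P$ satisfy $A'=B_i\theta_i$ for mgms $\theta_i$, then $A'$ has exactly $m$ or-node children, the $i$-th of which has the $n_i$ and-node children $B^i_1\theta_i,\dots,B^i_{n_i}\theta_i$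 (and $A'$ has no children if no clause head matches it).
   Formalization: Poset is read as preordered sets (antisymmetry dropped), since the given order on P_f is not antisymmetric: {∅,{∗}} and {{∗}} lie below each other in P_fP_f of a point. Smallness: carriers are subsets of a fixed set containing arbitrary urelements and closed under the needed operations. *)

theory Defs
  imports Main "HOL-Library.FSet" "HOL-Library.FuncSet"
begin

section \<open>Categories, comonads, cofree comonads\<close>

record ('o, 'a) cat =
  Obj :: "'o set"
  Arr :: "'a set"
  Dom :: "'a \<Rightarrow> 'o"
  Cod :: "'a \<Rightarrow> 'o"
  Id :: "'o \<Rightarrow> 'a"
  Comp :: "'a \<Rightarrow> 'a \<Rightarrow> 'a"  \<comment> \<open>\<open>Comp K g f\<close> is ``\<open>g\<close> after \<open>f\<close>''\<close>

definition hom :: "('o, 'a, 'z) cat_scheme \<Rightarrow> 'o \<Rightarrow> 'o \<Rightarrow> 'a set" where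
  "hom K x y = {f \<in> Arr K. Dom K f = x \<and> Cod K f = y}"

locale category =
  fixes K :: "('o, 'a) cat"
  assumes dom_cod: "f \<in> Arr K \<Longrightarrow> Dom K f \<in> Obj K \<and> Cod K f \<in> Obj K"
    and Id_hom: "x \<in> Obj K \<Longrightarrow> Id K x \<in> hom K x x"
    and Comp_hom: "f \<in> hom K x y \<Longrightarrow> g \<in> hom K y z \<Longrightarrow> Comp K g f \<in> hom K x z"
    and Comp_Id: "f \<in> hom K x y \<Longrightarrow> Comp K f (Id K x) = f"
    and Id_Comp: "f \<in> hom K x y \<Longrightarrow> Comp K (Id K y) f = f"
    and assoc: "f \<in> hom K w x \<Longrightarrow> g \<in> hom K x y \<Longrightarrow> h \<in> hom K y z \<Longrightarrow>
      Comp K h (Comp K g f) = Comp K (Comp K h g) f"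

locale endofunctor = category K
  for K :: "('o, 'a) cat" +
  fixes FO :: "'o \<Rightarrow> 'o" and FA :: "'a \<Rightarrow> 'a"
  assumes F_obj: "x \<in> Obj K \<Longrightarrow> FO x \<in> Obj K"
    and F_hom: "f \<in> hom K x y \<Longrightarrow> FA f \<in> hom K (FO x) (FO y)"
    and F_Id: "x \<in> Obj K \<Longrightarrow> FA (Id K x) = Id K (FO x)"
    and F_Comp: "f \<in> hom K x y \<Longrightarrow> g \<in> hom K y z \<Longrightarrow> FA (Comp K g f) = Comp K (FA g) (FA f)"

locale comonad = endofunctor K CO CA
  for K :: "('o, 'a) cat" and CO :: "'o \<Rightarrow> 'o" and CA :: "'a \<Rightarrow> 'a" +
  fixes eps :: "'o \<Rightarrow> 'a" and delta :: "'o \<Rightarrow> 'a"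
  assumes eps_hom: "x \<in> Obj K \<Longrightarrow> eps x \<in> hom K (CO x) x"
    and eps_natural: "f \<in> hom K x y \<Longrightarrow> Comp K (eps y) (CA f) = Comp K f (eps x)"
    and delta_hom: "x \<in> Obj K \<Longrightarrow> delta x \<in> hom K (CO x) (CO (CO x))"
    and delta_natural: "f \<in> hom K x y \<Longrightarrow> Comp K (delta y) (CA f) = Comp K (CA (CA f)) (delta x)"
    and counit_left: "x \<in> Obj K \<Longrightarrow> Comp K (eps (CO x)) (delta x) = Id K (CO x)"
    and counit_right: "x \<in> Obj K \<Longrightarrow> Comp K (CA (eps x)) (delta x) = Id K (CO x)"
    and coassoc: "x \<in> Obj K \<Longrightarrow> Comp K (delta (CO x)) (delta x) = Comp K (CA (delta x)) (delta x)"

text \<open>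
  The cofree comonad on an endofunctor \<open>F\<close>: the forgetful functor from \<open>F\<close>-coalgebras has a right
  adjoint, sending \<open>x\<close> to the cofree coalgebra \<open>gam x : C x \<rightarrow> F (C x)\<close> with counit \<open>eps x\<close>, and
  \<open>C\<close> is the comonad induced by this adjunction. Together with the comonad laws, the last two
  assumptions determine the action of \<open>C\<close> on arrows and \<open>delta\<close> uniquely from \<open>eps\<close> and \<open>gam\<close>.
\<close>

locale cofree_comonad = base: endofunctor K FO FA + comonad K CO CA eps delta
  for K :: "('o, 'a) cat" and FO :: "'o \<Rightarrow> 'o" and FA :: "'a \<Rightarrow> 'a"
    and CO :: "'o \<Rightarrow> 'o" and CA :: "'a \<Rightarrow> 'a" and eps :: "'o \<Rightarrow> 'a" and delta :: "'o \<Rightarrow> 'a" +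
  fixes gam :: "'o \<Rightarrow> 'a"
  assumes gam_hom: "x \<in> Obj K \<Longrightarrow> gam x \<in> hom K (CO x) (FO (CO x))"
    and cofree: "x \<in> Obj K \<Longrightarrow> y \<in> Obj K \<Longrightarrow> c \<in> hom K y (FO y) \<Longrightarrow> f \<in> hom K y x \<Longrightarrow>
      \<exists>!h. h \<in> hom K y (CO x) \<and> Comp K (gam x) h = Comp K (FA h) c \<and> Comp K (eps x) h = f"
    and CA_coalgebra_map: "f \<in> hom K x y \<Longrightarrow>
      Comp K (gam y) (CA f) = Comp K (FA (CA f)) (gam x)"
    and delta_coalgebra_map: "x \<in> Obj K \<Longrightarrow>
      Comp K (gam (CO x)) (delta x) = Comp K (FA (delta x)) (gam x)"

definition comonad_coalgebra ::
  "('o, 'a) cat \<Rightarrow> ('o \<Rightarrow> 'o) \<Rightarrow> ('a \<Rightarrow> 'a) \<Rightarrow> ('o \<Rightarrow> 'a) \<Rightarrow> ('o \<Rightarrow> 'a) \<Rightarrow> 'o \<Rightarrow> 'a \<Rightarrow> bool" where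
  "comonad_coalgebra K CO CA eps delta x c \<longleftrightarrow>
     c \<in> hom K x (CO x) \<and>
     Comp K (eps x) c = Id K x \<and>
     Comp K (delta x) c = Comp K (CA c) c"

text \<open>
  The canonical projection from the cofree comonad to \<open>F\<close> is \<open>F (eps x) \<circ> gam x\<close>. The coalgebra of
  the comonad corresponding to an \<open>F\<close>-coalgebra \<open>c\<close> on \<open>x\<close> is the one from which \<open>c\<close> is recovered
  by composing with this projection.
\<close>

definition corresponding_coalgebra ::
  "('o, 'a) cat \<Rightarrow> ('a \<Rightarrow> 'a) \<Rightarrow> ('o \<Rightarrow> 'o) \<Rightarrow> ('a \<Rightarrow> 'a) \<Rightarrow> ('o \<Rightarrow> 'a) \<Rightarrow> ('o \<Rightarrow> 'a) \<Rightarrow> ('o \<Rightarrow> 'a)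
    \<Rightarrow> 'o \<Rightarrow> 'a \<Rightarrow> 'a \<Rightarrow> bool" where
  "corresponding_coalgebra K FA CO CA eps delta gam x c cbar \<longleftrightarrow>
     comonad_coalgebra K CO CA eps delta x cbar \<and>
     Comp K (Comp K (FA (eps x)) (gam x)) cbar = c"


section \<open>Terms, atoms, clauses\<close>

text \<open>The variable \<open>x\<^sub>i\<close> (\<open>i \<ge> 1\<close>) is \<open>Var (i - 1)\<close>, so ``over \<open>x\<^sub>1, \<dots>, x\<^sub>n\<close>'' means variables \<open>< n\<close>.\<close>

datatype 'f trm = Var nat | Fun 'f "'f trm list"

datatype ('f, 'p) atom = Pred 'p "'f trm list"

datatype ('f, 'p) clause = Clause (head: "('f, 'p) atom") (body: "('f, 'p) atom list")

record ('f, 'p) sig =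
  funs :: "'f set"
  fun_arity :: "'f \<Rightarrow> nat"
  preds :: "'p set"
  pred_arity :: "'p \<Rightarrow> nat"

fun vars :: "'f trm \<Rightarrow> nat set" where
  "vars (Var x) = {x}"
| "vars (Fun f ts) = (\<Union>t\<in>set ts. vars t)"

fun wf_trm :: "('f, 'p) sig \<Rightarrow> 'f trm \<Rightarrow> bool" where
  "wf_trm Sg (Var x) \<longleftrightarrow> True"
| "wf_trm Sg (Fun f ts) \<longleftrightarrow> f \<in> funs Sg \<and> length ts = fun_arity Sg f \<and> (\<forall>t\<in>set ts. wf_trm Sg t)"

fun subst :: "(nat \<Rightarrow> 'f trm) \<Rightarrow> 'f trm \<Rightarrow> 'f trm" where
  "subst \<sigma> (Var x) = \<sigma> x"
| "subst \<sigma> (Fun f ts) = Fun f (map (subst \<sigma>) ts)"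

fun avars :: "('f, 'p) atom \<Rightarrow> nat set" where
  "avars (Pred q ts) = (\<Union>t\<in>set ts. vars t)"

fun wf_atom :: "('f, 'p) sig \<Rightarrow> ('f, 'p) atom \<Rightarrow> bool" where
  "wf_atom Sg (Pred q ts) \<longleftrightarrow>
     q \<in> preds Sg \<and> length ts = pred_arity Sg q \<and> (\<forall>t\<in>set ts. wf_trm Sg t)"

fun asubst :: "(nat \<Rightarrow> 'f trm) \<Rightarrow> ('f, 'p) atom \<Rightarrow> ('f, 'p) atom" where
  "asubst \<sigma> (Pred q ts) = Pred q (map (subst \<sigma>) ts)"

definition atoms :: "('f, 'p) sig \<Rightarrow> nat \<Rightarrow> ('f, 'p) atom set" where
  "atoms Sg n = {A. wf_atom Sg A \<and> avars A \<subseteq> {..<n}}"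

definition logic_program :: "('f, 'p) sig \<Rightarrow> ('f, 'p) clause list \<Rightarrow> bool" where
  "logic_program Sg P \<longleftrightarrow> (\<forall>c\<in>set P. wf_atom Sg (head c) \<and> (\<forall>B\<in>set (body c). wf_atom Sg B))"

definition matcher :: "(nat \<Rightarrow> 'f trm) \<Rightarrow> ('f, 'p) atom \<Rightarrow> ('f, 'p) atom \<Rightarrow> bool" where
  "matcher \<sigma> B A \<longleftrightarrow> asubst \<sigma> B = A"

definition mgm :: "(nat \<Rightarrow> 'f trm) \<Rightarrow> ('f, 'p) atom \<Rightarrow> ('f, 'p) atom \<Rightarrow> bool" where
  "mgm \<sigma> B A \<longleftrightarrow> matcher \<sigma> B A \<and> (\<forall>\<tau>. matcher \<tau> B A \<longrightarrow> (\<exists>\<rho>. \<forall>x. \<tau> x = subst \<rho> (\<sigma> x)))"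

definition matches :: "('f, 'p) clause \<Rightarrow> ('f, 'p) atom \<Rightarrow> bool" where
  "matches c A \<longleftrightarrow> (\<exists>\<sigma>. mgm \<sigma> (head c) A)"

text \<open>
  A most general matcher is unique only up to renaming of the variables that occur in the body of
  the clause but not in its head. Relative to a context of \<open>n\<close> variables those variables are named
  \<open>x\<^sub>n\<^sub>+\<^sub>1, x\<^sub>n\<^sub>+\<^sub>2, \<dots>\<close>, separately for each clause.
\<close>

definition body_only_vars :: "('f, 'p) clause \<Rightarrow> nat list" where
  "body_only_vars c = sorted_list_of_set ((\<Union>B\<in>set (body c). avars B) - avars (head c))"

definition fresh_mgm :: "nat \<Rightarrow> (nat \<Rightarrow> 'f trm) \<Rightarrow> ('f, 'p) clause \<Rightarrow> ('f, 'p) atom \<Rightarrow> bool" where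
  "fresh_mgm n \<theta> c A \<longleftrightarrow>
     mgm \<theta> (head c) A \<and>
     map \<theta> (body_only_vars c) = map Var [n..<n + length (body_only_vars c)]"

text \<open>The number of fresh variables needed for one resolution step from \<open>A\<close>.\<close>

definition num_fresh :: "('f, 'p) clause list \<Rightarrow> ('f, 'p) atom \<Rightarrow> nat" where
  "num_fresh P A = Max (insert 0 {length (body_only_vars c) | c. c \<in> set P \<and> matches c A})"


section \<open>The Lawvere theory and \<open>Lax\<^sub>I\<^sub>n\<^sub>j\<close>\<close>

text \<open>The homset from \<open>n\<close> to \<open>m\<close>.\<close>

definition law :: "('f, 'p) sig \<Rightarrow> nat \<Rightarrow> nat \<Rightarrow> 'f trm list set" where
  "law Sg n m = {f. length f = m \<and> (\<forall>t\<in>set f. wf_trm Sg t \<and> vars t \<subseteq> {..<n})}"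

definition law_id :: "nat \<Rightarrow> 'f trm list" where
  "law_id n = map Var [0..<n]"

definition tuple_subst :: "'f trm list \<Rightarrow> nat \<Rightarrow> 'f trm" where
  "tuple_subst f x = f ! x"

text \<open>\<open>law_comp g f\<close> is ``\<open>g\<close> after \<open>f\<close>'', for \<open>f : n \<rightarrow> m\<close> and \<open>g : m \<rightarrow> l\<close>.\<close>

definition law_comp :: "'f trm list \<Rightarrow> 'f trm list \<Rightarrow> 'f trm list" where
  "law_comp g f = map (subst (tuple_subst f)) g"

definition injections :: "nat \<Rightarrow> nat \<Rightarrow> (nat \<Rightarrow> nat) set" where
  "injections n m = {i. inj_on i {..<n} \<and> i ` {..<n} \<subseteq> {..<m}}"

text \<open>An injection \<open>i : n \<rightarrow> m\<close> yields an arrow \<open>m \<rightarrow> n\<close> of the Lawvere theory.\<close>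

definition J :: "nat \<Rightarrow> (nat \<Rightarrow> nat) \<Rightarrow> 'f trm list" where
  "J n i = map (\<lambda>x. Var (i x)) [0..<n]"

text \<open>
  Ordered sets are given by a carrier and a relation which is reflexive and transitive on it;
  antisymmetry is not required, since the order on finite subsets below is not antisymmetric,
  not even when iterated on a discrete order: \<open>{{a}, {a, b}}\<close> and \<open>{{a, b}}\<close> are below each other.
\<close>

record 'u ord_set =
  carr :: "'u set"
  leq :: "'u \<Rightarrow> 'u \<Rightarrow> bool"

definition is_ord_set :: "'u ord_set \<Rightarrow> bool" where
  "is_ord_set X \<longleftrightarrow> reflp_on (carr X) (leq X) \<and> transp_on (carr X) (leq X)"

definition monotone_map :: "'u ord_set \<Rightarrow> 'u ord_set \<Rightarrow> ('u \<Rightarrow> 'u) \<Rightarrow> bool" where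
  "monotone_map X Y h \<longleftrightarrow>
     h \<in> carr X \<rightarrow> carr Y \<and> (\<forall>a\<in>carr X. \<forall>b\<in>carr X. leq X a b \<longrightarrow> leq Y (h a) (h b))"

text \<open>
  Functors \<open>H\<close> from the opposite of the Lawvere theory to ordered sets: for \<open>f : n \<rightarrow> m\<close>,
  \<open>act H n m f\<close> maps \<open>ob H m\<close> to \<open>ob H n\<close>.
\<close>

record ('f, 'u) ofunctor =
  ob :: "nat \<Rightarrow> 'u ord_set"
  act :: "nat \<Rightarrow> nat \<Rightarrow> 'f trm list \<Rightarrow> 'u \<Rightarrow> 'u"

definition is_ofunctor :: "('f, 'p) sig \<Rightarrow> ('f, 'u) ofunctor \<Rightarrow> bool" where
  "is_ofunctor Sg H \<longleftrightarrow>
     (\<forall>n. is_ord_set (ob H n)) \<and>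
     (\<forall>n m. \<forall>f\<in>law Sg n m. monotone_map (ob H m) (ob H n) (act H n m f)) \<and>
     (\<forall>n. \<forall>a\<in>carr (ob H n). act H n n (law_id n) a = a) \<and>
     (\<forall>n m l. \<forall>f\<in>law Sg n m. \<forall>g\<in>law Sg m l. \<forall>a\<in>carr (ob H l).
        act H n l (law_comp g f) a = act H n m f (act H m l g a))"

record ('f, 'u) trans =
  src :: "('f, 'u) ofunctor"
  tgt :: "('f, 'u) ofunctor"
  app :: "nat \<Rightarrow> 'u \<Rightarrow> 'u"

text \<open>
  Lax transformations that are strict on injections. Components are extensional, so that
  equality of transformations is equality of their components on the carriers.
\<close>

definition is_trans :: "('f, 'p) sig \<Rightarrow> ('f, 'u) trans \<Rightarrow> bool" where
  "is_trans Sg \<alpha> \<longleftrightarrow>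
     is_ofunctor Sg (src \<alpha>) \<and> is_ofunctor Sg (tgt \<alpha>) \<and>
     (\<forall>n. app \<alpha> n \<in> extensional (carr (ob (src \<alpha>) n)) \<and>
          monotone_map (ob (src \<alpha>) n) (ob (tgt \<alpha>) n) (app \<alpha> n)) \<and>
     (\<forall>n m. \<forall>f\<in>law Sg n m. \<forall>a\<in>carr (ob (src \<alpha>) m).
        leq (ob (tgt \<alpha>) n) (act (tgt \<alpha>) n m f (app \<alpha> m a)) (app \<alpha> n (act (src \<alpha>) n m f a))) \<and>
     (\<forall>n m. \<forall>i\<in>injections n m. \<forall>a\<in>carr (ob (src \<alpha>) n).
        act (tgt \<alpha>) m n (J n i) (app \<alpha> n a) = app \<alpha> m (act (src \<alpha>) m n (J n i) a))"

definition Lax_Inj :: "('f, 'p) sig \<Rightarrow> (('f, 'u) ofunctor, ('f, 'u) trans) cat" where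
  "Lax_Inj Sg = \<lparr>
     Obj = Collect (is_ofunctor Sg),
     Arr = Collect (is_trans Sg),
     Dom = src,
     Cod = tgt,
     Id = (\<lambda>H. \<lparr>src = H, tgt = H, app = (\<lambda>n. restrict (\<lambda>a. a) (carr (ob H n)))\<rparr>),
     Comp = (\<lambda>\<beta> \<alpha>. \<lparr>src = src \<alpha>, tgt = tgt \<beta>,
       app = (\<lambda>n. compose (carr (ob (src \<alpha>) n)) (app \<beta> n) (app \<alpha> n))\<rparr>)\<rparr>"


section \<open>The universe\<close>

text \<open>
  The ordered sets under consideration are those with carrier in this type. It contains an arbitrary
  type \<open>'a\<close> of urelements, hence copies of arbitrarily large ordered sets, as well as the atoms. It
  is closed under finite subsets and \<open>\<nat>\<close>-indexed sums, which makes \<open>P\<^sub>f\<close> and \<open>P\<^sub>f\<^sub>f\<close> endofunctors, and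
  under \<open>\<nat>\<close>-indexed families (constructor \<open>Seq\<close>), which leaves room for cofree coalgebras.
\<close>

datatype ('f, 'p, 'a) univ =
    Elem 'a
  | Atm "('f, 'p) atom"
  | FinSet "('f, 'p, 'a) univ fset"
  | Tag nat "('f, 'p, 'a) univ"
  | Seq "nat \<Rightarrow> ('f, 'p, 'a) univ"


section \<open>The functors \<open>P\<^sub>f\<close> and \<open>P\<^sub>f\<^sub>f\<close>\<close>

definition Pf :: "('f, 'p, 'a) univ ord_set \<Rightarrow> ('f, 'p, 'a) univ ord_set" where
  "Pf X = \<lparr>
     carr = {FinSet s | s. fset s \<subseteq> carr X},
     leq = (\<lambda>a b. \<exists>s t. a = FinSet s \<and> b = FinSet t \<and> (\<forall>x\<in>fset s. \<exists>y\<in>fset t. leq X x y))\<rparr>"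

fun Pf_map :: "(('f, 'p, 'a) univ \<Rightarrow> ('f, 'p, 'a) univ) \<Rightarrow> ('f, 'p, 'a) univ \<Rightarrow> ('f, 'p, 'a) univ" where
  "Pf_map h (FinSet s) = FinSet (h |`| s)"

text \<open>
  The colimit over \<open>n / Inj\<close> is computed over the equivalent full subcategory of standard inclusions
  \<open>n \<rightarrow> n + k\<close>, whose arrows are the injections \<open>n + k \<rightarrow> n + k'\<close> fixing \<open>0, \<dots>, n - 1\<close>. The element
  \<open>S\<close> of the summand \<open>P\<^sub>f (P\<^sub>f (H (n + k)))\<close> is written \<open>Tag k S\<close>.
\<close>

definition summands :: "('f, ('f, 'p, 'a) univ) ofunctor \<Rightarrow> nat \<Rightarrow> ('f, 'p, 'a) univ set" where
  "summands H n = {Tag k S | k S. S \<in> carr (Pf (Pf (ob H (n + k))))}"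

definition inj_step ::
  "('f, ('f, 'p, 'a) univ) ofunctor \<Rightarrow> nat \<Rightarrow> ('f, 'p, 'a) univ \<Rightarrow> ('f, 'p, 'a) univ \<Rightarrow> bool" where
  "inj_step H n u v \<longleftrightarrow>
     (\<exists>k k' i S. i \<in> injections (n + k) (n + k') \<and> (\<forall>x<n. i x = x) \<and>
        S \<in> carr (Pf (Pf (ob H (n + k)))) \<and> u = Tag k S \<and>
        v = Tag k' (Pf_map (Pf_map (act H (n + k') (n + k) (J (n + k) i))) S))"

definition summand_leq ::
  "('f, ('f, 'p, 'a) univ) ofunctor \<Rightarrow> nat \<Rightarrow> ('f, 'p, 'a) univ \<Rightarrow> ('f, 'p, 'a) univ \<Rightarrow> bool" where
  "summand_leq H n u v \<longleftrightarrow>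
     (\<exists>k S T. S \<in> carr (Pf (Pf (ob H (n + k)))) \<and> T \<in> carr (Pf (Pf (ob H (n + k)))) \<and>
        u = Tag k S \<and> v = Tag k T \<and> leq (Pf (Pf (ob H (n + k)))) S T)"

text \<open>
  The colimit is the quotient of the sum by the equivalence relation generated by \<open>inj_step\<close>, each
  class being represented by a chosen member; its order is the least one for which the maps from
  the summands are monotone.
\<close>

definition cls ::
  "('f, ('f, 'p, 'a) univ) ofunctor \<Rightarrow> nat \<Rightarrow> ('f, 'p, 'a) univ \<Rightarrow> ('f, 'p, 'a) univ" where
  "cls H n u = (SOME v. equivclp (inj_step H n) u v)"

definition colim :: "('f, ('f, 'p, 'a) univ) ofunctor \<Rightarrow> nat \<Rightarrow> ('f, 'p, 'a) univ ord_set" where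
  "colim H n = \<lparr>
     carr = cls H n ` summands H n,
     leq = (sup (symclp (inj_step H n)) (summand_leq H n))\<^sup>*\<^sup>*\<rparr>"

text \<open>For \<open>f : n' \<rightarrow> n\<close> in the Lawvere theory, the arrow \<open>f + k : n' + k \<rightarrow> n + k\<close>.\<close>

definition law_plus :: "nat \<Rightarrow> 'f trm list \<Rightarrow> nat \<Rightarrow> 'f trm list" where
  "law_plus n' f k = f @ map Var [n'..<n' + k]"

definition Pff_ob ::
  "('f, ('f, 'p, 'a) univ) ofunctor \<Rightarrow> ('f, ('f, 'p, 'a) univ) ofunctor" where
  "Pff_ob H = \<lparr>
     ob = colim H,
     act = (\<lambda>n' n f u. case u of Tag k S \<Rightarrow>
       cls H n' (Tag k (Pf_map (Pf_map (act H (n' + k) (n + k) (law_plus n' f k))) S)))\<rparr>"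

definition Pff_arr ::
  "('f, ('f, 'p, 'a) univ) trans \<Rightarrow> ('f, ('f, 'p, 'a) univ) trans" where
  "Pff_arr \<alpha> = \<lparr>
     src = Pff_ob (src \<alpha>),
     tgt = Pff_ob (tgt \<alpha>),
     app = (\<lambda>n. restrict
       (\<lambda>u. case u of Tag k S \<Rightarrow> cls (tgt \<alpha>) n (Tag k (Pf_map (Pf_map (app \<alpha> (n + k))) S)))
       (carr (colim (src \<alpha>) n)))\<rparr>"


section \<open>Logic programs as coalgebras\<close>

definition At :: "('f, 'p) sig \<Rightarrow> ('f, ('f, 'p, 'a) univ) ofunctor" where
  "At Sg = \<lparr>
     ob = (\<lambda>n. \<lparr>carr = Atm ` atoms Sg n, leq = (=)\<rparr>),
     act = (\<lambda>n m f u. case u of Atm A \<Rightarrow> Atm (asubst (tuple_subst f) A))\<rparr>"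

definition resolvents ::
  "('f, 'p) clause list \<Rightarrow> nat \<Rightarrow> ('f, 'p) atom \<Rightarrow> ('f, 'p, 'a) univ set" where
  "resolvents P n A =
     {FinSet (fset_of_list (map (\<lambda>B. Atm (asubst \<theta> B)) (body c))) | c \<theta>.
        c \<in> set P \<and> fresh_mgm n \<theta> c A}"

definition program_coalgebra ::
  "('f, 'p) sig \<Rightarrow> ('f, 'p) clause list \<Rightarrow> ('f, ('f, 'p, 'a) univ) trans" where
  "program_coalgebra Sg P = \<lparr>
     src = At Sg,
     tgt = Pff_ob (At Sg),
     app = (\<lambda>n. restrict
       (\<lambda>u. case u of Atm A \<Rightarrow>
          cls (At Sg) n (Tag (num_fresh P A) (FinSet (Abs_fset (resolvents P n A)))))
       (carr (ob (At Sg) n)))\<rparr>"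


section \<open>Coinductive trees\<close>

text \<open>
  The root is an and-node. Each member of the outer list is an or-node, given by the list of its
  and-node children.
\<close>

codatatype 'l and_tree = And_Node (root: 'l) (or_nodes: "'l and_tree list list")

text \<open>
  And-nodes are labelled by atoms in context: \<open>(n, A)\<close> is \<open>A\<close> regarded as an element of \<open>At(n)\<close>. The
  context holds all variables introduced along the branch, so that later ones can be chosen fresh.
\<close>

coinductive coinductive_tree ::
  "('f, 'p) clause list \<Rightarrow> (nat \<times> ('f, 'p) atom) and_tree \<Rightarrow> bool"
  for P :: "('f, 'p) clause list" where
  "list_all2
     (\<lambda>c ts. \<exists>\<theta>. fresh_mgm n \<theta> c A \<and>
        list_all2 (\<lambda>B t. root t = (n + num_fresh P A, asubst \<theta> B) \<and> coinductive_tree P t) (body c) ts)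
     (filter (\<lambda>c. matches c A) (remdups P)) tss
   \<Longrightarrow> coinductive_tree P (And_Node (n, A) tss)"

definition coinductive_tree_for ::
  "('f, 'p) clause list \<Rightarrow> nat \<Rightarrow> ('f, 'p) atom \<Rightarrow> (nat \<times> ('f, 'p) atom) and_tree \<Rightarrow> bool" where
  "coinductive_tree_for P n A T \<longleftrightarrow> root T = (n, A) \<and> coinductive_tree P T"

text \<open>
  Identification of elements of a \<open>P\<^sub>f\<^sub>f\<close>-coalgebra \<open>gam\<close> on \<open>X\<close>, labelled in \<open>At\<close> by \<open>eps\<close>, with
  trees: an element at \<open>n\<close> is identified with a tree when its label is that of the root and
  \<open>gam\<close> sends it to the class of a finite set of finite sets of elements at \<open>n + k\<close>, which are
  identified with the and-nodes below the or-nodes below the root.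
\<close>

lemma rel_set_inductive_mono [mono]:
  "(\<And>x y. R x y \<longrightarrow> R' x y) \<Longrightarrow> rel_set R X Y \<longrightarrow> rel_set R' X Y"
  unfolding rel_set_def by blast

coinductive identified ::
  "('f, ('f, 'p, 'a) univ) ofunctor \<Rightarrow> ('f, ('f, 'p, 'a) univ) trans
    \<Rightarrow> ('f, ('f, 'p, 'a) univ) trans \<Rightarrow> nat \<Rightarrow> ('f, 'p, 'a) univ
    \<Rightarrow> (nat \<times> ('f, 'p) atom) and_tree \<Rightarrow> bool"
  for X :: "('f, ('f, 'p, 'a) univ) ofunctor"
    and eps gam :: "('f, ('f, 'p, 'a) univ) trans" where
  "x \<in> carr (ob X n) \<Longrightarrow>
   app eps n x = Atm A \<Longrightarrow>
   Tag k (FinSet S) \<in> summands X n \<Longrightarrow>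
   app gam n x = cls X n (Tag k (FinSet S)) \<Longrightarrow>
   rel_set
     (\<lambda>u ts. \<exists>s. u = FinSet s \<and> rel_set (\<lambda>y t. identified X eps gam (n + k) y t) (fset s) (set ts))
     (fset S) (set tss) \<Longrightarrow>
   identified X eps gam n x (And_Node (n, A) tss)"

end

theory Submission
  imports Defs "HOL-Library.Countable"
begin

text \<open>
  Spans of injections under \<open>n\<close> can be completed to commutative squares, so equality and order in the
  colimit \<open>P\<^sub>f\<^sub>f(H)(n)\<close> can be tested in a single summand. The cofree coalgebra on \<open>H\<close> is obtained from
  the possibly infinite trees whose nodes in context \<open>n\<close> carry an element of \<open>H(n)\<close>, a number \<open>k\<close> and
  finitely many finite families of subtrees in context \<open>n + k\<close>: it consists of their classes modulo
  bisimilarity, ordered by similarity, both taken up to renaming of the fresh variables. Arrows of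
  the Lawvere theory act on whole trees, which makes its structure map strictly natural; laxness
  enters only through the map into it that a lax coalgebra induces. Two elements of the
  cofree coalgebra identified with the same coinductive tree are bisimilar, hence equal, and any two
  cofree coalgebras are isomorphic.
\<close>

text \<open>Three obstacles shape the construction. The zigzags that generate equality and order in
  the colimit are useless as a step of a coinduction, which must hand on one comparison of subtrees;
  a single cospan of injections can be built into the definition of \<open>brel\<close>, and
  amalgamation is what makes the resulting relation transitive. Orders are only preorders, so
  mutually similar trees may differ in their labels and in their families of subtrees. The carrier
  is therefore divided by bisimilarity: \<open>eps\<close> and \<open>gam\<close> would not be well
  defined modulo mutual similarity. Everything has to live in the fixed type \<open>univ\<close>,
  which offers finite sets and sequences but no larger sets. Trees branch over lists, so that their
  nodes are addressed by countably many index paths, and a class is stored as the code of one chosen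
  member. The order and repetitions in the lists disappear in the quotient. Since transformations
  are strict on renamings and lax elsewhere, a lax coalgebra never compares two arbitrary arrows:
  one side of each comparison carries any arrow, the other side only a renaming.\<close>

lemma (in category) in_homD:
  assumes "f \<in> hom K x y"
  shows "f \<in> Arr K" "Dom K f = x" "Cod K f = y" "x \<in> Obj K" "y \<in> Obj K"
  using assms dom_cod by (auto simp: hom_def)

section \<open>From cofree coalgebras to the cofree comonad, over any category\<close>

locale cofree_coalgebras = endofunctor K FO FA
  for K :: "('o, 'a) cat" and FO :: "'o \<Rightarrow> 'o" and FA :: "'a \<Rightarrow> 'a" +
  fixes CO :: "'o \<Rightarrow> 'o" and eps gam :: "'o \<Rightarrow> 'a"
  assumes CO_obj: "x \<in> Obj K \<Longrightarrow> CO x \<in> Obj K"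
    and ep_hom: "x \<in> Obj K \<Longrightarrow> eps x \<in> hom K (CO x) x"
    and ga_hom: "x \<in> Obj K \<Longrightarrow> gam x \<in> hom K (CO x) (FO (CO x))"
    and universal: "x \<in> Obj K \<Longrightarrow> y \<in> Obj K \<Longrightarrow> c \<in> hom K y (FO y) \<Longrightarrow> f \<in> hom K y x \<Longrightarrow>
      \<exists>!h. h \<in> hom K y (CO x) \<and> Comp K (gam x) h = Comp K (FA h) c \<and> Comp K (eps x) h = f"
begin

text \<open>The codomain is always a cofree coalgebra \<open>gam x\<close>, because each comonad law
  compares two maps into one.\<close>

definition coalg_hom :: "'o \<Rightarrow> 'o \<Rightarrow> 'a \<Rightarrow> 'a \<Rightarrow> bool" where
  "coalg_hom x y c h \<longleftrightarrow> h \<in> hom K y (CO x) \<and> Comp K (gam x) h = Comp K (FA h) c"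

text \<open>The method behind the comonad laws: both sides are coalgebra maps, so it suffices to
  compare them after the counit.\<close>

lemma coalg_hom_unique:
  assumes "x \<in> Obj K" "c \<in> hom K y (FO y)" "coalg_hom x y c h" "coalg_hom x y c h'"
    "Comp K (eps x) h = Comp K (eps x) h'"
  shows "h = h'"
proof -
  have y: "y \<in> Obj K" using assms(2) in_homD by blast
  have "Comp K (eps x) h \<in> hom K y x"
    using assms(3) ep_hom[OF assms(1)] Comp_hom unfolding coalg_hom_def by blast
  from universal[OF assms(1) y assms(2) this] assms(3-5) show ?thesis
    unfolding coalg_hom_def by metis
qed

text \<open>Pastes the square of \<open>g\<close> to the square of \<open>h\<close>; functoriality
  of \<open>FA\<close> merges the two right-hand sides.\<close>

lemma coalg_hom_comp:
  assumes "x \<in> Obj K" "z \<in> Obj K" "c \<in> hom K y (FO y)" "d \<in> hom K w (FO w)"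
    and "coalg_hom x w d h" and "g \<in> hom K y w" "Comp K d g = Comp K (FA g) c"
  shows "coalg_hom x y c (Comp K h g)"
proof -
  have h: "h \<in> hom K w (CO x)" and gh: "Comp K (gam x) h = Comp K (FA h) d"
    using assms(5) by (auto simp: coalg_hom_def)
  have g: "gam x \<in> hom K (CO x) (FO (CO x))" using ga_hom assms(1) .
  have "Comp K (gam x) (Comp K h g) = Comp K (Comp K (FA h) d) g"
    using assoc[OF assms(6) h g] gh by simp
  also have "\<dots> = Comp K (FA h) (Comp K (FA g) c)"
    using assoc[OF assms(6) assms(4) F_hom[OF h]] assms(7) by simp
  also have "\<dots> = Comp K (FA (Comp K h g)) c"
    using assoc[OF assms(3) F_hom[OF assms(6)] F_hom[OF h]] F_Comp[OF assms(6) h] by simp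
  finally show ?thesis using Comp_hom[OF assms(6) h] by (simp add: coalg_hom_def)
qed

lemma ex_coalg_hom:
  assumes "x \<in> Obj K" "c \<in> hom K y (FO y)" "f \<in> hom K y x"
  shows "\<exists>!h. coalg_hom x y c h \<and> Comp K (eps x) h = f"
  using universal[OF assms(1) _ assms(2,3)] in_homD[OF assms(2)] unfolding coalg_hom_def
  by (simp add: conj_assoc)

text \<open>The choice is forced: \<open>cofree_comonad\<close> requires a coalgebra map for which
  \<open>eps\<close> is natural, and these two conditions have one solution. In the same way
  \<open>delta\<close> is forced by \<open>counit_left\<close>.\<close>

definition CA :: "'a \<Rightarrow> 'a" where
  "CA f = (THE h. coalg_hom (Cod K f) (CO (Dom K f)) (gam (Dom K f)) h \<and>
     Comp K (eps (Cod K f)) h = Comp K f (eps (Dom K f)))"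

definition delta :: "'o \<Rightarrow> 'a" where
  "delta x = (THE h. coalg_hom (CO x) (CO x) (gam x) h \<and> Comp K (eps (CO x)) h = Id K (CO x))"

lemma CA:
  assumes "f \<in> hom K x y"
  shows "coalg_hom y (CO x) (gam x) (CA f)" "Comp K (eps y) (CA f) = Comp K f (eps x)"
proof -
  have xy: "x \<in> Obj K" "y \<in> Obj K" "Dom K f = x" "Cod K f = y" using in_homD[OF assms] by auto
  from theI'[OF ex_coalg_hom[OF xy(2) ga_hom[OF xy(1)] Comp_hom[OF ep_hom[OF xy(1)] assms]]]
  show "coalg_hom y (CO x) (gam x) (CA f)" "Comp K (eps y) (CA f) = Comp K f (eps x)"
    unfolding CA_def xy by auto
qed

lemma delta:
  assumes "x \<in> Obj K"
  shows "coalg_hom (CO x) (CO x) (gam x) (delta x)" "Comp K (eps (CO x)) (delta x) = Id K (CO x)"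
  using theI'[OF ex_coalg_hom[OF CO_obj[OF assms] ga_hom[OF assms] Id_hom[OF CO_obj[OF assms]]]]
  unfolding delta_def by auto

lemmas CA_hom = CA(1)[unfolded coalg_hom_def, THEN conjunct1]
lemmas delta_hom = delta(1)[unfolded coalg_hom_def, THEN conjunct1]

lemma coalg_hom_Id: "x \<in> Obj K \<Longrightarrow> coalg_hom x (CO x) (gam x) (Id K (CO x))"
  unfolding coalg_hom_def
  using Id_hom CO_obj F_Id Comp_Id[OF ga_hom] Id_Comp[OF ga_hom] by auto

lemma coalg_hom_after:
  assumes "x \<in> Obj K" "coalg_hom z (CO x) (gam x) h" "coalg_hom x y c g" "z \<in> Obj K"
    "c \<in> hom K y (FO y)"
  shows "coalg_hom z y c (Comp K h g)"
  using coalg_hom_comp[OF assms(4,4,5) ga_hom[OF assms(1)] assms(2)] assms(3)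
  by (auto simp: coalg_hom_def)

lemma eps_CA_delta:
  assumes "f \<in> hom K x y" "g \<in> hom K w (CO x)"
  shows "Comp K (eps y) (Comp K (CA f) g) = Comp K f (Comp K (eps x) g)"
  using in_homD[OF assms(1)] assoc[OF assms(2) CA_hom[OF assms(1)] ep_hom[of y]]
    assoc[OF assms(2) ep_hom[of x] assms(1)] CA(2)[OF assms(1)] by simp

lemma eps_delta:
  assumes "x \<in> Obj K" "g \<in> hom K w (CO x)"
  shows "Comp K (eps (CO x)) (Comp K (delta x) g) = g"
  using assoc[OF assms(2) delta_hom[OF assms(1)] ep_hom[OF CO_obj[OF assms(1)]]] delta(2)[OF assms(1)]
    Id_Comp[OF assms(2)] by simp

lemma CA_Id: "x \<in> Obj K \<Longrightarrow> CA (Id K x) = Id K (CO x)"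
  using coalg_hom_unique[OF _ ga_hom CA(1)[OF Id_hom] coalg_hom_Id] CA(2)[OF Id_hom]
    Id_Comp[OF ep_hom] Comp_Id[OF ep_hom] by metis

lemma CA_Comp:
  assumes f: "f \<in> hom K x y" and g: "g \<in> hom K y z"
  shows "CA (Comp K g f) = Comp K (CA g) (CA f)"
proof -
  have o: "x \<in> Obj K" "y \<in> Obj K" "z \<in> Obj K" using in_homD f g by auto
  have "Comp K (eps z) (Comp K (CA g) (CA f)) = Comp K g (Comp K f (eps x))"
    using eps_CA_delta[OF g CA_hom[OF f]] CA(2)[OF f] by simp
  also have "\<dots> = Comp K (Comp K g f) (eps x)" using assoc[OF ep_hom[OF o(1)] f g] .
  also have "\<dots> = Comp K (eps z) (CA (Comp K g f))" using CA(2)[OF Comp_hom[OF f g]] by simp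
  finally show ?thesis
    using coalg_hom_unique[OF o(3) ga_hom[OF o(1)] CA(1)[OF Comp_hom[OF f g]]
        coalg_hom_after[OF o(2) CA(1)[OF g] CA(1)[OF f] o(3) ga_hom[OF o(1)]]] by simp
qed

lemma delta_natural:
  assumes f: "f \<in> hom K x y"
  shows "Comp K (delta y) (CA f) = Comp K (CA (CA f)) (delta x)"
proof -
  have o: "x \<in> Obj K" "y \<in> Obj K" using in_homD f by auto
  have cf: "CA f \<in> hom K (CO x) (CO y)" using CA_hom[OF f] .
  have "Comp K (eps (CO y)) (Comp K (CA (CA f)) (delta x)) = CA f"
    using eps_CA_delta[OF cf delta_hom[OF o(1)]] delta(2)[OF o(1)] Comp_Id[OF cf] by simp
  then show ?thesis
    using coalg_hom_unique[OF CO_obj[OF o(2)] ga_hom[OF o(1)]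
        coalg_hom_after[OF o(2) delta(1)[OF o(2)] CA(1)[OF f] CO_obj[OF o(2)] ga_hom[OF o(1)]]
        coalg_hom_after[OF CO_obj[OF o(1)] CA(1)[OF cf] delta(1)[OF o(1)] CO_obj[OF o(2)] ga_hom[OF o(1)]]]
      eps_delta[OF o(2) cf] by simp
qed

lemma counit_right:
  assumes x: "x \<in> Obj K"
  shows "Comp K (CA (eps x)) (delta x) = Id K (CO x)"
proof (rule coalg_hom_unique[OF x ga_hom[OF x]])
  show "coalg_hom x (CO x) (gam x) (Comp K (CA (eps x)) (delta x))"
    using coalg_hom_after[OF CO_obj[OF x] CA(1)[OF ep_hom[OF x]] delta(1)[OF x] x ga_hom[OF x]] .
  show "coalg_hom x (CO x) (gam x) (Id K (CO x))" using coalg_hom_Id[OF x] .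
  show "Comp K (eps x) (Comp K (CA (eps x)) (delta x)) = Comp K (eps x) (Id K (CO x))"
    using eps_CA_delta[OF ep_hom[OF x] delta_hom[OF x]] delta(2)[OF x] by simp
qed

lemma coassoc:
  assumes x: "x \<in> Obj K"
  shows "Comp K (delta (CO x)) (delta x) = Comp K (CA (delta x)) (delta x)"
proof (rule coalg_hom_unique[OF CO_obj[OF CO_obj[OF x]] ga_hom[OF x]])
  note c = CO_obj[OF x] and cc = CO_obj[OF CO_obj[OF x]]
  note d = delta_hom[OF x]
  show "coalg_hom (CO (CO x)) (CO x) (gam x) (Comp K (delta (CO x)) (delta x))"
    using coalg_hom_after[OF c delta(1)[OF c] delta(1)[OF x] cc ga_hom[OF x]] .
  show "coalg_hom (CO (CO x)) (CO x) (gam x) (Comp K (CA (delta x)) (delta x))"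
    using coalg_hom_after[OF c CA(1)[OF d] delta(1)[OF x] cc ga_hom[OF x]] .
  show "Comp K (eps (CO (CO x))) (Comp K (delta (CO x)) (delta x)) =
    Comp K (eps (CO (CO x))) (Comp K (CA (delta x)) (delta x))"
    using eps_CA_delta[OF d d] delta(2)[OF x] eps_delta[OF c d] Comp_Id[OF d] by simp
qed

theorem cofree_comonad: "cofree_comonad K FO FA CO CA eps delta gam"
proof
  fix x y z c f g
  show "f \<in> hom K x y \<Longrightarrow> Comp K (gam y) (CA f) = Comp K (FA (CA f)) (gam x)"
    using CA(1) unfolding coalg_hom_def by blast
  show "x \<in> Obj K \<Longrightarrow> Comp K (gam (CO x)) (delta x) = Comp K (FA (delta x)) (gam x)"
    using delta(1) unfolding coalg_hom_def by blast
qed (use CO_obj ep_hom ga_hom CA_hom CA(2) CA_Id CA_Comp delta_hom delta(2) delta_natural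
    counit_right coassoc universal in simp_all)

end

text \<open>Makes the universal property available under \<open>cof\<close> for an arbitrary cofree
  comonad, not only for the one constructed later; the final theorem quantifies over all of
  them.\<close>

sublocale cofree_comonad \<subseteq> cof: cofree_coalgebras K FO FA CO eps gam
  by unfold_locales (use F_obj eps_hom gam_hom cofree in blast)+

context cofree_comonad
begin

text \<open>Both \<open>delta x\<close> after \<open>h\<close> and \<open>CA h\<close> after
  \<open>h\<close> are coalgebra maps into the cofree coalgebra on \<open>CO x\<close>, and both
  become \<open>h\<close> after the counit; so they agree. The coalgebra \<open>c\<close> is
  recovered because \<open>FA (eps x)\<close> cancels \<open>FA h\<close>.\<close>

lemma coalg_hom_comonad_coalgebra:
  assumes x: "x \<in> Obj K" and c: "c \<in> hom K x (FO x)"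
    and h: "cof.coalg_hom x x c h" and e: "Comp K (eps x) h = Id K x"
  shows "corresponding_coalgebra K FA CO CA eps delta gam x c h"
proof -
  have hh: "h \<in> hom K x (CO x)" and gh: "Comp K (gam x) h = Comp K (FA h) c"
    using h by (auto simp: cof.coalg_hom_def)
  note gx = gam_hom[OF x] and ex = eps_hom[OF x] and dx = delta_hom[OF x]
  have CAh: "CA h \<in> hom K (CO x) (CO (CO x))" using F_hom[OF hh] .
  have "cof.coalg_hom (CO x) (CO x) (gam x) (delta x)" "cof.coalg_hom (CO x) (CO x) (gam x) (CA h)"
    using delta_coalgebra_map[OF x] CA_coalgebra_map[OF hh] dx CAh by (auto simp: cof.coalg_hom_def)
  moreover have "Comp K (eps (CO x)) (Comp K (delta x) h) = h"
    using base.assoc[OF hh dx eps_hom[OF F_obj[OF x]]] counit_left[OF x] base.Id_Comp[OF hh] by simp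
  moreover have "Comp K (eps (CO x)) (Comp K (CA h) h) = h"
    using base.assoc[OF hh CAh eps_hom[OF F_obj[OF x]]] eps_natural[OF hh] base.assoc[OF hh ex hh] e base.Comp_Id[OF hh]
    by simp
  ultimately have "Comp K (delta x) h = Comp K (CA h) h"
    using cof.coalg_hom_unique[OF F_obj[OF x] c] cof.coalg_hom_after[OF x _ h F_obj[OF x] c] by metis
  moreover have "Comp K (Comp K (FA (eps x)) (gam x)) h = c"
    using base.assoc[OF hh gx base.F_hom[OF ex]] gh base.assoc[OF c base.F_hom[OF hh] base.F_hom[OF ex]]
      base.F_Comp[OF hh ex] e base.F_Id[OF x] base.Id_Comp[OF c] by simp
  ultimately show ?thesis
    using hh e by (simp add: corresponding_coalgebra_def comonad_coalgebra_def)
qed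

text \<open>Write \<open>c\<close> as the projection after \<open>h\<close>. Naturality of
  \<open>eps\<close> turns \<open>h\<close> after \<open>eps x\<close> into
  \<open>eps (CO x)\<close> after \<open>CA h\<close>; being coalgebra maps that agree after
  \<open>h\<close>, \<open>CA h\<close> and \<open>delta x\<close> can be exchanged, and
  \<open>counit_left\<close> then cancels \<open>delta x\<close>.\<close>

lemma corresponding_coalgebra_coalg_hom:
  assumes x: "x \<in> Obj K" and c: "c \<in> hom K x (FO x)"
    and "corresponding_coalgebra K FA CO CA eps delta gam x c h"
  shows "cof.coalg_hom x x c h" "Comp K (eps x) h = Id K x"
proof -
  have h: "h \<in> hom K x (CO x)" and e: "Comp K (eps x) h = Id K x"
    and d: "Comp K (delta x) h = Comp K (CA h) h"
    and p: "Comp K (Comp K (FA (eps x)) (gam x)) h = c"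
    using assms(3) by (auto simp: corresponding_coalgebra_def comonad_coalgebra_def)
  show "Comp K (eps x) h = Id K x" by (fact e)
  note gx = gam_hom[OF x] and ex = eps_hom[OF x] and dx = delta_hom[OF x]
  note Cx = F_obj[OF x]
  note gC = gam_hom[OF Cx] and eC = eps_hom[OF Cx]
  have CAh: "CA h \<in> hom K (CO x) (CO (CO x))" using F_hom[OF h] .
  note gh = base.Comp_hom[OF h gx]
  have "Comp K (FA h) c = Comp K (FA h) (Comp K (FA (eps x)) (Comp K (gam x) h))"
    using p base.assoc[OF h gx base.F_hom[OF ex]] by simp
  also have "\<dots> = Comp K (FA (Comp K (eps (CO x)) (CA h))) (Comp K (gam x) h)"
    using base.assoc[OF gh base.F_hom[OF ex] base.F_hom[OF h]] base.F_Comp[OF ex h] eps_natural[OF h]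
    by simp
  also have "\<dots> = Comp K (FA (eps (CO x))) (Comp K (Comp K (FA (CA h)) (gam x)) h)"
    using base.F_Comp[OF CAh eC] base.assoc[OF gh base.F_hom[OF CAh] base.F_hom[OF eC]]
      base.assoc[OF h gx base.F_hom[OF CAh]] by simp
  also have "\<dots> = Comp K (FA (eps (CO x))) (Comp K (gam (CO x)) (Comp K (delta x) h))"
    using CA_coalgebra_map[OF h] base.assoc[OF h CAh gC] d by simp
  also have "\<dots> = Comp K (FA (eps (CO x))) (Comp K (FA (delta x)) (Comp K (gam x) h))"
    using base.assoc[OF h dx gC] delta_coalgebra_map[OF x] base.assoc[OF h gx base.F_hom[OF dx]] by simp
  also have "\<dots> = Comp K (gam x) h"
    using base.assoc[OF gh base.F_hom[OF dx] base.F_hom[OF eC]] base.F_Comp[OF dx eC]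
      counit_left[OF x] base.F_Id[OF Cx] base.Id_Comp[OF gh] by simp
  finally show "cof.coalg_hom x x c h" using h by (simp add: cof.coalg_hom_def)
qed

text \<open>Replaces the comonadic description of the corresponding coalgebra by the universal
  property: it is the unique coalgebra map whose composite with the counit is the identity.\<close>

theorem corresponding_coalgebra_iff:
  assumes "x \<in> Obj K" "c \<in> hom K x (FO x)"
  shows "corresponding_coalgebra K FA CO CA eps delta gam x c h \<longleftrightarrow>
    cof.coalg_hom x x c h \<and> Comp K (eps x) h = Id K x"
  using coalg_hom_comonad_coalgebra[OF assms] corresponding_coalgebra_coalg_hom[OF assms] by blast

theorem ex1_corresponding_coalgebra:
  assumes "x \<in> Obj K" "c \<in> hom K x (FO x)"
  shows "\<exists>!h. corresponding_coalgebra K FA CO CA eps delta gam x c h"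
  unfolding corresponding_coalgebra_iff[OF assms] using cof.ex_coalg_hom[OF assms base.Id_hom[OF assms(1)]] .

end

section \<open>Substitution and renamings\<close>

lemma subst_cong: "(\<And>x. x \<in> vars t \<Longrightarrow> \<sigma> x = \<tau> x) \<Longrightarrow> subst \<sigma> t = subst \<tau> t"
  by (induction t) auto

lemma subst_Var: "(\<And>x. x \<in> vars t \<Longrightarrow> \<sigma> x = Var x) \<Longrightarrow> subst \<sigma> t = t"
  by (induction t) (auto intro: map_idI)

lemma subst_subst: "subst \<sigma> (subst \<tau> t) = subst (\<lambda>x. subst \<sigma> (\<tau> x)) t"
  by (induction t) auto

lemma vars_subst: "vars (subst \<sigma> t) = (\<Union>x\<in>vars t. vars (\<sigma> x))"
  by (induction t) auto

lemma wf_trm_subst: "wf_trm Sg t \<Longrightarrow> (\<And>x. x \<in> vars t \<Longrightarrow> wf_trm Sg (\<sigma> x)) \<Longrightarrow> wf_trm Sg (subst \<sigma> t)"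
  by (induction t) auto

lemma law_length: "f \<in> law Sg n m \<Longrightarrow> length f = m"
  by (simp add: law_def)

lemma law_id_law: "law_id n \<in> law Sg n n"
  by (auto simp: law_def law_id_def)

lemma law_comp_law:
  assumes "f \<in> law Sg n m" "g \<in> law Sg m l"
  shows "law_comp g f \<in> law Sg n l"
proof -
  have "wf_trm Sg (subst (tuple_subst f) t) \<and> vars (subst (tuple_subst f) t) \<subseteq> {..<n}" if "t \<in> set g" for t
  proof -
    have "vars t \<subseteq> {..<m}" "wf_trm Sg t" using that assms(2) by (auto simp: law_def)
    moreover have "wf_trm Sg (f ! x) \<and> vars (f ! x) \<subseteq> {..<n}" if "x < m" for x
      using that assms(1) by (auto simp: law_def)
    ultimately show ?thesis
      by (auto simp: vars_subst tuple_subst_def subset_iff intro!: wf_trm_subst)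
  qed
  then show ?thesis using assms(2) by (auto simp: law_def law_comp_def)
qed

lemma J_law: "i ` {..<n} \<subseteq> {..<m} \<Longrightarrow> J n i \<in> law Sg m n"
  by (auto simp: law_def J_def image_subset_iff)

lemma injections_J_law: "i \<in> injections n m \<Longrightarrow> J n i \<in> law Sg m n"
  by (simp add: injections_def J_law)

lemma J_cong: "(\<And>x. x < n \<Longrightarrow> i x = j x) \<Longrightarrow> J n i = J n j"
  by (simp add: J_def)

lemma J_id: "J n (\<lambda>x. x) = law_id n"
  by (simp add: J_def law_id_def)

lemma law_comp_J_left: "law_comp (J n i) f = map (\<lambda>x. f ! i x) [0..<n]"
  by (simp add: law_comp_def J_def tuple_subst_def)

lemma law_comp_J_J: "i ` {..<n} \<subseteq> {..<m} \<Longrightarrow> law_comp (J n i) (J m j) = J n (\<lambda>x. j (i x))"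
  unfolding law_comp_J_left by (auto simp: J_def image_subset_iff)

section \<open>Injections that fix a context, and arrows extended by fresh variables\<close>

lemma injections_id: "(\<lambda>x. x) \<in> injections n n"
  by (auto simp: injections_def)

lemma injections_comp: "i \<in> injections n m \<Longrightarrow> j \<in> injections m l \<Longrightarrow> (\<lambda>x. j (i x)) \<in> injections n l"
  unfolding injections_def inj_on_def by (fastforce simp: image_subset_iff)

text \<open>The arrows of the index category of the colimit: exactly the injections that
  \<open>inj_step\<close> allows.\<close>

definition inj_under :: "nat \<Rightarrow> nat \<Rightarrow> nat \<Rightarrow> (nat \<Rightarrow> nat) set" where
  "inj_under n k m = {i \<in> injections (n + k) (n + m). \<forall>x<n. i x = x}"

lemma inj_underD:
  assumes "i \<in> inj_under n k m"
  shows "i \<in> injections (n + k) (n + m)" "x < n \<Longrightarrow> i x = x" "x < n + k \<Longrightarrow> i x < n + m"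
    "x < n + k \<Longrightarrow> y < n + k \<Longrightarrow> i x = i y \<longleftrightarrow> x = y" "n \<le> x \<Longrightarrow> x < n + k \<Longrightarrow> n \<le> i x"
proof -
  show i: "i \<in> injections (n + k) (n + m)" and fx: "x < n \<Longrightarrow> i x = x" for x
    using assms by (auto simp: inj_under_def)
  show "x < n + k \<Longrightarrow> i x < n + m" using i by (auto simp: injections_def)
  show eq: "x < n + k \<Longrightarrow> y < n + k \<Longrightarrow> i x = i y \<longleftrightarrow> x = y" for x y
    using i by (auto simp: injections_def inj_on_def)
  \<comment> \<open>If \<open>i x\<close> were below \<open>n\<close> it would be a fixed point, so
    \<open>i (i x) = i x\<close>, and injectivity would give \<open>i x = x\<close>.\<close>
  show "n \<le> x \<Longrightarrow> x < n + k \<Longrightarrow> n \<le> i x"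
    using eq[of x "i x"] fx[of "i x"] by (cases "i x < n") auto
qed

lemma inj_under_id: "k \<le> m \<Longrightarrow> (\<lambda>x. x) \<in> inj_under n k m"
  by (auto simp: injections_def inj_under_def)

lemma inj_under_comp:
  "i \<in> inj_under n k m \<Longrightarrow> j \<in> inj_under n m l \<Longrightarrow>
    (\<lambda>x. j (i x)) \<in> inj_under n k l"
  unfolding inj_under_def using injections_comp by fastforce

text \<open>The apex need not be a pushout, so it can be taken generously as
  \<open>n + (m + m')\<close>: one leg is the inclusion, the other follows \<open>i\<close> where
  commutation demands it and moves all remaining variables out of the way.\<close>

lemma amalgamation:
  assumes i: "i \<in> inj_under n k m" and j: "j \<in> inj_under n k m'"
  obtains p d d' where "d \<in> inj_under n m p" "d' \<in> inj_under n m' p"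
    "\<And>x. x < n + k \<Longrightarrow> d (i x) = d' (j x)"
proof -
  define inv where "inv = the_inv_into {..<n + k} j"
  \<comment> \<open>A variable outside the image of \<open>j\<close> is at least \<open>n\<close>,
    since \<open>j\<close> fixes everything below. Adding \<open>m\<close> therefore lands at or
    above \<open>n + m\<close>, clear of the values of \<open>i\<close>.\<close>
  define d' where "d' x = (if x \<in> j ` {..<n + k} then i (inv x) else x + m)" for x
  have inv: "inv (j y) = y" if "y < n + k" for y
    unfolding inv_def using that inj_underD(4)[OF j]
    by (intro the_inv_into_f_f) (auto simp: inj_on_def)
  have d'j: "d' (j y) = i y" if "y < n + k" for y using that inv by (auto simp: d'_def)
  have fx: "d' x = x" if "x < n" for x
    using d'j[of x] inj_underD(2)[OF i that] inj_underD(2)[OF j that] that by simp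
  have big: "n \<le> x" if "x \<notin> j ` {..<n + k}" for x
    using that inj_underD(2)[OF j, of x] by (metis imageI lessThan_iff linorder_not_less trans_less_add1)
  have lt: "d' x < n + m" if "x \<in> j ` {..<n + k}" for x
    using that d'j inj_underD(3)[OF i] by auto
  have "inj_on d' {..<n + m'}"
  proof (rule inj_onI)
    fix x y assume eq: "d' x = d' y"
    show "x = y"
    proof (cases "x \<in> j ` {..<n + k}"; cases "y \<in> j ` {..<n + k}")
      assume "x \<in> j ` {..<n + k}" "y \<in> j ` {..<n + k}"
      then show ?thesis using eq d'j inj_underD(4)[OF i] by auto
    next
      assume "x \<in> j ` {..<n + k}" "y \<notin> j ` {..<n + k}"
      then show ?thesis using eq lt[of x] big[of y] by (simp add: d'_def)
    next
      assume "x \<notin> j ` {..<n + k}" "y \<in> j ` {..<n + k}"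
      then show ?thesis using eq lt[of y] big[of x] by (simp add: d'_def)
    qed (use eq in \<open>simp add: d'_def\<close>)
  qed
  moreover have "d' x < n + (m + m')" if "x < n + m'" for x
    using that lt[of x] by (cases "x \<in> j ` {..<n + k}") (auto simp: d'_def)
  ultimately have "d' \<in> inj_under n m' (m + m')"
    using fx by (auto simp: inj_under_def injections_def)
  moreover have "(\<lambda>x. x) \<in> inj_under n m (m + m')" by (simp add: inj_under_id)
  ultimately show ?thesis using that d'j by metis
qed

lemma law_plus_law: "f \<in> law Sg n' n \<Longrightarrow> law_plus n' f k \<in> law Sg (n' + k) (n + k)"
  by (fastforce simp: law_def law_plus_def)

lemma law_plus_nth:
  "length f = n \<Longrightarrow> x < n + k \<Longrightarrow> law_plus n' f k ! x = (if x < n then f ! x else Var (n' + (x - n)))"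
  by (simp add: law_plus_def nth_append)

lemma law_plus_id: "law_plus n (law_id n) k = law_id (n + k)"
  by (rule nth_equalityI) (auto simp: law_plus_def law_id_def nth_append)

lemma law_plus_comp:
  assumes f: "f \<in> law Sg n m" and g: "g \<in> law Sg m l"
  shows "law_plus n (law_comp g f) k = law_comp (law_plus m g k) (law_plus n f k)"
proof (rule nth_equalityI)
  fix x assume "x < length (law_plus n (law_comp g f) k)"
  then have x: "x < l + k" using g by (simp add: law_plus_def law_comp_def law_def)
  have lens: "length f = m" "length g = l" "length (law_comp g f) = l"
    using f g by (auto simp: law_def law_comp_def)
  show "law_plus n (law_comp g f) k ! x = law_comp (law_plus m g k) (law_plus n f k) ! x"
  proof (cases "x < l")
    case True
    then have "vars (g ! x) \<subseteq> {..<m}" using g by (auto simp: law_def)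
    then have "subst (tuple_subst f) (g ! x) = subst (tuple_subst (law_plus n f k)) (g ! x)"
      by (intro subst_cong) (auto simp: tuple_subst_def law_plus_nth[OF lens(1)])
    then show ?thesis using True lens x
      by (simp add: law_plus_nth[OF lens(3) x] law_comp_def law_plus_def nth_append)
  next
    case False
    then obtain y where y: "x = l + y" using le_Suc_ex not_less by blast
    then have "law_plus m g k ! x = Var (m + y)" "law_plus n f k ! (m + y) = Var (n + y)"
      using x y by (simp_all add: law_plus_nth[OF lens(2)] law_plus_nth[OF lens(1)])
    moreover have "law_comp (law_plus m g k) (law_plus n f k) ! x =
        subst (tuple_subst (law_plus n f k)) (law_plus m g k ! x)"
      using x lens unfolding law_comp_def by (intro nth_map) (simp add: law_plus_def)
    ultimately show ?thesis using x y by (simp add: law_plus_nth[OF lens(3)] tuple_subst_def)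
  qed
qed (use g in \<open>simp add: law_plus_def law_comp_def\<close>)

definition extend_injection :: "nat \<Rightarrow> nat \<Rightarrow> (nat \<Rightarrow> nat) \<Rightarrow> nat \<Rightarrow> nat" where
  "extend_injection n m i x = (if x < n then i x else m + (x - n))"

lemma extend_injection:
  assumes "i \<in> injections n m"
  shows "extend_injection n m i \<in> injections (n + k) (m + k)"
proof -
  have lt: "i x < m" if "x < n" for x using assms that by (auto simp: injections_def)
  have "inj_on (extend_injection n m i) {..<n + k}"
  proof (rule inj_onI)
    fix x y assume "extend_injection n m i x = extend_injection n m i y"
    moreover have "i x = i y \<Longrightarrow> x < n \<Longrightarrow> y < n \<Longrightarrow> x = y"
      using assms by (simp add: injections_def inj_on_def)
    ultimately show "x = y"
      using lt[of x] lt[of y] unfolding extend_injection_def by (cases "x < n"; cases "y < n") simp_all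
  qed
  moreover have "extend_injection n m i x < m + k" if "x < n + k" for x
    using lt[of x] that by (auto simp: extend_injection_def)
  ultimately show ?thesis by (auto simp: injections_def)
qed

text \<open>For a renaming \<open>f\<close> the arrow \<open>f + k\<close> is again a renaming. This
  is why strictness on injections is inherited by \<open>Pff_arr\<close> and by the behaviour
  map.\<close>

lemma law_plus_J: "law_plus m (J n i) k = J (n + k) (extend_injection n m i)"
  by (rule nth_equalityI) (auto simp: law_plus_def J_def extend_injection_def nth_append)

text \<open>An injection that fixes \<open>n\<close> only rearranges fresh variables, so the same
  rearrangement can be made above \<open>n'\<close>. The commuting square makes the action of
  \<open>f\<close> on the colimit independent of the representative.\<close>

lemma law_plus_fixing_injection:
  assumes f: "f \<in> law Sg n' n" and i: "i \<in> inj_under n k m"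
  obtains i' where "i' \<in> inj_under n' k m"
    "law_comp (J (n + k) i) (law_plus n' f m) = law_comp (law_plus n' f k) (J (n' + k) i')"
proof
  \<comment> \<open>\<open>i\<close> conjugated by the shift between the two blocks of fresh
    variables. The subtraction of \<open>n\<close> loses nothing, as \<open>i\<close> keeps fresh
    variables at or above \<open>n\<close>.\<close>
  define i' where "i' x = (if x < n' then x else n' + (i (n + (x - n')) - n))" for x
  note iD = inj_underD[OF i]
  have big: "n \<le> i (n + (x - n'))" if "n' \<le> x" "x < n' + k" for x
    using that iD(5)[of "n + (x - n')"] by auto
  have lt: "i (n + (x - n')) < n + m" if "n' \<le> x" "x < n' + k" for x
    using that iD(3)[of "n + (x - n')"] by auto
  have "inj_on i' {..<n' + k}"
  proof (rule inj_onI)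
    fix x y assume xy: "x \<in> {..<n' + k}" "y \<in> {..<n' + k}" "i' x = i' y"
    show "x = y"
    proof (cases "n' \<le> x \<and> n' \<le> y")
      case True
      then have "i (n + (x - n')) = i (n + (y - n'))"
        using xy big[of x] big[of y] by (simp add: i'_def)
      moreover have "n + (x - n') < n + k" "n + (y - n') < n + k" using True xy(1,2) by auto
      ultimately have "n + (x - n') = n + (y - n')" using iD(4) by blast
      then show ?thesis using True by linarith
    qed (use xy in \<open>auto simp: i'_def split: if_splits\<close>)
  qed
  moreover have "i' x < n' + m" if "x < n' + k" for x
    using lt[of x] big[of x] that by (cases "n' \<le> x") (simp_all add: i'_def)
  moreover have "i' x = x" if "x < n'" for x using that by (simp add: i'_def)
  ultimately show "i' \<in> inj_under n' k m"
    by (auto simp: inj_under_def injections_def)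
  show "law_comp (J (n + k) i) (law_plus n' f m) = law_comp (law_plus n' f k) (J (n' + k) i')"
  proof (rule nth_equalityI)
    fix x assume "x < length (law_comp (J (n + k) i) (law_plus n' f m))"
    then have x: "x < n + k" by (simp add: law_comp_J_left)
    note lf = law_length[OF f]
    have L: "law_comp (J (n + k) i) (law_plus n' f m) ! x = law_plus n' f m ! i x"
      using x by (simp add: law_comp_J_left)
    have R: "law_comp (law_plus n' f k) (J (n' + k) i') ! x =
        subst (tuple_subst (J (n' + k) i')) (law_plus n' f k ! x)"
      using x lf unfolding law_comp_def by (intro nth_map) (simp add: law_plus_def)
    show "law_comp (J (n + k) i) (law_plus n' f m) ! x = law_comp (law_plus n' f k) (J (n' + k) i') ! x"
    proof (cases "x < n")
      case True
      then have "vars (f ! x) \<subseteq> {..<n'}" using f by (auto simp: law_def)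
      then have "subst (tuple_subst (J (n' + k) i')) (f ! x) = f ! x"
        by (intro subst_Var) (auto simp: tuple_subst_def J_def i'_def)
      then show ?thesis unfolding L R using True lf iD(2) by (simp add: law_plus_nth)
    next
      case False
      then obtain y where y: "x = n + y" using le_Suc_ex not_less by blast
      then have "\<not> i x < n" "i x < n + m" using iD(3)[OF x] iD(5)[of x] x by auto
      then show ?thesis unfolding L R using y x lf
        by (simp add: law_plus_nth tuple_subst_def J_def i'_def)
    qed
  qed (use law_length[OF f] in \<open>simp add: law_comp_def law_plus_def J_def\<close>)
qed

type_synonym ('f, 'p, 'a) ufunctor = "('f, ('f, 'p, 'a) univ) ofunctor"
type_synonym ('f, 'p, 'a) utrans = "('f, ('f, 'p, 'a) univ) trans"

section \<open>Finite sets of finite sets\<close>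

text \<open>Elements of the double powerset as plain sets of sets. The arguments below take place
  here; \<open>pp\<close> and \<open>unpp\<close> translate to and from the universe.\<close>

definition finite_finite :: "'u set \<Rightarrow> 'u set set set" where
  "finite_finite X = {SS. finite SS \<and> (\<forall>s\<in>SS. finite s \<and> s \<subseteq> X)}"

text \<open>The element of \<open>P\<^sub>f P\<^sub>f\<close> with the given members.\<close>

definition pp :: "('f, 'p, 'a) univ set set \<Rightarrow> ('f, 'p, 'a) univ" where
  "pp SS = FinSet (Abs_fset ((\<lambda>s. FinSet (Abs_fset s)) ` SS))"

fun unfin :: "('f, 'p, 'a) univ \<Rightarrow> ('f, 'p, 'a) univ set" where
  "unfin (FinSet s) = fset s"
| "unfin _ = {}"

definition unpp :: "('f, 'p, 'a) univ \<Rightarrow> ('f, 'p, 'a) univ set set" where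
  "unpp u = unfin ` unfin u"

lemma finite_finiteD: "SS \<in> finite_finite X \<Longrightarrow> s \<in> SS \<Longrightarrow> x \<in> s \<Longrightarrow> x \<in> X"
  by (auto simp: finite_finite_def)

lemma finite_finite_image:
  "SS \<in> finite_finite X \<Longrightarrow> (\<And>x. x \<in> X \<Longrightarrow> h x \<in> Y) \<Longrightarrow> image h ` SS \<in> finite_finite Y"
  by (simp add: finite_finite_def image_subset_iff) blast

lemma unpp_pp:
  assumes "SS \<in> finite_finite X"
  shows "unpp (pp SS) = SS"
proof -
  have "finite SS" "\<And>s. s \<in> SS \<Longrightarrow> unfin (FinSet (Abs_fset s)) = s"
    using assms by (simp_all add: finite_finite_def Abs_fset_inverse)
  then show ?thesis by (simp add: unpp_def pp_def Abs_fset_inverse image_image)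
qed

lemma pp_inject: "SS \<in> finite_finite X \<Longrightarrow> TT \<in> finite_finite Y \<Longrightarrow> pp SS = pp TT \<longleftrightarrow> SS = TT"
  using unpp_pp by metis

lemma carr_Pf: "carr (Pf X) = {FinSet s |s. fset s \<subseteq> carr X}"
  by (simp add: Pf_def)

lemma carr_Pf_Pf: "carr (Pf (Pf X)) = pp ` finite_finite (carr X)"
proof (intro subset_antisym subsetI)
  fix S assume "S \<in> carr (Pf (Pf X))"
  then obtain s where S: "S = FinSet s" and s: "fset s \<subseteq> carr (Pf X)"
    unfolding carr_Pf[of "Pf X"] by blast
  have u: "FinSet (Abs_fset (unfin u)) = u \<and> finite (unfin u) \<and> unfin u \<subseteq> carr X" if us: "u \<in> fset s" for u
  proof -
    obtain t where "u = FinSet t" "fset t \<subseteq> carr X"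
      using us s unfolding carr_Pf[of X] by blast
    then show ?thesis by (simp add: fset_inverse)
  qed
  then have "unfin ` fset s \<in> finite_finite (carr X)" by (auto simp: finite_finite_def)
  moreover have "(\<lambda>u. FinSet (Abs_fset (unfin u))) ` fset s = (\<lambda>u. u) ` fset s"
    using u by (intro image_cong) auto
  then have "pp (unfin ` fset s) = S" by (simp add: S pp_def image_image fset_inverse)
  ultimately show "S \<in> pp ` finite_finite (carr X)" by blast
next
  fix S assume "S \<in> pp ` finite_finite (carr X)"
  then obtain SS where SS: "finite SS" "\<And>s. s \<in> SS \<Longrightarrow> finite s \<and> s \<subseteq> carr X" "S = pp SS"
    by (auto simp: finite_finite_def)
  have "FinSet (Abs_fset s) \<in> carr (Pf X)" if "s \<in> SS" for s
    using SS(2)[OF that] unfolding carr_Pf by (simp add: Abs_fset_inverse)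
  then have "fset (Abs_fset ((\<lambda>s. FinSet (Abs_fset s)) ` SS)) \<subseteq> carr (Pf X)"
    using SS(1) by (simp add: Abs_fset_inverse image_subset_iff)
  then show "S \<in> carr (Pf (Pf X))" unfolding carr_Pf[of "Pf X"] SS(3) pp_def by blast
qed

lemma Pf_map_Pf_map:
  assumes "SS \<in> finite_finite X"
  shows "Pf_map (Pf_map h) (pp SS) = pp (image h ` SS)"
proof -
  have "Pf_map h (FinSet (Abs_fset s)) = FinSet (Abs_fset (h ` s))" if "s \<in> SS" for s
  proof -
    have "finite s" using that assms by (simp add: finite_finite_def)
    then have "fset (h |`| Abs_fset s) = fset (Abs_fset (h ` s))" by (simp add: Abs_fset_inverse)
    then have "h |`| Abs_fset s = Abs_fset (h ` s)" by (simp only: fset_inject)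
    then show ?thesis by simp
  qed
  moreover have "finite SS" using assms by (simp add: finite_finite_def)
  ultimately have "fset (Pf_map h |`| Abs_fset ((\<lambda>s. FinSet (Abs_fset s)) ` SS)) =
      (\<lambda>s. FinSet (Abs_fset s)) ` (image h ` SS)"
    by (simp add: Abs_fset_inverse image_image)
  then show ?thesis unfolding pp_def by (metis Pf_map.simps fset_inverse)
qed

text \<open>
  The flag \<open>e\<close> here and below lets one argument serve both for equality (\<open>e\<close>) and for the order
  (\<open>\<not> e\<close>): these are the two relation liftings of \<open>P\<^sub>f P\<^sub>f\<close>.
\<close>

definition nest :: "bool \<Rightarrow> ('u \<Rightarrow> 'v \<Rightarrow> bool) \<Rightarrow> 'u set set \<Rightarrow> 'v set set \<Rightarrow> bool" where
  "nest e R X Y \<longleftrightarrow>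
     (if e then rel_set (rel_set R) X Y else \<forall>s\<in>X. \<exists>t\<in>Y. \<forall>x\<in>s. \<exists>y\<in>t. R x y)"

lemma leq_Pf: "leq (Pf X) (FinSet s) (FinSet t) \<longleftrightarrow> (\<forall>x\<in>fset s. \<exists>y\<in>fset t. leq X x y)"
  by (simp add: Pf_def)

lemma leq_Pf_Pf:
  assumes "SS \<in> finite_finite X" "TT \<in> finite_finite Y"
  shows "leq (Pf (Pf Z)) (pp SS) (pp TT) \<longleftrightarrow> nest False (leq Z) SS TT"
proof -
  have fin: "finite SS" "finite TT" "\<And>s. s \<in> SS \<Longrightarrow> finite s" "\<And>t. t \<in> TT \<Longrightarrow> finite t"
    using assms by (auto simp: finite_finite_def)
  then have "leq (Pf Z) (FinSet (Abs_fset s)) (FinSet (Abs_fset t)) \<longleftrightarrow> (\<forall>x\<in>s. \<exists>y\<in>t. leq Z x y)"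
    if "s \<in> SS" "t \<in> TT" for s t using that by (simp add: leq_Pf Abs_fset_inverse)
  then show ?thesis
    using fin(1,2) by (simp add: leq_Pf pp_def nest_def Abs_fset_inverse)
qed

lemma nest_mono_strong:
  assumes "nest e R X Y" "\<And>s t x y. s \<in> X \<Longrightarrow> t \<in> Y \<Longrightarrow> x \<in> s \<Longrightarrow> y \<in> t \<Longrightarrow> R x y \<Longrightarrow> S x y"
  shows "nest e S X Y"
proof (cases e)
  case True
  have "rel_set S s t" if "s \<in> X" "t \<in> Y" "rel_set R s t" for s t
    using that(3) assms(2)[OF that(1,2)] unfolding rel_set_def by fast
  then have "rel_set (rel_set S) X Y" if "rel_set (rel_set R) X Y"
    using that unfolding rel_set_def[of "rel_set R"] rel_set_def[of "rel_set S"] by fast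
  then show ?thesis using assms(1) True by (simp add: nest_def)
next
  case False
  show ?thesis unfolding nest_def
  proof (simp add: False, intro ballI)
    fix s assume s: "s \<in> X"
    then obtain t where "t \<in> Y" "\<forall>x\<in>s. \<exists>y\<in>t. R x y"
      using assms(1) False unfolding nest_def by auto
    then show "\<exists>t\<in>Y. \<forall>x\<in>s. \<exists>y\<in>t. S x y" using assms(2)[OF s] by fast
  qed
qed

text \<open>Needed for the coinductive definition of \<open>brel\<close>, whose recursive occurrence
  is under \<open>nest\<close>.\<close>

lemma nest_mono [mono]: "(\<And>x y. R x y \<longrightarrow> S x y) \<Longrightarrow> nest e R X Y \<longrightarrow> nest e S X Y"
  using nest_mono_strong[of e R X Y S] by blast

lemma nest_trans:
  assumes "nest e R X Y" "nest e S Y Z" "\<And>x y z. R x y \<Longrightarrow> S y z \<Longrightarrow> T x z"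
  shows "nest e T X Z"
proof (cases e)
  case True
  then have "rel_set (rel_set (R OO S)) X Z" using assms(1,2) unfolding nest_def rel_set_OO[symmetric] by auto
  then have "nest e (R OO S) X Z" using True by (simp add: nest_def)
  then show ?thesis by (rule nest_mono_strong) (use assms(3) in blast)
next
  case False
  show ?thesis unfolding nest_def
  proof (simp add: False, intro ballI)
    fix s assume "s \<in> X"
    then obtain t where t: "t \<in> Y" "\<And>x. x \<in> s \<Longrightarrow> \<exists>y\<in>t. R x y"
      using assms(1) False unfolding nest_def by auto
    then obtain u where "u \<in> Z" "\<And>y. y \<in> t \<Longrightarrow> \<exists>z\<in>u. S y z"
      using assms(2) False unfolding nest_def by auto
    then show "\<exists>u\<in>Z. \<forall>x\<in>s. \<exists>y\<in>u. T x y" using t(2) assms(3) by blast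
  qed
qed

text \<open>The computation rule used throughout: pushing families forward amounts to pulling the
  relation back.\<close>

lemma nest_image: "nest e R (image f ` X) (image g ` Y) \<longleftrightarrow> nest e (\<lambda>x y. R (f x) (g y)) X Y"
  by (simp add: nest_def rel_set_def)

lemma nest_refl: "(\<And>s x. s \<in> X \<Longrightarrow> x \<in> s \<Longrightarrow> R x x) \<Longrightarrow> nest e R X X"
  unfolding nest_def rel_set_def by (simp, blast)

lemma nest_weaken: "nest e R X Y \<Longrightarrow> nest False R X Y"
  unfolding nest_def rel_set_def by (simp split: if_splits) metis

lemma nest_eq: "nest True (=) X Y \<longleftrightarrow> X = Y"
  by (simp add: nest_def rel_set_eq)

lemma nest_eqD: "nest True R X Y \<Longrightarrow> (\<And>x y. R x y \<Longrightarrow> x = y) \<Longrightarrow> X = Y"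
  using nest_mono_strong[of True R X Y "(=)"] nest_eq by blast

lemma rel_set_flip: "rel_set (\<lambda>y x. R x y) = (\<lambda>B A. rel_set R A B)"
  by (intro ext) (simp add: rel_set_def conj_commute)

lemma nest_flip: "nest True R X Y \<Longrightarrow> nest True (\<lambda>x y. R y x) Y X"
  by (simp add: nest_def rel_set_flip[of R] rel_set_flip[of "rel_set R"])

section \<open>Ordered functors\<close>

abbreviation el :: "('f, 'u) ofunctor \<Rightarrow> nat \<Rightarrow> 'u set" where
  "el H n \<equiv> carr (ob H n)"

abbreviation fsets :: "('f, 'u) ofunctor \<Rightarrow> nat \<Rightarrow> 'u set set set" where
  "fsets H n \<equiv> finite_finite (el H n)"

text \<open>The covariant action of an injection \<open>i\<close> from \<open>n\<close> to
  \<open>m\<close>; the contexts appear in the opposite order in \<open>act\<close>, because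
  \<open>J n i\<close> is an arrow from \<open>m\<close> to \<open>n\<close>.\<close>

definition ren :: "('f, 'u) ofunctor \<Rightarrow> nat \<Rightarrow> nat \<Rightarrow> (nat \<Rightarrow> nat) \<Rightarrow> 'u \<Rightarrow> 'u" where
  "ren H n m i = act H m n (J n i)"

lemma ren_cong: "(\<And>x. x < n \<Longrightarrow> i x = j x) \<Longrightarrow> ren H n m i = ren H n m j"
  unfolding ren_def using J_cong by metis

definition eq_or_leq :: "bool \<Rightarrow> ('f, 'u) ofunctor \<Rightarrow> nat \<Rightarrow> 'u \<Rightarrow> 'u \<Rightarrow> bool" where
  "eq_or_leq e H n x y \<longleftrightarrow>
     x \<in> el H n \<and> y \<in> el H n \<and> (if e then x = y else leq (ob H n) x y)"

context
  fixes Sg :: "('f, 'p) sig" and H :: "('f, 'u) ofunctor"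
  assumes H: "is_ofunctor Sg H"
begin

lemma act_carr: "f \<in> law Sg n m \<Longrightarrow> a \<in> el H m \<Longrightarrow> act H n m f a \<in> el H n"
  using H unfolding is_ofunctor_def monotone_map_def by blast

lemma act_leq: "f \<in> law Sg n m \<Longrightarrow> a \<in> el H m \<Longrightarrow> b \<in> el H m \<Longrightarrow>
    leq (ob H m) a b \<Longrightarrow> leq (ob H n) (act H n m f a) (act H n m f b)"
  using H unfolding is_ofunctor_def monotone_map_def by blast

lemma act_id: "a \<in> el H n \<Longrightarrow> act H n n (law_id n) a = a"
  using H unfolding is_ofunctor_def by blast

lemma act_comp: "f \<in> law Sg n m \<Longrightarrow> g \<in> law Sg m l \<Longrightarrow> a \<in> el H l \<Longrightarrow>
    act H n l (law_comp g f) a = act H n m f (act H m l g a)"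
  using H unfolding is_ofunctor_def by blast

lemma leq_refl: "a \<in> el H n \<Longrightarrow> leq (ob H n) a a"
  using H unfolding is_ofunctor_def is_ord_set_def by (meson reflp_onD)

lemma leq_trans: "a \<in> el H n \<Longrightarrow> b \<in> el H n \<Longrightarrow> c \<in> el H n \<Longrightarrow>
    leq (ob H n) a b \<Longrightarrow> leq (ob H n) b c \<Longrightarrow> leq (ob H n) a c"
  using H unfolding is_ofunctor_def is_ord_set_def by (meson transp_onD)

lemma ren_carr: "i \<in> injections n m \<Longrightarrow> a \<in> el H n \<Longrightarrow> ren H n m i a \<in> el H m"
  unfolding ren_def using act_carr injections_J_law by blast

lemma ren_id: "a \<in> el H n \<Longrightarrow> ren H n n (\<lambda>x. x) a = a"
  unfolding ren_def J_id by (rule act_id)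

lemma ren_ren:
  assumes "i \<in> injections n m" "j \<in> injections m l" "a \<in> el H n"
  shows "ren H m l j (ren H n m i a) = ren H n l (\<lambda>x. j (i x)) a"
proof -
  have "law_comp (J n i) (J m j) = J n (\<lambda>x. j (i x))"
    using assms(1) by (intro law_comp_J_J) (simp add: injections_def)
  then show ?thesis unfolding ren_def
    using act_comp[OF injections_J_law[OF assms(2)] injections_J_law[OF assms(1)] assms(3)] by metis
qed

lemma eq_or_leq_refl: "a \<in> el H n \<Longrightarrow> eq_or_leq e H n a a"
  by (simp add: eq_or_leq_def leq_refl)

lemma eq_or_leq_trans: "eq_or_leq e H n a b \<Longrightarrow> eq_or_leq e H n b c \<Longrightarrow> eq_or_leq e H n a c"
  unfolding eq_or_leq_def using leq_trans by (metis (full_types))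

lemma eq_or_leq_act:
  "f \<in> law Sg n m \<Longrightarrow> eq_or_leq e H m a b \<Longrightarrow> eq_or_leq e H n (act H n m f a) (act H n m f b)"
  unfolding eq_or_leq_def using act_carr act_leq by (metis (full_types))

lemma eq_or_leq_ren:
  "i \<in> injections n m \<Longrightarrow> eq_or_leq e H n a b \<Longrightarrow> eq_or_leq e H m (ren H n m i a) (ren H n m i b)"
  unfolding ren_def by (intro eq_or_leq_act injections_J_law)

lemma image_ren_finite_finite: "i \<in> injections n m \<Longrightarrow> SS \<in> fsets H n \<Longrightarrow>
    image (ren H n m i) ` SS \<in> fsets H m"
  by (erule finite_finite_image) (rule ren_carr)

lemma image_ren_id: "SS \<in> fsets H n \<Longrightarrow> image (ren H n n (\<lambda>x. x)) ` SS = SS"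
  by (force simp: finite_finite_def ren_id image_def subset_iff)

lemma image_ren_ren: "i \<in> injections n m \<Longrightarrow> j \<in> injections m l \<Longrightarrow>
    SS \<in> fsets H n \<Longrightarrow>
    image (ren H m l j) ` image (ren H n m i) ` SS = image (ren H n l (\<lambda>x. j (i x))) ` SS"
  unfolding image_image
  by (intro image_cong refl ren_ren) (auto dest: finite_finiteD)

text \<open>The two comparisons meet in \<open>TT\<close> but take place in different contexts.
  Amalgamating the legs out of \<open>TT\<close> moves both to one context, where the two images of
  \<open>TT\<close> coincide. The conclusion keeps the composite of \<open>Q\<close> with itself,
  since one use is the coinductive proof that \<open>brel\<close> is transitive.\<close>

lemma nest_amalgamation:
  assumes SS: "SS \<in> fsets H (n + k)" and TT: "TT \<in> fsets H (n + k')"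
    and UU: "UU \<in> fsets H (n + k'')"
    and i: "i \<in> inj_under n k m" and j: "j \<in> inj_under n k' m"
    and i': "i' \<in> inj_under n k' m'" and j': "j' \<in> inj_under n k'' m'"
    and 1: "nest e (Q (n + m)) (image (ren H (n + k) (n + m) i) ` SS) (image (ren H (n + k') (n + m) j) ` TT)"
    and 2: "nest e (Q (n + m')) (image (ren H (n + k') (n + m') i') ` TT) (image (ren H (n + k'') (n + m') j') ` UU)"
    and Q: "\<And>i m l x y. i \<in> injections m l \<Longrightarrow> Q m x y \<Longrightarrow> Q l (ren H m l i x) (ren H m l i y)"
  shows "\<exists>p a b. a \<in> inj_under n k p \<and> b \<in> inj_under n k'' p \<and>
    nest e (\<lambda>x z. \<exists>y. Q (n + p) x y \<and> Q (n + p) y z)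
      (image (ren H (n + k) (n + p) a) ` SS) (image (ren H (n + k'') (n + p) b) ` UU)"
proof -
  obtain p d d' where d: "d \<in> inj_under n m p" and d': "d' \<in> inj_under n m' p"
    and eq: "\<And>x. x < n + k' \<Longrightarrow> d (j x) = d' (i' x)"
    by (rule amalgamation[OF j i']) (rule that)
  note inj = inj_underD(1)
  have push: "nest e (Q (n + p)) (image (ren H (n + l) (n + p) (\<lambda>x. g (a x))) ` X)
      (image (ren H (n + l') (n + p) (\<lambda>x. g (b x))) ` Y)"
    if "nest e (Q (n + q)) (image (ren H (n + l) (n + q) a) ` X) (image (ren H (n + l') (n + q) b) ` Y)"
      and g: "g \<in> inj_under n q p" and a: "a \<in> inj_under n l q" and b: "b \<in> inj_under n l' q"
      and X: "X \<in> fsets H (n + l)" and Y: "Y \<in> fsets H (n + l')"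
    for q l l' g a b X Y
  proof -
    have "nest e (Q (n + p)) (image (ren H (n + q) (n + p) g) ` image (ren H (n + l) (n + q) a) ` X)
        (image (ren H (n + q) (n + p) g) ` image (ren H (n + l') (n + q) b) ` Y)"
      unfolding nest_image[of e _ "ren H (n + q) (n + p) g"]
      by (rule nest_mono_strong[OF that(1)]) (rule Q[OF inj[OF g]])
    then show ?thesis
      unfolding image_ren_ren[OF inj[OF a] inj[OF g] X] image_ren_ren[OF inj[OF b] inj[OF g] Y] .
  qed
  \<comment> \<open>The square commutes below \<open>n + k'\<close> only, and \<open>ren\<close>
    does not look any further.\<close>
  have c: "ren H (n + k') (n + p) (\<lambda>x. d (j x)) = ren H (n + k') (n + p) (\<lambda>x. d' (i' x))"
    by (rule ren_cong) (rule eq)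
  have "nest e (\<lambda>x z. \<exists>y. Q (n + p) x y \<and> Q (n + p) y z)
      (image (ren H (n + k) (n + p) (\<lambda>x. d (i x))) ` SS) (image (ren H (n + k'') (n + p) (\<lambda>x. d' (j' x))) ` UU)"
    by (rule nest_trans[OF push[OF 1 d i j SS TT, unfolded c] push[OF 2 d' i' j' TT UU]]) blast
  then show ?thesis using inj_under_comp[OF i d] inj_under_comp[OF j' d'] by blast
qed

end

abbreviation push :: "('f, 'u) ofunctor \<Rightarrow> nat \<Rightarrow> nat \<Rightarrow> nat \<Rightarrow> (nat \<Rightarrow> nat) \<Rightarrow> 'u set \<Rightarrow> 'u set" where
  "push H n k m i \<equiv> image (ren H (n + k) (n + m) i)"

section \<open>The colimit\<close>

lemma summands_pp: "summands H n = {Tag k (pp SS) | k SS. SS \<in> fsets H (n + k)}"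
  by (auto simp: summands_def carr_Pf_Pf)

lemma inj_step_pp: "inj_step H n u v \<longleftrightarrow>
  (\<exists>k k' i SS. i \<in> inj_under n k k' \<and> SS \<in> fsets H (n + k) \<and>
     u = Tag k (pp SS) \<and> v = Tag k' (pp (push H n k k' i ` SS)))"
  unfolding inj_step_def inj_under_def ren_def carr_Pf_Pf
  by (auto simp: Pf_map_Pf_map)

lemma summand_leq_pp: "summand_leq H n u v \<longleftrightarrow>
  (\<exists>k SS TT. SS \<in> fsets H (n + k) \<and> TT \<in> fsets H (n + k) \<and>
     u = Tag k (pp SS) \<and> v = Tag k (pp TT) \<and> nest False (leq (ob H (n + k))) SS TT)"
  unfolding summand_leq_def carr_Pf_Pf by (auto simp: leq_Pf_Pf)

definition colim_rel ::
  "bool \<Rightarrow> ('f, 'p, 'a) ufunctor \<Rightarrow> nat \<Rightarrow> ('f, 'p, 'a) univ \<Rightarrow> ('f, 'p, 'a) univ \<Rightarrow> bool" where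
  "colim_rel e H n = (if e then equivclp (inj_step H n) else leq (colim H n))"

text \<open>The single-summand form of \<open>colim_rel\<close>: two injections into one context
  replace a zigzag of arbitrary length.\<close>

definition cospan_rel ::
  "bool \<Rightarrow> ('f, 'p, 'a) ufunctor \<Rightarrow> nat \<Rightarrow> nat \<Rightarrow> ('f, 'p, 'a) univ set set \<Rightarrow>
     nat \<Rightarrow> ('f, 'p, 'a) univ set set \<Rightarrow> bool" where
  "cospan_rel e H n k SS k' TT \<longleftrightarrow> (\<exists>m i j. i \<in> inj_under n k m \<and> j \<in> inj_under n k' m \<and>
     nest e (eq_or_leq e H (n + m))
       (push H n k m i ` SS) (push H n k' m j ` TT))"

lemma equivclp_le_colim: "equivclp (inj_step H n) u v \<Longrightarrow> leq (colim H n) u v"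
  unfolding equivclp_def colim_def ord_set.simps by (erule rtranclp_mono[THEN predicate2D, rotated]) (rule sup_ge1)

context
  fixes Sg :: "('f, 'q) sig" and H :: "('f, 'p, 'a) ufunctor"
  assumes H: "is_ofunctor Sg H"
begin

lemma nest_eq_or_leq_refl: "SS \<in> fsets H n \<Longrightarrow> nest e (eq_or_leq e H n) SS SS"
  by (rule nest_refl) (auto intro: eq_or_leq_refl[OF H] dest: finite_finiteD)

lemma cospan_relI:
  "SS \<in> fsets H (n + k) \<Longrightarrow> TT \<in> fsets H (n + k) \<Longrightarrow>
    nest e (eq_or_leq e H (n + k)) SS TT \<Longrightarrow> cospan_rel e H n k SS k TT"
  unfolding cospan_rel_def
  by (intro exI[of _ k] exI[of _ "\<lambda>x. x"]) (simp add: inj_under_id image_ren_id[OF H])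

lemma cospan_rel_refl: "SS \<in> fsets H (n + k) \<Longrightarrow> cospan_rel e H n k SS k SS"
  by (intro cospan_relI nest_eq_or_leq_refl)

lemma cospan_rel_trans:
  assumes SS: "SS \<in> fsets H (n + k)"
    and TT: "TT \<in> fsets H (n + k')"
    and UU: "UU \<in> fsets H (n + k'')"
    and "cospan_rel e H n k SS k' TT" "cospan_rel e H n k' TT k'' UU"
  shows "cospan_rel e H n k SS k'' UU"
proof -
  obtain m i j where ij: "i \<in> inj_under n k m" "j \<in> inj_under n k' m"
    and 1: "nest e (eq_or_leq e H (n + m))
      (push H n k m i ` SS) (push H n k' m j ` TT)"
    using assms(4) unfolding cospan_rel_def by blast
  obtain m' i' j' where ij': "i' \<in> inj_under n k' m'" "j' \<in> inj_under n k'' m'"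
    and 2: "nest e (eq_or_leq e H (n + m'))
      (push H n k' m' i' ` TT) (push H n k'' m' j' ` UU)"
    using assms(5) unfolding cospan_rel_def by blast
  obtain p a b where ab: "a \<in> inj_under n k p" "b \<in> inj_under n k'' p"
    and nest: "nest e (\<lambda>x z. \<exists>y. eq_or_leq e H (n + p) x y \<and> eq_or_leq e H (n + p) y z)
      (push H n k p a ` SS) (push H n k'' p b ` UU)"
    using nest_amalgamation[OF H SS TT UU ij ij' 1 2 eq_or_leq_ren[OF H]] by blast
  have "nest e (eq_or_leq e H (n + p)) (push H n k p a ` SS) (push H n k'' p b ` UU)"
    by (rule nest_mono_strong[OF nest]) (blast intro: eq_or_leq_trans[OF H])
  then show ?thesis unfolding cospan_rel_def using ab by blast
qed

lemma inj_step_cospan_rel: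
  assumes i: "i \<in> inj_under n k k'" and SS: "SS \<in> fsets H (n + k)"
  defines "TT \<equiv> push H n k k' i ` SS"
  shows "cospan_rel e H n k SS k' TT" "cospan_rel e H n k' TT k SS"
    "TT \<in> fsets H (n + k')"
proof -
  show TT: "TT \<in> fsets H (n + k')"
    unfolding TT_def using image_ren_finite_finite[OF H inj_underD(1)[OF i] SS] .
  note refl = nest_eq_or_leq_refl[OF TT, of e]
  show "cospan_rel e H n k SS k' TT"
    unfolding cospan_rel_def
    by (intro exI[of _ k'] exI[of _ i] exI[of _ "\<lambda>x. x"])
      (simp add: i inj_under_id image_ren_id[OF H TT] refl flip: TT_def)
  show "cospan_rel e H n k' TT k SS"
    unfolding cospan_rel_def
    by (intro exI[of _ k'] exI[of _ i] exI[of _ "\<lambda>x. x"])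
      (simp add: i inj_under_id image_ren_id[OF H TT] refl flip: TT_def)
qed

lemma inj_step_summands: "inj_step H n u v \<Longrightarrow> u \<in> summands H n \<and> v \<in> summands H n"
  unfolding inj_step_pp summands_pp using inj_step_cospan_rel(3) by blast

lemma equivclp_summands:
  assumes "equivclp (inj_step H n) u v"
  shows "u \<in> summands H n \<longleftrightarrow> v \<in> summands H n"
  using assms by (induction rule: equivclp_induct) (use inj_step_summands in blast)+

text \<open>Each step of the zigzag is a cospan, and cospans compose by amalgamation. Consecutive
  steps share their middle family because \<open>pp\<close> is injective.\<close>

lemma colim_rel_cospan_rel:
  assumes "colim_rel e H n u v" "u \<in> summands H n"
  shows "\<exists>k SS k' TT. u = Tag k (pp SS) \<and> v = Tag k' (pp TT) \<and>
    SS \<in> fsets H (n + k) \<and> TT \<in> fsets H (n + k') \<and>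
    cospan_rel e H n k SS k' TT"
    (is "?Q u v")
proof -
  have step_Q: "?Q v w \<and> ?Q w v" if vw: "inj_step H n v w" for v w
  proof -
    obtain k k' i SS where i: "i \<in> inj_under n k k'"
      and SS: "SS \<in> fsets H (n + k)" and "v = Tag k (pp SS)"
      and "w = Tag k' (pp (push H n k k' i ` SS))"
      using vw unfolding inj_step_pp by auto
    then show ?thesis using inj_step_cospan_rel[OF i SS] by blast
  qed
  \<comment> \<open>With \<open>bot\<close> in place of the order on summands the same closure
    describes equality, so one induction serves both values of \<open>e\<close>.\<close>
  have "(sup (symclp (inj_step H n)) (if e then bot else summand_leq H n))\<^sup>*\<^sup>* u v"
    using assms(1) by (simp add: colim_rel_def colim_def equivclp_def split: if_splits)
  then show ?thesis
  proof induction
    case base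
    then show ?case using assms(2) cospan_rel_refl unfolding summands_pp by blast
  next
    case (step v w)
    have "?Q v w"
    proof (cases "symclp (inj_step H n) v w")
      case True
      then have "inj_step H n v w \<or> inj_step H n w v" by (simp add: symclp_def)
      then show ?thesis using step_Q by blast
    next
      case False
      then have "summand_leq H n v w" "\<not> e" using step by (auto split: if_splits)
      then obtain k SS TT where *: "SS \<in> fsets H (n + k)"
        "TT \<in> fsets H (n + k)" "v = Tag k (pp SS)" "w = Tag k (pp TT)"
        "nest False (leq (ob H (n + k))) SS TT" unfolding summand_leq_pp by blast
      have "nest e (eq_or_leq e H (n + k)) SS TT"
        using *(5) \<open>\<not> e\<close> finite_finiteD[OF *(1)] finite_finiteD[OF *(2)]
        by simp (erule nest_mono_strong, simp add: eq_or_leq_def)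
      then show ?thesis using * cospan_relI by blast
    qed
    then obtain k' TT k'' UU where 2: "v = Tag k' (pp TT)" "w = Tag k'' (pp UU)"
      "TT \<in> fsets H (n + k')" "UU \<in> fsets H (n + k'')"
      "cospan_rel e H n k' TT k'' UU" by blast
    moreover obtain k SS TT' where "u = Tag k (pp SS)" "SS \<in> fsets H (n + k)"
      "cospan_rel e H n k SS k' TT'" "pp TT' = pp TT" "TT' \<in> fsets H (n + k')"
      using step.IH 2(1) by auto
    moreover from this(4,5) have "TT' = TT" using pp_inject 2(3) by blast
    ultimately show ?case using cospan_rel_trans by blast
  qed
qed

lemma cospan_rel_colim_rel:
  assumes SS: "SS \<in> fsets H (n + k)"
    and TT: "TT \<in> fsets H (n + k')"
    and "cospan_rel e H n k SS k' TT"
  shows "colim_rel e H n (Tag k (pp SS)) (Tag k' (pp TT))"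
proof -
  obtain m i j where i: "i \<in> inj_under n k m" and j: "j \<in> inj_under n k' m"
    and nest: "nest e (eq_or_leq e H (n + m))
      (push H n k m i ` SS) (push H n k' m j ` TT)"
      (is "nest e _ ?S ?T")
    using assms(3) unfolding cospan_rel_def by blast
  have 1: "inj_step H n (Tag k (pp SS)) (Tag m (pp ?S))" "inj_step H n (Tag k' (pp TT)) (Tag m (pp ?T))"
    using i j SS TT unfolding inj_step_pp by blast+
  show ?thesis
  proof (cases e)
    case True
    then have "?S = ?T" using nest nest_eqD[of "eq_or_leq True H (n + m)"] by (simp add: eq_or_leq_def)
    with 1 have "equivclp (inj_step H n) (Tag k (pp SS)) (Tag m (pp ?S))"
      "equivclp (inj_step H n) (Tag m (pp ?S)) (Tag k' (pp TT))"
      unfolding equivclp_def symclp_def by (auto intro!: r_into_rtranclp)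
    then show ?thesis using True unfolding colim_rel_def by (simp add: equivclp_trans)
  next
    case False
    have fin: "?S \<in> fsets H (n + m)" "?T \<in> fsets H (n + m)"
      using inj_step_cospan_rel(3) i j SS TT by blast+
    have "nest False (leq (ob H (n + m))) ?S ?T"
      using nest False by simp (erule nest_mono_strong, simp add: eq_or_leq_def)
    then have "summand_leq H n (Tag m (pp ?S)) (Tag m (pp ?T))"
      using fin unfolding summand_leq_pp by blast
    then have "(sup (symclp (inj_step H n)) (summand_leq H n))\<^sup>*\<^sup>* (Tag k (pp SS)) (Tag k' (pp TT))"
      using 1 by (intro converse_rtranclp_into_rtranclp[OF _ converse_rtranclp_into_rtranclp[OF _ r_into_rtranclp]])
        (auto intro: symclpI)
    then show ?thesis using False by (simp add: colim_rel_def colim_def)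
  qed
qed

theorem colim_rel_iff:
  assumes "SS \<in> fsets H (n + k)" "TT \<in> fsets H (n + k')"
  shows "colim_rel e H n (Tag k (pp SS)) (Tag k' (pp TT)) \<longleftrightarrow> cospan_rel e H n k SS k' TT"
proof
  assume "colim_rel e H n (Tag k (pp SS)) (Tag k' (pp TT))"
  moreover have "Tag k (pp SS) \<in> summands H n" using assms(1) unfolding summands_pp by blast
  ultimately obtain SS' TT' where "pp SS = pp SS'" "pp TT = pp TT'" "cospan_rel e H n k SS' k' TT'"
    "SS' \<in> fsets H (n + k)" "TT' \<in> fsets H (n + k')"
    using colim_rel_cospan_rel[of e n] by (metis univ.inject(4))
  then show "cospan_rel e H n k SS k' TT"
    using pp_inject[OF assms(1)] pp_inject[OF assms(2)] by blast
qed (rule cospan_rel_colim_rel[OF assms])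

end

section \<open>Maps induced between colimits\<close>

definition tag_map :: "(nat \<Rightarrow> ('f, 'p, 'a) univ \<Rightarrow> ('f, 'p, 'a) univ) \<Rightarrow> ('f, 'p, 'a) univ \<Rightarrow> ('f, 'p, 'a) univ" where
  "tag_map h u = (case u of Tag k S \<Rightarrow> Tag k (Pf_map (Pf_map (h k)) S))"

lemma tag_map_pp: "SS \<in> finite_finite X \<Longrightarrow> tag_map h (Tag k (pp SS)) = Tag k (pp (image (h k) ` SS))"
  by (simp add: tag_map_def Pf_map_Pf_map)

lemma summandsE:
  assumes "u \<in> summands H n"
  obtains k SS where "SS \<in> fsets H (n + k)" "u = Tag k (pp SS)"
  using assms unfolding summands_pp by blast

lemma summandsI: "SS \<in> fsets H (n + k) \<Longrightarrow> Tag k (pp SS) \<in> summands H n"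
  unfolding summands_pp by blast

text \<open>What a family of maps between summands needs in order to descend to the colimits. It has
  two instances: the action of an arrow, where \<open>i'\<close> is the injection transported along
  \<open>law_plus_fixing_injection\<close>, and the components of a transformation, where strictness
  allows \<open>i' = i\<close>.\<close>

definition summand_map ::
  "('f, 'p, 'a) ufunctor \<Rightarrow> nat \<Rightarrow> ('f, 'p, 'a) ufunctor \<Rightarrow> nat \<Rightarrow>
    (nat \<Rightarrow> ('f, 'p, 'a) univ \<Rightarrow> ('f, 'p, 'a) univ) \<Rightarrow> bool" where
  "summand_map H n H' n' h \<longleftrightarrow>
     (\<forall>k. monotone_map (ob H (n + k)) (ob H' (n' + k)) (h k)) \<and>
     (\<forall>k m. \<forall>i\<in>inj_under n k m. \<exists>i'\<in>inj_under n' k m.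
        \<forall>x\<in>el H (n + k).
          h m (ren H (n + k) (n + m) i x) = ren H' (n' + k) (n' + m) i' (h k x))"

context
  fixes H H' :: "('f, 'p, 'a) ufunctor" and n n' h
  assumes h: "summand_map H n H' n' h"
begin

lemma summand_map_carr: "x \<in> el H (n + k) \<Longrightarrow> h k x \<in> el H' (n' + k)"
  using h unfolding summand_map_def monotone_map_def by blast

lemma summand_map_finite_finite:
  "SS \<in> fsets H (n + k) \<Longrightarrow> image (h k) ` SS \<in> fsets H' (n' + k)"
  by (erule finite_finite_image) (rule summand_map_carr)

lemma tag_map_summands: "u \<in> summands H n \<Longrightarrow> tag_map h u \<in> summands H' n'"
  by (erule summandsE) (simp add: tag_map_pp summandsI summand_map_finite_finite)

lemma tag_map_inj_step:
  assumes "inj_step H n u v"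
  shows "inj_step H' n' (tag_map h u) (tag_map h v)"
proof -
  obtain k m i SS where i: "i \<in> inj_under n k m" and SS: "SS \<in> fsets H (n + k)"
    and u: "u = Tag k (pp SS)" and v: "v = Tag m (pp (push H n k m i ` SS))"
    using assms unfolding inj_step_pp by auto
  obtain i' where i': "i' \<in> inj_under n' k m" and
    eq: "\<And>x. x \<in> el H (n + k) \<Longrightarrow>
      h m (ren H (n + k) (n + m) i x) = ren H' (n' + k) (n' + m) i' (h k x)"
    using h i unfolding summand_map_def by blast
  have "push H n k m i ` SS \<in> finite_finite UNIV"
    by (rule finite_finite_image[OF SS]) simp
  then have "tag_map h v = Tag m (pp (image (h m) ` push H n k m i ` SS))"
    unfolding v by (rule tag_map_pp)
  also have "image (h m) ` push H n k m i ` SS =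
      image (ren H' (n' + k) (n' + m) i') ` image (h k) ` SS"
    unfolding image_image using finite_finiteD[OF SS] by (intro image_cong refl eq)
  finally show ?thesis
    using i' summand_map_finite_finite[OF SS] unfolding u tag_map_pp[OF SS] inj_step_pp by blast
qed

lemma tag_map_equivclp:
  assumes "equivclp (inj_step H n) u v"
  shows "equivclp (inj_step H' n') (tag_map h u) (tag_map h v)"
  using assms
proof (induction rule: equivclp_induct)
  case (step y z)
  then have "inj_step H' n' (tag_map h y) (tag_map h z) \<or> inj_step H' n' (tag_map h z) (tag_map h y)"
    using tag_map_inj_step by blast
  then show ?case using step.IH by (rule equivclp_into_equivclp[rotated])
qed simp

lemma tag_map_summand_leq:
  assumes "summand_leq H n u v"
  shows "summand_leq H' n' (tag_map h u) (tag_map h v)"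
proof -
  obtain k SS TT where SS: "SS \<in> fsets H (n + k)"
    and TT: "TT \<in> fsets H (n + k)"
    and uv: "u = Tag k (pp SS)" "v = Tag k (pp TT)" and le: "nest False (leq (ob H (n + k))) SS TT"
    using assms unfolding summand_leq_pp by auto
  have "nest False (leq (ob H' (n' + k))) (image (h k) ` SS) (image (h k) ` TT)"
    unfolding nest_image using le
    by (rule nest_mono_strong)
      (use h finite_finiteD[OF SS] finite_finiteD[OF TT] in \<open>auto simp: summand_map_def monotone_map_def\<close>)
  then show ?thesis
    using summand_map_finite_finite SS TT unfolding uv tag_map_pp[OF SS] tag_map_pp[OF TT] summand_leq_pp
    by blast
qed

lemma tag_map_leq:
  assumes "leq (colim H n) u v"
  shows "leq (colim H' n') (tag_map h u) (tag_map h v)"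
proof -
  have "(sup (symclp (inj_step H n)) (summand_leq H n))\<^sup>*\<^sup>* u v"
    using assms by (simp add: colim_def)
  then have "(sup (symclp (inj_step H' n')) (summand_leq H' n'))\<^sup>*\<^sup>* (tag_map h u) (tag_map h v)"
  proof induction
    case (step y z)
    have "sup (symclp (inj_step H' n')) (summand_leq H' n') (tag_map h y) (tag_map h z)"
      using step.hyps(2) tag_map_inj_step tag_map_summand_leq by (auto simp: symclp_def)
    with step.IH show ?case by (rule rtranclp.rtrancl_into_rtrancl)
  qed simp
  then show ?thesis by (simp add: colim_def)
qed

end

lemma equivclp_cls: "equivclp (inj_step H n) u (cls H n u)"
  unfolding cls_def by (rule someI[of _ u]) simp

text \<open>Equivalent elements offer the same candidates to the choice in \<open>cls\<close>, hence
  have the same chosen member.\<close>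

lemma cls_eq_iff: "cls H n u = cls H n v \<longleftrightarrow> equivclp (inj_step H n) u v"
proof
  assume "cls H n u = cls H n v"
  then show "equivclp (inj_step H n) u v"
    using equivclp_cls[of H n u] equivclp_sym[OF equivclp_cls[of H n v]] equivclp_trans by metis
next
  assume "equivclp (inj_step H n) u v"
  then have "equivclp (inj_step H n) u = equivclp (inj_step H n) v"
    using equivp_evquivclp[of "inj_step H n"] by (simp add: equivp_def)
  then show "cls H n u = cls H n v" by (simp add: cls_def)
qed

lemma cls_cls [simp]: "cls H n (cls H n u) = cls H n u"
  unfolding cls_eq_iff by (rule equivclp_sym[OF equivclp_cls])

lemma colim_leq_refl: "leq (colim H n) u u"
  by (simp add: colim_def)

lemma colim_leq_trans: "leq (colim H n) u v \<Longrightarrow> leq (colim H n) v w \<Longrightarrow> leq (colim H n) u w"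
  unfolding colim_def by simp

lemma colim_leq_cls: "leq (colim H n) (cls H n u) (cls H n v) \<longleftrightarrow> leq (colim H n) u v"
  using equivclp_le_colim[OF equivclp_cls] equivclp_le_colim[OF equivclp_sym[OF equivclp_cls]]
    colim_leq_trans by metis

lemma carr_colim: "carr (colim H n) = cls H n ` summands H n"
  by (simp add: colim_def)

lemma cls_carr: "u \<in> summands H n \<Longrightarrow> cls H n u \<in> carr (colim H n)"
  by (simp add: carr_colim)

lemma cls_in_summands: "is_ofunctor Sg H \<Longrightarrow> cls H n u \<in> summands H n \<longleftrightarrow> u \<in> summands H n"
  using equivclp_summands[OF _ equivclp_cls] by metis

lemma carr_colimD:
  assumes "is_ofunctor Sg H" "u \<in> carr (colim H n)"
  shows "u \<in> summands H n" "cls H n u = u"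
  using assms cls_in_summands[OF assms(1)] unfolding carr_colim by auto

lemma summands_TagE: "u \<in> summands H n \<Longrightarrow> (\<And>k S. u = Tag k S \<Longrightarrow> Q) \<Longrightarrow> Q"
  by (auto simp: summands_def)

section \<open>The endofunctor\<close>

definition plus_act ::
  "('f, 'p, 'a) ufunctor \<Rightarrow> nat \<Rightarrow> nat \<Rightarrow> 'f trm list \<Rightarrow> nat \<Rightarrow> ('f, 'p, 'a) univ \<Rightarrow> ('f, 'p, 'a) univ" where
  "plus_act H n' n f k = act H (n' + k) (n + k) (law_plus n' f k)"

lemma ob_Pff [simp]: "ob (Pff_ob H) = colim H"
  by (simp add: Pff_ob_def)

lemma act_Pff: "u \<in> summands H n \<Longrightarrow> act (Pff_ob H) n' n f u = cls H n' (tag_map (plus_act H n' n f) u)"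
  by (erule summands_TagE) (simp add: Pff_ob_def tag_map_def plus_act_def)

lemma summand_map_plus_act:
  assumes H: "is_ofunctor Sg H" and f: "f \<in> law Sg n' n"
  shows "summand_map H n H n' (plus_act H n' n f)"
  unfolding summand_map_def
proof (intro conjI allI ballI)
  fix k show "monotone_map (ob H (n + k)) (ob H (n' + k)) (plus_act H n' n f k)"
    using H law_plus_law[OF f] unfolding is_ofunctor_def plus_act_def by blast
next
  fix k m i assume i: "i \<in> inj_under n k m"
  obtain i' where i': "i' \<in> inj_under n' k m" and
    eq: "law_comp (J (n + k) i) (law_plus n' f m) = law_comp (law_plus n' f k) (J (n' + k) i')"
    by (rule law_plus_fixing_injection[OF f i]) (rule that)
  have "plus_act H n' n f m (ren H (n + k) (n + m) i x) =
      ren H (n' + k) (n' + m) i' (plus_act H n' n f k x)" if x: "x \<in> el H (n + k)" for x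
    unfolding plus_act_def ren_def
    using act_comp[OF H law_plus_law[OF f] injections_J_law[OF inj_underD(1)[OF i]] x]
      act_comp[OF H injections_J_law[OF inj_underD(1)[OF i']] law_plus_law[OF f] x] eq by simp
  then show "\<exists>i'\<in>inj_under n' k m. \<forall>x\<in>el H (n + k).
      plus_act H n' n f m (ren H (n + k) (n + m) i x) =
        ren H (n' + k) (n' + m) i' (plus_act H n' n f k x)"
    using i' by blast
qed

lemma act_Pff_cls:
  assumes "is_ofunctor Sg H" "f \<in> law Sg n' n" "u \<in> summands H n"
  shows "act (Pff_ob H) n' n f (cls H n u) = cls H n' (tag_map (plus_act H n' n f) u)"
  using act_Pff cls_in_summands[OF assms(1)] assms(3)
    tag_map_equivclp[OF summand_map_plus_act[OF assms(1,2)] equivclp_sym[OF equivclp_cls]]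
  by (metis cls_eq_iff)

lemma tag_map_cong:
  assumes "u \<in> summands H n" "\<And>k x. x \<in> el H (n + k) \<Longrightarrow> h k x = h' k x"
  shows "tag_map h u = tag_map h' u"
proof -
  obtain k SS where SS: "SS \<in> fsets H (n + k)" "u = Tag k (pp SS)"
    by (rule summandsE[OF assms(1)])
  have "image (h k) ` SS = image (h' k) ` SS"
    using finite_finiteD[OF SS(1)] by (intro image_cong refl assms(2))
  then show ?thesis by (simp add: SS(2) tag_map_pp[OF SS(1)])
qed

lemma tag_map_id:
  assumes "u \<in> summands H n" "\<And>k x. x \<in> el H (n + k) \<Longrightarrow> h k x = x"
  shows "tag_map h u = u"
proof -
  obtain k SS where SS: "SS \<in> fsets H (n + k)" "u = Tag k (pp SS)"
    by (rule summandsE[OF assms(1)])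
  have "tag_map (\<lambda>k x. x) u = u" by (simp add: SS(2) tag_map_pp[OF SS(1)])
  then show ?thesis using tag_map_cong[OF assms(1), of h "\<lambda>k x. x"] assms(2) by simp
qed

lemma tag_map_tag_map:
  assumes "u \<in> summands H n"
  shows "tag_map g (tag_map h u) = tag_map (\<lambda>k x. g k (h k x)) u"
proof -
  obtain k SS where SS: "SS \<in> fsets H (n + k)" "u = Tag k (pp SS)"
    by (rule summandsE[OF assms(1)])
  have "image (h k) ` SS \<in> finite_finite UNIV" by (rule finite_finite_image[OF SS(1)]) simp
  then show ?thesis by (simp add: SS(2) tag_map_pp[OF SS(1)] tag_map_pp image_image)
qed

lemma Pff_ob_ofunctor:
  assumes H: "is_ofunctor Sg H"
  shows "is_ofunctor Sg (Pff_ob H)"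
  unfolding is_ofunctor_def ob_Pff
proof (intro conjI allI ballI)
  fix n show "is_ord_set (colim H n)"
    unfolding is_ord_set_def using colim_leq_refl colim_leq_trans
    by (metis reflp_onI transp_onI)
next
  fix n m f assume f: "f \<in> law Sg n m"
  note sm = summand_map_plus_act[OF H f]
  show "monotone_map (colim H m) (colim H n) (act (Pff_ob H) n m f)"
    unfolding monotone_map_def
  proof (intro conjI Pi_I ballI impI)
    fix u assume "u \<in> carr (colim H m)"
    then show "act (Pff_ob H) n m f u \<in> carr (colim H n)"
      using act_Pff tag_map_summands[OF sm] carr_colimD[OF H] cls_carr by metis
  next
    fix u v assume "u \<in> carr (colim H m)" "v \<in> carr (colim H m)" "leq (colim H m) u v"
    then show "leq (colim H n) (act (Pff_ob H) n m f u) (act (Pff_ob H) n m f v)"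
      using tag_map_leq[OF sm] by (simp add: act_Pff carr_colimD[OF H] colim_leq_cls)
  qed
next
  fix n u assume u: "u \<in> carr (colim H n)"
  have "tag_map (plus_act H n n (law_id n)) u = u"
    by (rule tag_map_id[OF carr_colimD(1)[OF H u]]) (simp add: plus_act_def law_plus_id act_id[OF H])
  then show "act (Pff_ob H) n n (law_id n) u = u"
    using act_Pff carr_colimD[OF H u] by metis
next
  fix n m l f g u
  assume f: "f \<in> law Sg n m" and g: "g \<in> law Sg m l" and u: "u \<in> carr (colim H l)"
  note u' = carr_colimD(1)[OF H u]
  have "tag_map (plus_act H n l (law_comp g f)) u =
      tag_map (plus_act H n m f) (tag_map (plus_act H m l g) u)"
    unfolding tag_map_tag_map[OF u'] plus_act_def
    by (rule tag_map_cong[OF u'])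
      (simp add: law_plus_comp[OF f g] act_comp[OF H law_plus_law[OF f] law_plus_law[OF g]])
  then show "act (Pff_ob H) n l (law_comp g f) u = act (Pff_ob H) n m f (act (Pff_ob H) m l g u)"
    by (simp add: act_Pff[OF u'] act_Pff_cls[OF H f tag_map_summands[OF summand_map_plus_act[OF H g] u']])
qed

section \<open>The category of lax transformations, and the arrow part of the endofunctor\<close>

lemma trans_eqI:
  assumes "is_trans Sg \<alpha>" "is_trans Sg \<beta>" "src \<alpha> = src \<beta>" "tgt \<alpha> = tgt \<beta>"
    and "\<And>n a. a \<in> el (src \<alpha>) n \<Longrightarrow> app \<alpha> n a = app \<beta> n a"
  shows "\<alpha> = \<beta>"
proof -
  have "app \<alpha> n = app \<beta> n" for n
    by (rule extensionalityI[where A = "el (src \<alpha>) n"])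
      (use assms in \<open>auto simp: is_trans_def\<close>)
  then have "app \<alpha> = app \<beta>" by (rule ext)
  then show ?thesis using assms(3,4) by simp
qed

lemma is_transI:
  assumes "is_ofunctor Sg (src \<alpha>)" "is_ofunctor Sg (tgt \<alpha>)"
    and "\<And>n. app \<alpha> n \<in> extensional (el (src \<alpha>) n)"
    and "\<And>n a. a \<in> el (src \<alpha>) n \<Longrightarrow> app \<alpha> n a \<in> el (tgt \<alpha>) n"
    and "\<And>n a b. a \<in> el (src \<alpha>) n \<Longrightarrow> b \<in> el (src \<alpha>) n \<Longrightarrow> leq (ob (src \<alpha>) n) a b \<Longrightarrow>
      leq (ob (tgt \<alpha>) n) (app \<alpha> n a) (app \<alpha> n b)"
    and "\<And>n m f a. f \<in> law Sg n m \<Longrightarrow> a \<in> el (src \<alpha>) m \<Longrightarrow>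
      leq (ob (tgt \<alpha>) n) (act (tgt \<alpha>) n m f (app \<alpha> m a)) (app \<alpha> n (act (src \<alpha>) n m f a))"
    and "\<And>n m i a. i \<in> injections n m \<Longrightarrow> a \<in> el (src \<alpha>) n \<Longrightarrow>
      ren (tgt \<alpha>) n m i (app \<alpha> n a) = app \<alpha> m (ren (src \<alpha>) n m i a)"
  shows "is_trans Sg \<alpha>"
  unfolding is_trans_def monotone_map_def
proof (intro conjI allI ballI impI)
  fix n m i a assume "i \<in> injections n m" "a \<in> el (src \<alpha>) n"
  then show "act (tgt \<alpha>) m n (J n i) (app \<alpha> n a) = app \<alpha> m (act (src \<alpha>) m n (J n i) a)"
    using assms(7) unfolding ren_def by blast
qed (use assms in auto)

lemma hom_Lax_Inj: "\<alpha> \<in> hom (Lax_Inj Sg) X Y \<longleftrightarrow> is_trans Sg \<alpha> \<and> src \<alpha> = X \<and> tgt \<alpha> = Y"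
  by (auto simp: hom_def Lax_Inj_def)

lemma Obj_Lax_Inj: "X \<in> Obj (Lax_Inj Sg) \<longleftrightarrow> is_ofunctor Sg X"
  by (simp add: Lax_Inj_def)

lemma Id_Lax_Inj [simp]:
  "src (Id (Lax_Inj Sg) H) = H" "tgt (Id (Lax_Inj Sg) H) = H"
  "a \<in> el H n \<Longrightarrow> app (Id (Lax_Inj Sg) H) n a = a"
  "app (Id (Lax_Inj Sg) H) n \<in> extensional (el H n)"
  by (simp_all add: Lax_Inj_def)

lemma Comp_Lax_Inj [simp]:
  "src (Comp (Lax_Inj Sg) \<beta> \<alpha>) = src \<alpha>" "tgt (Comp (Lax_Inj Sg) \<beta> \<alpha>) = tgt \<beta>"
  "a \<in> el (src \<alpha>) n \<Longrightarrow> app (Comp (Lax_Inj Sg) \<beta> \<alpha>) n a = app \<beta> n (app \<alpha> n a)"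
  "app (Comp (Lax_Inj Sg) \<beta> \<alpha>) n \<in> extensional (el (src \<alpha>) n)"
  by (simp_all add: Lax_Inj_def compose_def)

context
  fixes Sg :: "('f, 'p) sig" and \<alpha> :: "('f, 'u) trans"
  assumes \<alpha>: "is_trans Sg \<alpha>"
begin

lemma src_ofunctor: "is_ofunctor Sg (src \<alpha>)" and tgt_ofunctor: "is_ofunctor Sg (tgt \<alpha>)"
  using \<alpha> by (auto simp: is_trans_def)

lemma app_carr: "a \<in> el (src \<alpha>) n \<Longrightarrow> app \<alpha> n a \<in> el (tgt \<alpha>) n"
  using \<alpha> unfolding is_trans_def monotone_map_def by blast

lemma app_leq: "a \<in> el (src \<alpha>) n \<Longrightarrow> b \<in> el (src \<alpha>) n \<Longrightarrow> leq (ob (src \<alpha>) n) a b \<Longrightarrow>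
    leq (ob (tgt \<alpha>) n) (app \<alpha> n a) (app \<alpha> n b)"
  using \<alpha> unfolding is_trans_def monotone_map_def by blast

lemma app_lax: "f \<in> law Sg n m \<Longrightarrow> a \<in> el (src \<alpha>) m \<Longrightarrow>
    leq (ob (tgt \<alpha>) n) (act (tgt \<alpha>) n m f (app \<alpha> m a)) (app \<alpha> n (act (src \<alpha>) n m f a))"
  using \<alpha> unfolding is_trans_def by blast

lemma app_strict: "i \<in> injections n m \<Longrightarrow> a \<in> el (src \<alpha>) n \<Longrightarrow>
    ren (tgt \<alpha>) n m i (app \<alpha> n a) = app \<alpha> m (ren (src \<alpha>) n m i a)"
  using \<alpha> unfolding is_trans_def ren_def by blast

lemma app_eq_or_leq: "eq_or_leq e (src \<alpha>) n a b \<Longrightarrow> eq_or_leq e (tgt \<alpha>) n (app \<alpha> n a) (app \<alpha> n b)"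
  unfolding eq_or_leq_def using app_carr app_leq by (auto split: if_splits)

end

lemma Id_trans:
  assumes H: "is_ofunctor Sg H"
  shows "is_trans Sg (Id (Lax_Inj Sg) H)"
  by (rule is_transI)
    (use assms act_carr[OF H] ren_carr[OF H] leq_refl[OF H] in simp_all)

lemma Comp_trans:
  assumes \<alpha>: "is_trans Sg \<alpha>" and \<beta>: "is_trans Sg \<beta>" and eq: "src \<beta> = tgt \<alpha>"
  shows "is_trans Sg (Comp (Lax_Inj Sg) \<beta> \<alpha>)"
proof (rule is_transI, simp_all add: src_ofunctor[OF \<alpha>] tgt_ofunctor[OF \<beta>])
  note H = src_ofunctor[OF \<alpha>] tgt_ofunctor[OF \<alpha>] tgt_ofunctor[OF \<beta>]
  note ac = app_carr[OF \<alpha>] and bc = app_carr[OF \<beta>, unfolded eq]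
  show "app \<beta> n (app \<alpha> n a) \<in> el (tgt \<beta>) n" if "a \<in> el (src \<alpha>) n" for n a
    using that ac bc by blast
  show "leq (ob (tgt \<beta>) n) (app \<beta> n (app \<alpha> n a)) (app \<beta> n (app \<alpha> n b))"
    if "a \<in> el (src \<alpha>) n" "b \<in> el (src \<alpha>) n" "leq (ob (src \<alpha>) n) a b" for n a b
    using app_leq[OF \<beta>, unfolded eq] ac app_leq[OF \<alpha>] that by blast
  show "leq (ob (tgt \<beta>) n) (act (tgt \<beta>) n m f (app \<beta> m (app \<alpha> m a)))
      (app (Comp (Lax_Inj Sg) \<beta> \<alpha>) n (act (src \<alpha>) n m f a))"
    if f: "f \<in> law Sg n m" and a: "a \<in> el (src \<alpha>) m" for n m f a
  proof -
    have fa: "act (src \<alpha>) n m f a \<in> el (src \<alpha>) n" using act_carr[OF H(1) f a] .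
    have fa': "act (tgt \<alpha>) n m f (app \<alpha> m a) \<in> el (tgt \<alpha>) n" using act_carr[OF H(2) f ac[OF a]] .
    have "leq (ob (tgt \<beta>) n) (act (tgt \<beta>) n m f (app \<beta> m (app \<alpha> m a)))
        (app \<beta> n (act (tgt \<alpha>) n m f (app \<alpha> m a)))"
      using app_lax[OF \<beta>, unfolded eq, OF f ac[OF a]] .
    moreover have "leq (ob (tgt \<beta>) n) (app \<beta> n (act (tgt \<alpha>) n m f (app \<alpha> m a)))
        (app \<beta> n (app \<alpha> n (act (src \<alpha>) n m f a)))"
      using app_leq[OF \<beta>, unfolded eq, OF fa' ac[OF fa] app_lax[OF \<alpha> f a]] .
    ultimately show ?thesis
      using leq_trans[OF H(3) act_carr[OF H(3) f bc[OF ac[OF a]]] bc[OF fa'] bc[OF ac[OF fa]]] fa by simp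
  qed
  show "ren (tgt \<beta>) n m i (app \<beta> n (app \<alpha> n a)) =
      app (Comp (Lax_Inj Sg) \<beta> \<alpha>) m (ren (src \<alpha>) n m i a)"
    if "i \<in> injections n m" "a \<in> el (src \<alpha>) n" for n m i a
    using app_strict[OF \<alpha> that] app_strict[OF \<beta>, unfolded eq, OF that(1) ac[OF that(2)]]
      ren_carr[OF H(1) that] by simp
qed

theorem category_Lax_Inj: "category (Lax_Inj Sg)"
proof
  fix f x show "f \<in> Arr (Lax_Inj Sg) \<Longrightarrow>
      Dom (Lax_Inj Sg) f \<in> Obj (Lax_Inj Sg) \<and> Cod (Lax_Inj Sg) f \<in> Obj (Lax_Inj Sg)"
    by (auto simp: Lax_Inj_def is_trans_def)
  show "x \<in> Obj (Lax_Inj Sg) \<Longrightarrow> Id (Lax_Inj Sg) x \<in> hom (Lax_Inj Sg) x x"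
    by (simp add: hom_Lax_Inj Obj_Lax_Inj Id_trans)
next
  fix f g x y z assume "f \<in> hom (Lax_Inj Sg) x y" "g \<in> hom (Lax_Inj Sg) y z"
  then show "Comp (Lax_Inj Sg) g f \<in> hom (Lax_Inj Sg) x z"
    by (auto simp: hom_Lax_Inj Comp_trans)
next
  fix f x y assume "f \<in> hom (Lax_Inj Sg) x y"
  then have f: "is_trans Sg f" "src f = x" "tgt f = y" by (simp_all add: hom_Lax_Inj)
  then have xy: "is_ofunctor Sg x" "is_ofunctor Sg y" using src_ofunctor tgt_ofunctor by blast+
  show "Comp (Lax_Inj Sg) f (Id (Lax_Inj Sg) x) = f"
    by (rule trans_eqI[OF Comp_trans[OF Id_trans[OF xy(1)] f(1)] f(1)]) (simp_all add: f)
  show "Comp (Lax_Inj Sg) (Id (Lax_Inj Sg) y) f = f"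
    by (rule trans_eqI[OF Comp_trans[OF f(1) Id_trans[OF xy(2)]] f(1)])
      (use f app_carr[OF f(1)] in simp_all)
next
  fix f g h w x y z
  assume "f \<in> hom (Lax_Inj Sg) w x" "g \<in> hom (Lax_Inj Sg) x y" "h \<in> hom (Lax_Inj Sg) y z"
  then have f: "is_trans Sg f" "src f = w" "tgt f = x" and g: "is_trans Sg g" "src g = x" "tgt g = y"
    and h: "is_trans Sg h" "src h = y" "tgt h = z" by (simp_all add: hom_Lax_Inj)
  show "Comp (Lax_Inj Sg) h (Comp (Lax_Inj Sg) g f) = Comp (Lax_Inj Sg) (Comp (Lax_Inj Sg) h g) f"
    by (rule trans_eqI[of Sg]) (use f g h app_carr[OF f(1)] in \<open>simp_all add: Comp_trans\<close>)
qed

lemma Pff_arr_simps [simp]: "src (Pff_arr \<alpha>) = Pff_ob (src \<alpha>)" "tgt (Pff_arr \<alpha>) = Pff_ob (tgt \<alpha>)"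
  by (simp_all add: Pff_arr_def)

context
  fixes Sg :: "('f, 'q) sig" and \<alpha> :: "('f, 'p, 'a) utrans"
  assumes \<alpha>: "is_trans Sg \<alpha>"
begin

lemma summand_map_app: "summand_map (src \<alpha>) n (tgt \<alpha>) n (\<lambda>k. app \<alpha> (n + k))"
  unfolding summand_map_def
proof (intro conjI allI ballI)
  fix k m i assume "i \<in> inj_under n k m"
  then show "\<exists>i'\<in>inj_under n k m. \<forall>x\<in>el (src \<alpha>) (n + k).
      app \<alpha> (n + m) (ren (src \<alpha>) (n + k) (n + m) i x) = ren (tgt \<alpha>) (n + k) (n + m) i' (app \<alpha> (n + k) x)"
    using app_strict[OF \<alpha>] inj_underD(1) by metis
qed (use \<alpha> in \<open>auto simp: is_trans_def\<close>)

lemma app_Pff_cls: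
  assumes u: "u \<in> summands (src \<alpha>) n"
  shows "app (Pff_arr \<alpha>) n (cls (src \<alpha>) n u) = cls (tgt \<alpha>) n (tag_map (\<lambda>k. app \<alpha> (n + k)) u)"
proof -
  let ?v = "cls (src \<alpha>) n u"
  have v: "?v \<in> summands (src \<alpha>) n" using u cls_in_summands[OF src_ofunctor[OF \<alpha>]] by blast
  have "app (Pff_arr \<alpha>) n ?v = cls (tgt \<alpha>) n (tag_map (\<lambda>k. app \<alpha> (n + k)) ?v)"
    using cls_carr[OF u] by (rule_tac summands_TagE[OF v]) (simp add: Pff_arr_def tag_map_def)
  then show ?thesis
    using tag_map_equivclp[OF summand_map_app equivclp_sym[OF equivclp_cls]] by (metis cls_eq_iff)
qed

lemma app_Pff:
  "u \<in> carr (colim (src \<alpha>) n) \<Longrightarrow> app (Pff_arr \<alpha>) n u = cls (tgt \<alpha>) n (tag_map (\<lambda>k. app \<alpha> (n + k)) u)"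
  using app_Pff_cls carr_colimD[OF src_ofunctor[OF \<alpha>]] by metis

lemma Pff_arr_trans: "is_trans Sg (Pff_arr \<alpha>)"
proof (rule is_transI)
  note X = src_ofunctor[OF \<alpha>] and Y = tgt_ofunctor[OF \<alpha>]
  show "is_ofunctor Sg (src (Pff_arr \<alpha>))" "is_ofunctor Sg (tgt (Pff_arr \<alpha>))"
    using X Y by (simp_all add: Pff_ob_ofunctor)
  show "app (Pff_arr \<alpha>) n \<in> extensional (el (src (Pff_arr \<alpha>)) n)" for n
    by (simp add: Pff_arr_def Pff_ob_def)
  show "app (Pff_arr \<alpha>) n u \<in> el (tgt (Pff_arr \<alpha>)) n"
    if "u \<in> el (src (Pff_arr \<alpha>)) n" for n u
    using that cls_carr[OF tag_map_summands[OF summand_map_app carr_colimD(1)[OF X]]]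
    by (simp add: app_Pff)
  show "leq (ob (tgt (Pff_arr \<alpha>)) n) (app (Pff_arr \<alpha>) n u) (app (Pff_arr \<alpha>) n v)"
    if "u \<in> el (src (Pff_arr \<alpha>)) n" "v \<in> el (src (Pff_arr \<alpha>)) n"
      "leq (ob (src (Pff_arr \<alpha>)) n) u v" for n u v
    using that by (simp add: app_Pff colim_leq_cls tag_map_leq[OF summand_map_app])
  show "leq (ob (tgt (Pff_arr \<alpha>)) n) (act (tgt (Pff_arr \<alpha>)) n m f (app (Pff_arr \<alpha>) m u))
      (app (Pff_arr \<alpha>) n (act (src (Pff_arr \<alpha>)) n m f u))"
    if f: "f \<in> law Sg n m" and u: "u \<in> el (src (Pff_arr \<alpha>)) m" for n m f u
  proof -
    have u': "u \<in> carr (colim (src \<alpha>) m)" "u \<in> summands (src \<alpha>) m" using u carr_colimD[OF X] by simp_all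
    obtain k SS where SS: "SS \<in> fsets (src \<alpha>) (m + k)" "u = Tag k (pp SS)"
      by (rule summandsE[OF u'(2)])
    note fk = law_plus_law[OF f, of k]
    note L = summand_map_finite_finite[OF summand_map_plus_act[OF Y f] summand_map_finite_finite[OF summand_map_app SS(1)]]
    note R = summand_map_finite_finite[OF summand_map_app summand_map_finite_finite[OF summand_map_plus_act[OF X f] SS(1)]]
    \<comment> \<open>Both composites stay in summand \<open>k\<close>, and laxness of
      \<open>\<alpha>\<close> at \<open>f + k\<close> compares them element by element; no change of
      summand is involved.\<close>
    have "nest False (leq (ob (tgt \<alpha>) (n + k)))
        (image (plus_act (tgt \<alpha>) n m f k) ` image (app \<alpha> (m + k)) ` SS)
        (image (app \<alpha> (n + k)) ` image (plus_act (src \<alpha>) n m f k) ` SS)"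
      unfolding nest_image image_image[of image] plus_act_def
      unfolding image_image[of "image _" "image _"] image_image nest_image
      using app_lax[OF \<alpha> fk] finite_finiteD[OF SS(1)] by (intro nest_refl) blast
    then have "summand_leq (tgt \<alpha>) n (tag_map (plus_act (tgt \<alpha>) n m f) (tag_map (\<lambda>k. app \<alpha> (m + k)) u))
        (tag_map (\<lambda>k. app \<alpha> (n + k)) (tag_map (plus_act (src \<alpha>) n m f) u))"
      unfolding SS(2) tag_map_pp[OF SS(1)]
        tag_map_pp[OF summand_map_finite_finite[OF summand_map_plus_act[OF X f] SS(1)]]
        tag_map_pp[OF summand_map_finite_finite[OF summand_map_app SS(1)]]
        summand_leq_pp using L R by blast
    then have "leq (colim (tgt \<alpha>) n) (tag_map (plus_act (tgt \<alpha>) n m f) (tag_map (\<lambda>k. app \<alpha> (m + k)) u))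
        (tag_map (\<lambda>k. app \<alpha> (n + k)) (tag_map (plus_act (src \<alpha>) n m f) u))"
      unfolding colim_def by (simp add: r_into_rtranclp)
    then show ?thesis
      using u' tag_map_summands[OF summand_map_app u'(2)]
        tag_map_summands[OF summand_map_plus_act[OF X f] u'(2)]
      by (simp add: app_Pff act_Pff act_Pff_cls[OF Y f] app_Pff_cls colim_leq_cls)
  qed
  show "ren (tgt (Pff_arr \<alpha>)) n m i (app (Pff_arr \<alpha>) n u) = app (Pff_arr \<alpha>) m (ren (src (Pff_arr \<alpha>)) n m i u)"
    if i: "i \<in> injections n m" and u: "u \<in> el (src (Pff_arr \<alpha>)) n" for n m i u
  proof -
    have u': "u \<in> carr (colim (src \<alpha>) n)" "u \<in> summands (src \<alpha>) n" using u carr_colimD[OF X] by simp_all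
    note f = injections_J_law[OF i, of Sg]
    have "tag_map (plus_act (tgt \<alpha>) m n (J n i)) (tag_map (\<lambda>k. app \<alpha> (n + k)) u) =
        tag_map (\<lambda>k. app \<alpha> (m + k)) (tag_map (plus_act (src \<alpha>) m n (J n i)) u)"
      unfolding tag_map_tag_map[OF u'(2)]
    proof (rule tag_map_cong[OF u'(2)])
      fix k x assume "x \<in> el (src \<alpha>) (n + k)"
      then show "plus_act (tgt \<alpha>) m n (J n i) k (app \<alpha> (n + k) x) =
          app \<alpha> (m + k) (plus_act (src \<alpha>) m n (J n i) k x)"
        using app_strict[OF \<alpha> extend_injection[OF i]] unfolding plus_act_def law_plus_J ren_def by blast
    qed
    then show ?thesis
      using u' tag_map_summands[OF summand_map_app u'(2)]
        tag_map_summands[OF summand_map_plus_act[OF X f] u'(2)]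
      by (simp add: ren_def app_Pff act_Pff act_Pff_cls[OF Y f] app_Pff_cls)
  qed
qed

end

theorem endofunctor_Pff:
  fixes Sg :: "('f, 'q) sig"
  shows "endofunctor (Lax_Inj Sg)
    (Pff_ob :: ('f, 'p, 'a) ufunctor \<Rightarrow> ('f, 'p, 'a) ufunctor) Pff_arr"
proof (intro endofunctor.intro[OF category_Lax_Inj] endofunctor_axioms.intro)
  fix x :: "('f, 'p, 'a) ufunctor"
  show "x \<in> Obj (Lax_Inj Sg) \<Longrightarrow> Pff_ob x \<in> Obj (Lax_Inj Sg)"
    by (simp add: Obj_Lax_Inj Pff_ob_ofunctor)
next
  fix f :: "('f, 'p, 'a) utrans" and x y
  show "f \<in> hom (Lax_Inj Sg) x y \<Longrightarrow> Pff_arr f \<in> hom (Lax_Inj Sg) (Pff_ob x) (Pff_ob y)"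
    by (auto simp: hom_Lax_Inj Pff_arr_trans)
next
  fix x :: "('f, 'p, 'a) ufunctor"
  assume "x \<in> Obj (Lax_Inj Sg)"
  then have x: "is_ofunctor Sg x" by (simp add: Obj_Lax_Inj)
  show "Pff_arr (Id (Lax_Inj Sg) x) = Id (Lax_Inj Sg) (Pff_ob x)"
  proof (rule trans_eqI[OF Pff_arr_trans[OF Id_trans[OF x]] Id_trans[OF Pff_ob_ofunctor[OF x]]])
    fix n u assume "u \<in> el (src (Pff_arr (Id (Lax_Inj Sg) x))) n"
    then have u: "u \<in> carr (colim x n)" by simp
    have "tag_map (\<lambda>k. app (Id (Lax_Inj Sg) x) (n + k)) u = u"
      by (rule tag_map_id[OF carr_colimD(1)[OF x u]]) simp
    then show "app (Pff_arr (Id (Lax_Inj Sg) x)) n u = app (Id (Lax_Inj Sg) (Pff_ob x)) n u"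
      using app_Pff[OF Id_trans[OF x]] u carr_colimD(2)[OF x u] by simp
  qed simp_all
next
  fix f g :: "('f, 'p, 'a) utrans" and x y z
  assume "f \<in> hom (Lax_Inj Sg) x y" "g \<in> hom (Lax_Inj Sg) y z"
  then have f: "is_trans Sg f" "src f = x" "tgt f = y" and g: "is_trans Sg g" "src g = y" "tgt g = z"
    by (simp_all add: hom_Lax_Inj)
  have gf: "is_trans Sg (Comp (Lax_Inj Sg) g f)" using Comp_trans f g by metis
  show "Pff_arr (Comp (Lax_Inj Sg) g f) = Comp (Lax_Inj Sg) (Pff_arr g) (Pff_arr f)"
  proof (rule trans_eqI[OF Pff_arr_trans[OF gf] Comp_trans[OF Pff_arr_trans[OF f(1)] Pff_arr_trans[OF g(1)]]])
    fix n u assume "u \<in> el (src (Pff_arr (Comp (Lax_Inj Sg) g f))) n"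
    then have u: "u \<in> carr (colim (src f) n)" by simp
    note u' = carr_colimD(1)[OF src_ofunctor[OF f(1)] u]
    have "tag_map (\<lambda>k. app (Comp (Lax_Inj Sg) g f) (n + k)) u =
        tag_map (\<lambda>k. app g (n + k)) (tag_map (\<lambda>k. app f (n + k)) u)"
      unfolding tag_map_tag_map[OF u'] by (rule tag_map_cong[OF u']) simp
    moreover have "tag_map (\<lambda>k. app f (n + k)) u \<in> summands (src g) n"
      using tag_map_summands[OF summand_map_app[OF f(1)] u'] f g by simp
    ultimately show "app (Pff_arr (Comp (Lax_Inj Sg) g f)) n u =
        app (Comp (Lax_Inj Sg) (Pff_arr g) (Pff_arr f)) n u"
      using app_Pff[OF gf] app_Pff[OF f(1) u] app_Pff_cls[OF g(1)] u f g by simp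
  qed (simp_all add: f g)
qed

section \<open>Behaviour trees\<close>

text \<open>The context of a node is not stored: it is the context of the root plus the numbers
  \<open>ext\<close> along the path. Lists of lists, in place of sets, give the nodes addresses for
  the encoding.\<close>

codatatype 'u beh = Beh (lab: 'u) (ext: nat) (kids: "'u beh list list")

definition kidset :: "'u beh \<Rightarrow> 'u beh set set" where
  "kidset t = set ` set (kids t)"

primcorec tact :: "('f, 'u) ofunctor \<Rightarrow> nat \<Rightarrow> nat \<Rightarrow> 'f trm list \<Rightarrow> 'u beh \<Rightarrow> 'u beh" where
  "lab (tact H n m f t) = act H n m f (lab t)"
| "ext (tact H n m f t) = ext t"
| "kids (tact H n m f t) = map (map (tact H (n + ext t) (m + ext t) (law_plus n f (ext t)))) (kids t)"

lemma kidset_tact: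
  "kidset (tact H n m f t) = image (tact H (n + ext t) (m + ext t) (law_plus n f (ext t))) ` kidset t"
  by (simp add: kidset_def image_image)

coinductive wfb :: "('f, 'u) ofunctor \<Rightarrow> nat \<Rightarrow> 'u beh \<Rightarrow> bool" for H where
  "lab t \<in> el H n \<Longrightarrow> (\<And>s u. s \<in> kidset t \<Longrightarrow> u \<in> s \<Longrightarrow> wfb H (n + ext t) u) \<Longrightarrow> wfb H n t"

lemma wfb_lab: "wfb H n t \<Longrightarrow> lab t \<in> el H n"
  by (erule wfb.cases) simp

lemma wfb_kid: "wfb H n t \<Longrightarrow> s \<in> kidset t \<Longrightarrow> u \<in> s \<Longrightarrow> wfb H (n + ext t) u"
  by (erule wfb.cases) simp

text \<open>The trees before the quotient, with the discrete order. They form a functor, so the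
  general facts on renamings and amalgamation apply to trees as well.\<close>

definition beh_functor :: "('f, 'u) ofunctor \<Rightarrow> ('f, 'u beh) ofunctor" where
  "beh_functor H = \<lparr>ob = (\<lambda>n. \<lparr>carr = {t. wfb H n t}, leq = (=)\<rparr>), act = tact H\<rparr>"

lemma beh_functor_simps [simp]:
  "el (beh_functor H) n = {t. wfb H n t}" "act (beh_functor H) = tact H"
  by (simp_all add: beh_functor_def)

lemma kidset_finite_finite:
  assumes "wfb H n t"
  shows "kidset t \<in> finite_finite {u. wfb H (n + ext t) u}"
proof -
  have "finite (kidset t)" "s \<in> kidset t \<Longrightarrow> finite s" for s by (auto simp: kidset_def)
  then show ?thesis using wfb_kid[OF assms] by (auto simp: finite_finite_def)
qed

context
  fixes Sg :: "('f, 'q) sig" and H :: "('f, 'u) ofunctor"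
  assumes H: "is_ofunctor Sg H"
begin

lemma wfb_tact: "f \<in> law Sg n m \<Longrightarrow> wfb H m t \<Longrightarrow> wfb H n (tact H n m f t)"
proof (coinduction arbitrary: n m f t)
  case wfb
  have "\<exists>n' m' f' t'. n + ext t = n' \<and> u = tact H n' m' f' t' \<and> f' \<in> law Sg n' m' \<and> wfb H m' t'"
    if "s \<in> kidset (tact H n m f t)" "u \<in> s" for s u
    using that law_plus_law[OF wfb(1)] wfb_kid[OF wfb(2)] unfolding kidset_tact by blast
  then show ?case using act_carr[OF H wfb(1) wfb_lab[OF wfb(2)]] by auto
qed

lemma tact_id: "wfb H n t \<Longrightarrow> tact H n n (law_id n) t = t"
proof (coinduction arbitrary: n t)
  case (Eq_beh n t)
  have "list_all2 (list_all2 (\<lambda>x y. \<exists>n t. x = tact H n n (law_id n) t \<and> y = t \<and> wfb H n t))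
      (map (map (tact H (n + ext t) (n + ext t) (law_id (n + ext t)))) (kids t)) (kids t)"
    using wfb_kid[OF Eq_beh]
    by (fastforce simp: list.rel_map kidset_def intro!: list.rel_refl_strong)
  then show ?case using act_id[OF H wfb_lab[OF Eq_beh]] by (simp add: law_plus_id)
qed

lemma tact_comp: "f \<in> law Sg n m \<Longrightarrow> g \<in> law Sg m l \<Longrightarrow> wfb H l t \<Longrightarrow>
    tact H n l (law_comp g f) t = tact H n m f (tact H m l g t)"
proof (coinduction arbitrary: n m l f g t)
  case (Eq_beh n m l f g t)
  let ?R = "\<lambda>x y. \<exists>n m l f g t. x = tact H n l (law_comp g f) t \<and> y = tact H n m f (tact H m l g t) \<and>
    f \<in> law Sg n m \<and> g \<in> law Sg m l \<and> wfb H l t"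
  let ?k = "ext t"
  let ?a = "tact H (n + ?k) (l + ?k) (law_comp (law_plus m g ?k) (law_plus n f ?k))"
  let ?b = "\<lambda>u. tact H (n + ?k) (m + ?k) (law_plus n f ?k) (tact H (m + ?k) (l + ?k) (law_plus m g ?k) u)"
  have R: "?R (?a u) (?b u)" if "s \<in> set (kids t)" "u \<in> set s" for s u
    using law_plus_law[OF Eq_beh(1)] law_plus_law[OF Eq_beh(2)] wfb_kid[OF Eq_beh(3)] that
    unfolding kidset_def by blast
  have "list_all2 (list_all2 ?R) (map (map ?a) (kids t)) (map (map ?b) (kids t))"
    unfolding list.rel_map by (intro list.rel_refl_strong R)
  then show ?case using act_comp[OF H Eq_beh(1,2) wfb_lab[OF Eq_beh(3)]]
    by (simp add: law_plus_comp[OF Eq_beh(1,2)] comp_def)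
qed

lemma beh_functor: "is_ofunctor Sg (beh_functor H)"
  unfolding is_ofunctor_def monotone_map_def is_ord_set_def
  by (auto simp: beh_functor_def wfb_tact tact_id tact_comp intro!: reflp_onI transp_onI)

end

section \<open>Bisimilarity and similarity of behaviour trees\<close>

abbreviation bren :: "('f, 'u) ofunctor \<Rightarrow> nat \<Rightarrow> nat \<Rightarrow> (nat \<Rightarrow> nat) \<Rightarrow> 'u beh \<Rightarrow> 'u beh" where
  "bren H \<equiv> ren (beh_functor H)"

abbreviation ren_kids :: "('f, 'u) ofunctor \<Rightarrow> nat \<Rightarrow> nat \<Rightarrow> (nat \<Rightarrow> nat) \<Rightarrow> 'u beh \<Rightarrow> 'u beh set set" where
  "ren_kids H n m i t \<equiv> image (bren H (n + ext t) (n + m) i) ` kidset t"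

text \<open>Bisimilarity for \<open>e\<close>, similarity for \<open>\<not> e\<close>.\<close>

coinductive brel :: "bool \<Rightarrow> ('f, 'u) ofunctor \<Rightarrow> nat \<Rightarrow> 'u beh \<Rightarrow> 'u beh \<Rightarrow> bool" for e H where
  "wfb H n t \<Longrightarrow> wfb H n t' \<Longrightarrow> eq_or_leq e H n (lab t) (lab t') \<Longrightarrow>
   i \<in> inj_under n (ext t) m \<Longrightarrow> j \<in> inj_under n (ext t') m \<Longrightarrow>
   nest e (\<lambda>x y. brel e H (n + m) x y)
     (ren_kids H n m i t)
     (ren_kids H n m j t') \<Longrightarrow>
   brel e H n t t'"

lemma brelD:
  assumes "brel e H n t t'"
  shows "wfb H n t" "wfb H n t'" "eq_or_leq e H n (lab t) (lab t')"
  using assms by (auto elim: brel.cases)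

lemma brelE:
  assumes "brel e H n t t'"
  obtains i j m where "i \<in> inj_under n (ext t) m" "j \<in> inj_under n (ext t') m"
   "nest e (brel e H (n + m))
     (ren_kids H n m i t)
     (ren_kids H n m j t')"
  using assms by (auto elim: brel.cases)

text \<open>The operator whose greatest fixed point is \<open>brel\<close>; coinduction then asks
  for a relation contained in its own image.\<close>

definition progress ::
  "bool \<Rightarrow> ('f, 'u) ofunctor \<Rightarrow> (nat \<Rightarrow> 'u beh \<Rightarrow> 'u beh \<Rightarrow> bool) \<Rightarrow> nat \<Rightarrow> 'u beh \<Rightarrow> 'u beh \<Rightarrow> bool" where
  "progress e H R n t t' \<longleftrightarrow> wfb H n t \<and> wfb H n t' \<and> eq_or_leq e H n (lab t) (lab t') \<and>
    (\<exists>i j m. i \<in> inj_under n (ext t) m \<and> j \<in> inj_under n (ext t') m \<and>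
      nest e (R (n + m)) (ren_kids H n m i t)
        (ren_kids H n m j t'))"

lemma brel_coinduct_nest:
  assumes "R n t t'" and "\<And>n t t'. R n t t' \<Longrightarrow> progress e H R n t t'"
  shows "brel e H n t t'"
  using assms(1)
proof (coinduct rule: brel.coinduct)
  case (brel n t t')
  obtain i j m where ij: "i \<in> inj_under n (ext t) m" "j \<in> inj_under n (ext t') m"
    and nest: "nest e (R (n + m)) (ren_kids H n m i t)
          (ren_kids H n m j t')"
    using assms(2)[OF brel] unfolding progress_def by auto
  have "nest e (\<lambda>x y. R (n + m) x y \<or> brel e H (n + m) x y)
      (ren_kids H n m i t)
      (ren_kids H n m j t')"
    by (rule nest_mono_strong[OF nest]) simp
  then show ?case using assms(2)[OF brel] ij unfolding progress_def by blast
qed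

lemma brel_weaken:
  assumes H: "is_ofunctor Sg H" and "brel True H n t t'"
  shows "brel False H n t t'"
  using assms(2)
proof (rule brel_coinduct_nest)
  fix n t t' assume r: "brel True H n t t'"
  have "eq_or_leq False H n (lab t) (lab t')"
    using brelD(3)[OF r] leq_refl[OF H] by (auto simp: eq_or_leq_def)
  then show "progress False H (brel True H) n t t'"
    unfolding progress_def using brelD[OF r] by (rule_tac brelE[OF r]) (blast intro: nest_weaken)
qed

lemma brel_sym:
  assumes "brel True H n t t'"
  shows "brel True H n t' t"
proof (rule brel_coinduct_nest[where R = "\<lambda>n t t'. brel True H n t' t"])
  fix n t t' assume r: "brel True H n t' t"
  obtain i j m where "i \<in> inj_under n (ext t') m" "j \<in> inj_under n (ext t) m"
    and "nest True (brel True H (n + m)) (ren_kids H n m i t')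
      (ren_kids H n m j t)" by (rule brelE[OF r])
  moreover from this(3) have "nest True (\<lambda>x y. brel True H (n + m) y x)
      (ren_kids H n m j t)
      (ren_kids H n m i t')" by (rule nest_flip)
  ultimately show "progress True H (\<lambda>n t t'. brel True H n t' t) n t t'"
    unfolding progress_def using brelD[OF r] by (intro conjI exI) (auto simp: eq_or_leq_def)
qed (rule assms)

context
  fixes Sg :: "('f, 'q) sig" and H :: "('f, 'u) ofunctor"
  assumes H: "is_ofunctor Sg H"
begin

lemma kidset_fsets: "wfb H n t \<Longrightarrow> kidset t \<in> fsets (beh_functor H) (n + ext t)"
  using kidset_finite_finite by simp

lemma brel_refl:
  assumes "wfb H n t"
  shows "brel e H n t t"
proof (rule brel_coinduct_nest[where R = "\<lambda>n t t'. t = t' \<and> wfb H n t"])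
  fix n and t t' :: "'u beh" assume "t = t' \<and> wfb H n t"
  then have t: "t' = t" "wfb H n t" by blast+
  have "nest e (\<lambda>x y. x = y \<and> wfb H (n + ext t) x) (kidset t) (kidset t)"
    by (rule nest_refl) (use t wfb_kid in auto)
  then have "nest e (\<lambda>x y. x = y \<and> wfb H (n + ext t) x)
      (image (bren H (n + ext t) (n + ext t) (\<lambda>x. x)) ` kidset t)
      (image (bren H (n + ext t') (n + ext t) (\<lambda>x. x)) ` kidset t')"
    by (simp add: t image_ren_id[OF beh_functor[OF H] kidset_fsets])
  then show "progress e H (\<lambda>n t t'. t = t' \<and> wfb H n t) n t t'"
    unfolding progress_def using wfb_lab eq_or_leq_refl[OF H] inj_under_id[of "ext t" "ext t" n] t by blast
qed (use assms in simp)

text \<open>The square of \<open>law_plus_fixing_injection\<close>, read on subtrees: acting and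
  then renaming the fresh variables is the same as renaming first and then acting by
  \<open>f + m\<close>.\<close>

lemma ren_tact_kids:
  assumes f: "f \<in> law Sg n' n" and t: "wfb H n t" and i: "i \<in> inj_under n (ext t) m"
    and i': "i' \<in> inj_under n' (ext t) m"
    and eq: "law_comp (J (n + ext t) i) (law_plus n' f m) = law_comp (law_plus n' f (ext t)) (J (n' + ext t) i')"
  shows "image (bren H (n' + ext t) (n' + m) i') ` kidset (tact H n' n f t) =
    image (tact H (n' + m) (n + m) (law_plus n' f m)) ` ren_kids H n m i t"
  unfolding kidset_tact image_image
proof (intro image_cong refl)
  fix s u assume "s \<in> kidset t" "u \<in> s"
  then have u: "wfb H (n + ext t) u" using wfb_kid[OF t] by blast
  show "bren H (n' + ext t) (n' + m) i' (tact H (n' + ext t) (n + ext t) (law_plus n' f (ext t)) u) =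
      tact H (n' + m) (n + m) (law_plus n' f m) (bren H (n + ext t) (n + m) i u)"
    using tact_comp[OF H injections_J_law[OF inj_underD(1)[OF i']] law_plus_law[OF f] u]
      tact_comp[OF H law_plus_law[OF f] injections_J_law[OF inj_underD(1)[OF i]] u] eq
    by (simp add: ren_def)
qed

text \<open>The candidate consists of all images of related pairs under arrows. The injections of a
  cospan are transported above the new context without changing \<open>m\<close>, and the subtrees
  are then images under \<open>f + m\<close>, hence again in the candidate.\<close>

lemma brel_tact:
  assumes "f \<in> law Sg n' n" "brel e H n t t'"
  shows "brel e H n' (tact H n' n f t) (tact H n' n f t')"
proof -
  let ?R = "\<lambda>n' s s'. \<exists>n f t t'. s = tact H n' n f t \<and> s' = tact H n' n f t' \<and>
    f \<in> law Sg n' n \<and> brel e H n t t'"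
  show ?thesis
  proof (rule brel_coinduct_nest[where R = ?R])
  fix n' s s' assume "\<exists>n f t t'. s = tact H n' n f t \<and> s' = tact H n' n f t' \<and>
    f \<in> law Sg n' n \<and> brel e H n t t'"
  then obtain n f t t' where s: "s = tact H n' n f t" "s' = tact H n' n f t'" and f: "f \<in> law Sg n' n"
    and r: "brel e H n t t'" by blast
  note rD = brelD[OF r]
  obtain i j m where i: "i \<in> inj_under n (ext t) m" and j: "j \<in> inj_under n (ext t') m"
    and nest: "nest e (brel e H (n + m)) (ren_kids H n m i t)
      (ren_kids H n m j t')" by (rule brelE[OF r])
  obtain i' where i': "i' \<in> inj_under n' (ext t) m" "law_comp (J (n + ext t) i) (law_plus n' f m) =
      law_comp (law_plus n' f (ext t)) (J (n' + ext t) i')"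
    by (rule law_plus_fixing_injection[OF f i]) (rule that)
  obtain j' where j': "j' \<in> inj_under n' (ext t') m" "law_comp (J (n + ext t') j) (law_plus n' f m) =
      law_comp (law_plus n' f (ext t')) (J (n' + ext t') j')"
    by (rule law_plus_fixing_injection[OF f j]) (rule that)
  have "nest e (\<lambda>s s'. \<exists>l f t t'. s = tact H (n' + m) l f t \<and> s' = tact H (n' + m) l f t' \<and>
        f \<in> law Sg (n' + m) l \<and> brel e H l t t')
      (image (bren H (n' + ext s) (n' + m) i') ` kidset s) (image (bren H (n' + ext s') (n' + m) j') ` kidset s')"
    unfolding s tact.simps ren_tact_kids[OF f rD(1) i i'] ren_tact_kids[OF f rD(2) j j']
    using nest law_plus_law[OF f]
    by (subst nest_image) (erule nest_mono_strong, blast)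
  moreover have "eq_or_leq e H n' (lab s) (lab s')"
    using eq_or_leq_act[OF H f rD(3)] by (simp add: s)
  moreover have "i' \<in> inj_under n' (ext s) m" "j' \<in> inj_under n' (ext s') m"
    using i' j' by (simp_all add: s)
  ultimately show "progress e H ?R n' s s'"
    unfolding progress_def using wfb_tact[OF H f] rD(1,2) unfolding s by blast
qed (use assms in blast)
qed

text \<open>Relational composition is the candidate. Amalgamation applies because
  \<open>brel\<close> is stable under renamings, which is a case of
  \<open>brel_tact\<close>.\<close>

lemma brel_trans:
  assumes "brel e H n t t'" "brel e H n t' t''"
  shows "brel e H n t t''"
proof -
  let ?R = "\<lambda>n t t''. \<exists>t'. brel e H n t t' \<and> brel e H n t' t''"
  show ?thesis
  proof (rule brel_coinduct_nest[where R = ?R])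
  fix n t t'' assume "\<exists>t'. brel e H n t t' \<and> brel e H n t' t''"
  then obtain t' where r: "brel e H n t t'" and r': "brel e H n t' t''" by blast
  note B = beh_functor[OF H]
  note kt = kidset_fsets[OF brelD(1)[OF r]] kidset_fsets[OF brelD(2)[OF r]]
    kidset_fsets[OF brelD(2)[OF r']]
  obtain i j m where i: "i \<in> inj_under n (ext t) m" and j: "j \<in> inj_under n (ext t') m"
    and 1: "nest e (brel e H (n + m)) (ren_kids H n m i t)
      (ren_kids H n m j t')" by (rule brelE[OF r])
  obtain i' j' m' where i': "i' \<in> inj_under n (ext t') m'"
    and j': "j' \<in> inj_under n (ext t'') m'"
    and 2: "nest e (brel e H (n + m')) (ren_kids H n m' i' t')
      (ren_kids H n m' j' t'')" by (rule brelE[OF r'])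
  have Q: "brel e H l (bren H m l i x) (bren H m l i y)" if "i \<in> injections m l" "brel e H m x y" for i m l x y
    using brel_tact[OF injections_J_law[OF that(1)] that(2)] by (simp add: ren_def)
  obtain p a b where ab: "a \<in> inj_under n (ext t) p" "b \<in> inj_under n (ext t'') p"
    and "nest e (\<lambda>x z. \<exists>y. brel e H (n + p) x y \<and> brel e H (n + p) y z)
      (ren_kids H n p a t) (ren_kids H n p b t'')"
    using nest_amalgamation[OF B kt i j i' j' 1 2 Q] by blast
  moreover have "eq_or_leq e H n (lab t) (lab t'')"
    using eq_or_leq_trans[OF H brelD(3)[OF r] brelD(3)[OF r']] .
  ultimately show "progress e H ?R n t t''"
    unfolding progress_def using brelD(1)[OF r] brelD(2)[OF r'] ab by blast
qed (use assms in blast)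
qed

end

section \<open>Encoding behaviour trees in the universe\<close>

text \<open>A path that leaves the tree yields an unspecified node. The encoding records it all the
  same, which is harmless, as only injectivity of the encoding is required.\<close>

fun node_at :: "'u beh \<Rightarrow> (nat \<times> nat) list \<Rightarrow> 'u beh" where
  "node_at t [] = t"
| "node_at t ((i, j) # p) = node_at (kids t ! i ! j) p"

text \<open>
  A tree is determined by the label, number of fresh variables and branching at each of its countably
  many paths; \<open>Seq\<close> collects these data.
\<close>

definition enc :: "('f, 'p, 'a) univ beh \<Rightarrow> ('f, 'p, 'a) univ" where
  "enc t = Seq (\<lambda>q. let s = node_at t (from_nat q) in Tag (to_nat (ext s, map length (kids s))) (lab s))"

definition dec :: "('f, 'p, 'a) univ \<Rightarrow> ('f, 'p, 'a) univ beh" where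
  "dec = the_inv enc"

lemma enc_eqD:
  assumes "enc t = enc t'"
  shows "lab (node_at t p) = lab (node_at t' p)" "ext (node_at t p) = ext (node_at t' p)"
    "map length (kids (node_at t p)) = map length (kids (node_at t' p))"
proof -
  have "(\<lambda>q. let s = node_at t (from_nat q) in Tag (to_nat (ext s, map length (kids s))) (lab s)) (to_nat p) =
      (\<lambda>q. let s = node_at t' (from_nat q) in Tag (to_nat (ext s, map length (kids s))) (lab s)) (to_nat p)"
    using assms unfolding enc_def by (metis (no_types, lifting) univ.inject(5))
  then show "lab (node_at t p) = lab (node_at t' p)" "ext (node_at t p) = ext (node_at t' p)"
    "map length (kids (node_at t p)) = map length (kids (node_at t' p))"
    by (simp_all add: Let_def)
qed

lemma inj_enc: "inj (enc :: ('f, 'p, 'a) univ beh \<Rightarrow> ('f, 'p, 'a) univ)"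
proof (rule injI)
  fix t t' :: "('f, 'p, 'a) univ beh" assume "enc t = enc t'"
  then have "\<forall>p. lab (node_at t p) = lab (node_at t' p) \<and> ext (node_at t p) = ext (node_at t' p) \<and>
      map length (kids (node_at t p)) = map length (kids (node_at t' p))"
    using enc_eqD by blast
  \<comment> \<open>Agreement at all paths is a bisimulation: the empty path yields label,
    \<open>ext\<close> and shape, and prefixing a path with \<open>(i, j)\<close> passes the
    agreement on to that subtree.\<close>
  then show "t = t'"
  proof (coinduction arbitrary: t t')
    case (Eq_beh t t')
    note root = Eq_beh[rule_format, of "[]", simplified]
    have len: "length (kids t) = length (kids t')" using root by (metis length_map)
    have len': "length (kids t ! i) = length (kids t' ! i)" if "i < length (kids t)" for i
      using root that len by (metis nth_map)
    have "\<forall>p. lab (node_at (kids t ! i ! j) p) = lab (node_at (kids t' ! i ! j) p) \<and>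
        ext (node_at (kids t ! i ! j) p) = ext (node_at (kids t' ! i ! j) p) \<and>
        map length (kids (node_at (kids t ! i ! j) p)) = map length (kids (node_at (kids t' ! i ! j) p))" for i j
      using Eq_beh[rule_format, of "(i, j) # _"] by simp
    then show ?case using root len len' by (auto simp: list_all2_conv_all_nth)
  qed
qed

lemma dec_enc [simp]: "dec (enc t) = t"
  unfolding dec_def by (rule the_inv_f_f[OF inj_enc])

section \<open>The cofree coalgebra\<close>

text \<open>Bisimilar trees have the same set of candidates, hence the same code. Keeping the code
  of a tree, from which \<open>dec\<close> recovers a member, avoids sets of trees, which the
  universe cannot hold in general.\<close>

definition bcls :: "('f, 'p, 'a) ufunctor \<Rightarrow> nat \<Rightarrow> ('f, 'p, 'a) univ beh \<Rightarrow> ('f, 'p, 'a) univ" where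
  "bcls H n t = enc (SOME s. brel True H n t s)"

definition cofree_ob ::
  "('f, 'p, 'a) ufunctor \<Rightarrow> ('f, 'p, 'a) ufunctor" where
  "cofree_ob H = \<lparr>
     ob = (\<lambda>n. \<lparr>carr = bcls H n ` {t. wfb H n t}, leq = (\<lambda>x y. brel False H n (dec x) (dec y))\<rparr>),
     act = (\<lambda>n m f x. bcls H n (tact H n m f (dec x)))\<rparr>"

abbreviation kid_classes :: "('f, 'p, 'a) ufunctor \<Rightarrow> nat \<Rightarrow> ('f, 'p, 'a) univ beh \<Rightarrow> ('f, 'p, 'a) univ set set" where
  "kid_classes H n t \<equiv> image (bcls H (n + ext t)) ` kidset t"

text \<open>One representative of the value of \<open>gam\<close>; it depends on the tree, and its
  class only on the bisimilarity class by \<open>brel_step\<close>.\<close>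

definition beh_step ::
  "('f, 'p, 'a) ufunctor \<Rightarrow> nat \<Rightarrow> ('f, 'p, 'a) univ beh \<Rightarrow> ('f, 'p, 'a) univ" where
  "beh_step H n t = Tag (ext t) (pp (kid_classes H n t))"

definition cofree_eps :: "('f, 'p, 'a) ufunctor \<Rightarrow> ('f, 'p, 'a) utrans" where
  "cofree_eps H = \<lparr>src = cofree_ob H, tgt = H,
     app = (\<lambda>n. restrict (\<lambda>x. lab (dec x)) (el (cofree_ob H) n))\<rparr>"

definition cofree_gam :: "('f, 'p, 'a) ufunctor \<Rightarrow> ('f, 'p, 'a) utrans" where
  "cofree_gam H = \<lparr>src = cofree_ob H, tgt = Pff_ob (cofree_ob H),
     app = (\<lambda>n. restrict (\<lambda>x. cls (cofree_ob H) n (beh_step H n (dec x))) (el (cofree_ob H) n))\<rparr>"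

lemma cofree_simps [simp]:
  "src (cofree_eps H) = cofree_ob H" "tgt (cofree_eps H) = H"
  "src (cofree_gam H) = cofree_ob H" "tgt (cofree_gam H) = Pff_ob (cofree_ob H)"
  by (simp_all add: cofree_eps_def cofree_gam_def)

lemma bcls_carr: "wfb H n t \<Longrightarrow> bcls H n t \<in> el (cofree_ob H) n"
  by (simp add: cofree_ob_def)

lemma cofree_carrE:
  assumes "x \<in> el (cofree_ob H) n"
  obtains t where "wfb H n t" "x = bcls H n t"
  using assms by (auto simp: cofree_ob_def)

lemma image_bcls_kidset:
  "wfb H n t \<Longrightarrow> kid_classes H n t \<in> fsets (cofree_ob H) (n + ext t)"
  by (rule finite_finite_image[OF kidset_finite_finite]) (auto intro: bcls_carr)

lemma beh_step_summands: "wfb H n t \<Longrightarrow> beh_step H n t \<in> summands (cofree_ob H) n"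
  unfolding beh_step_def by (rule summandsI) (rule image_bcls_kidset)

context
  fixes Sg :: "('f, 'q) sig" and H :: "('f, 'p, 'a) ufunctor"
  assumes H: "is_ofunctor Sg H"
begin

lemma brel_dec_bcls:
  assumes "wfb H n t"
  shows "brel True H n t (dec (bcls H n t))"
  using someI[of "brel True H n t", OF brel_refl[OF H assms]] by (simp add: bcls_def)

lemma bcls_eq_iff:
  assumes t: "wfb H n t" and t': "wfb H n t'"
  shows "bcls H n t = bcls H n t' \<longleftrightarrow> brel True H n t t'"
proof
  assume "bcls H n t = bcls H n t'"
  then show "brel True H n t t'"
    using brel_trans[OF H brel_dec_bcls[OF t]] brel_sym[OF brel_dec_bcls[OF t']] by simp
next
  assume r: "brel True H n t t'"
  have "brel True H n t = brel True H n t'"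
    using brel_trans[OF H r] brel_trans[OF H brel_sym[OF r]] by (intro ext iffI) blast+
  then show "bcls H n t = bcls H n t'" by (simp add: bcls_def)
qed

lemma act_cofree:
  assumes f: "f \<in> law Sg n m" and t: "wfb H m t"
  shows "act (cofree_ob H) n m f (bcls H m t) = bcls H n (tact H n m f t)"
proof -
  have r: "brel True H n (tact H n m f (dec (bcls H m t))) (tact H n m f t)"
    by (rule brel_tact[OF H f brel_sym[OF brel_dec_bcls[OF t]]])
  then show ?thesis
    using bcls_eq_iff[OF brelD(1)[OF r] brelD(2)[OF r]] by (simp add: cofree_ob_def)
qed

lemma ren_cofree:
  "i \<in> injections n m \<Longrightarrow> wfb H n t \<Longrightarrow> ren (cofree_ob H) n m i (bcls H n t) = bcls H m (bren H n m i t)"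
  unfolding ren_def beh_functor_simps by (rule act_cofree[OF injections_J_law])

lemma ren_wfb: "i \<in> injections n m \<Longrightarrow> wfb H n t \<Longrightarrow> wfb H m (bren H n m i t)"
  using ren_carr[OF beh_functor[OF H]] by simp

lemma leq_cofree:
  assumes t: "wfb H n t" and t': "wfb H n t'"
  shows "leq (ob (cofree_ob H) n) (bcls H n t) (bcls H n t') \<longleftrightarrow> brel False H n t t'"
proof -
  note 1 = brel_weaken[OF H brel_dec_bcls[OF t]] brel_weaken[OF H brel_sym[OF brel_dec_bcls[OF t]]]
  note 2 = brel_weaken[OF H brel_dec_bcls[OF t']] brel_weaken[OF H brel_sym[OF brel_dec_bcls[OF t']]]
  have "brel False H n (dec (bcls H n t)) (dec (bcls H n t')) \<longleftrightarrow> brel False H n t t'"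
    using brel_trans[OF H 1(1) brel_trans[OF H _ 2(2)]] brel_trans[OF H 1(2) brel_trans[OF H _ 2(1)]]
    by blast
  then show ?thesis by (simp add: cofree_ob_def)
qed

lemma eq_or_leq_cofree:
  "wfb H n t \<Longrightarrow> wfb H n t' \<Longrightarrow> eq_or_leq e (cofree_ob H) n (bcls H n t) (bcls H n t') \<longleftrightarrow> brel e H n t t'"
  by (cases e) (simp_all add: eq_or_leq_def bcls_carr leq_cofree bcls_eq_iff)

lemma cofree_ofunctor: "is_ofunctor Sg (cofree_ob H)"
  unfolding is_ofunctor_def
proof (intro conjI allI ballI)
  fix n
  have "reflp_on (el (cofree_ob H) n) (leq (ob (cofree_ob H) n))"
    by (intro reflp_onI) (auto elim!: cofree_carrE simp: leq_cofree intro: brel_refl[OF H])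
  moreover have "transp_on (el (cofree_ob H) n) (leq (ob (cofree_ob H) n))"
    by (intro transp_onI) (auto elim!: cofree_carrE simp: leq_cofree intro: brel_trans[OF H])
  ultimately show "is_ord_set (ob (cofree_ob H) n)" by (simp add: is_ord_set_def)
next
  fix n m f assume f: "f \<in> law Sg n m"
  show "monotone_map (ob (cofree_ob H) m) (ob (cofree_ob H) n) (act (cofree_ob H) n m f)"
    unfolding monotone_map_def
  proof (intro conjI Pi_I ballI impI)
    fix x assume x: "x \<in> el (cofree_ob H) m"
    obtain t where t: "wfb H m t" "x = bcls H m t" by (rule cofree_carrE[OF x])
    show "act (cofree_ob H) n m f x \<in> el (cofree_ob H) n"
      by (simp add: t act_cofree[OF f] bcls_carr wfb_tact[OF H f])
  next
    fix x y assume xy: "x \<in> el (cofree_ob H) m" "y \<in> el (cofree_ob H) m" "leq (ob (cofree_ob H) m) x y"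
    obtain t where t: "wfb H m t" "x = bcls H m t" by (rule cofree_carrE[OF xy(1)])
    obtain u where u: "wfb H m u" "y = bcls H m u" by (rule cofree_carrE[OF xy(2)])
    show "leq (ob (cofree_ob H) n) (act (cofree_ob H) n m f x) (act (cofree_ob H) n m f y)"
      using xy(3) t u wfb_tact[OF H f] brel_tact[OF H f] by (simp add: leq_cofree act_cofree[OF f])
  qed
next
  fix n x assume "x \<in> el (cofree_ob H) n"
  then show "act (cofree_ob H) n n (law_id n) x = x"
    by (auto elim!: cofree_carrE simp: act_cofree[OF law_id_law] tact_id[OF H])
next
  fix n m l f g x assume f: "f \<in> law Sg n m" and g: "g \<in> law Sg m l" and x: "x \<in> el (cofree_ob H) l"
  obtain t where t: "wfb H l t" "x = bcls H l t" by (rule cofree_carrE[OF x])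
  show "act (cofree_ob H) n l (law_comp g f) x = act (cofree_ob H) n m f (act (cofree_ob H) m l g x)"
    using t wfb_tact[OF H g t(1)]
    by (simp add: act_cofree[OF f] act_cofree[OF g] act_cofree[OF law_comp_law[OF f g]] tact_comp[OF H f g])
qed

text \<open>Taking classes commutes with renaming, and equality or order of classes is
  \<open>brel\<close> of members. Hence a comparison of subtrees is the same as one of their classes
  in the colimit.\<close>

lemma nest_bcls:
  assumes t: "wfb H n t" and t': "wfb H n t'"
    and i: "i \<in> injections (n + ext t) m" and j: "j \<in> injections (n + ext t') m"
  shows "nest e (eq_or_leq e (cofree_ob H) m)
      (image (ren (cofree_ob H) (n + ext t) m i) ` kid_classes H n t)
      (image (ren (cofree_ob H) (n + ext t') m j) ` kid_classes H n t') \<longleftrightarrow>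
    nest e (brel e H m) (image (bren H (n + ext t) m i) ` kidset t)
      (image (bren H (n + ext t') m j) ` kidset t')"
  unfolding nest_image
proof (rule iffI; erule nest_mono_strong)
  fix s s' x x' assume "s \<in> kidset t" "s' \<in> kidset t'" "x \<in> s" "x' \<in> s'"
  then have x: "wfb H (n + ext t) x" "wfb H (n + ext t') x'" using wfb_kid t t' by blast+
  have "eq_or_leq e (cofree_ob H) m (ren (cofree_ob H) (n + ext t) m i (bcls H (n + ext t) x)) (ren (cofree_ob H) (n + ext t') m j (bcls H (n + ext t') x'))
      \<longleftrightarrow> brel e H m (bren H (n + ext t) m i x) (bren H (n + ext t') m j x')"
    by (simp add: ren_cofree[OF i x(1)] ren_cofree[OF j x(2)] eq_or_leq_cofree
        ren_wfb[OF i x(1)] ren_wfb[OF j x(2)])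
  then show "eq_or_leq e (cofree_ob H) m (ren (cofree_ob H) (n + ext t) m i (bcls H (n + ext t) x))
        (ren (cofree_ob H) (n + ext t') m j (bcls H (n + ext t') x')) \<Longrightarrow>
      brel e H m (bren H (n + ext t) m i x) (bren H (n + ext t') m j x')"
    and "brel e H m (bren H (n + ext t) m i x) (bren H (n + ext t') m j x') \<Longrightarrow>
      eq_or_leq e (cofree_ob H) m (ren (cofree_ob H) (n + ext t) m i (bcls H (n + ext t) x))
        (ren (cofree_ob H) (n + ext t') m j (bcls H (n + ext t') x'))"
    by blast+
qed

text \<open>The cospan that witnesses \<open>brel\<close> is a cospan for the colimit. With
  \<open>e\<close> this makes \<open>gam\<close> well defined on classes, without \<open>e\<close>
  it makes \<open>gam\<close> monotone.\<close>

lemma brel_step: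
  assumes r: "brel e H n t t'"
  shows "colim_rel e (cofree_ob H) n (beh_step H n t) (beh_step H n t')"
proof -
  note t = brelD(1)[OF r] and t' = brelD(2)[OF r]
  obtain i j m where i: "i \<in> inj_under n (ext t) m" and j: "j \<in> inj_under n (ext t') m"
    and nest: "nest e (brel e H (n + m)) (ren_kids H n m i t)
      (ren_kids H n m j t')" by (rule brelE[OF r])
  then have "cospan_rel e (cofree_ob H) n (ext t) (kid_classes H n t)
      (ext t') (kid_classes H n t')"
    unfolding cospan_rel_def
    using nest_bcls[OF t t' inj_underD(1)[OF i] inj_underD(1)[OF j]] by blast
  then show ?thesis
    unfolding beh_step_def
    using colim_rel_iff[OF cofree_ofunctor image_bcls_kidset[OF t] image_bcls_kidset[OF t']] by blast
qed

lemma eps_bcls: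
  assumes t: "wfb H n t"
  shows "app (cofree_eps H) n (bcls H n t) = lab t"
  using brelD(3)[OF brel_dec_bcls[OF t]] bcls_carr[OF t] by (simp add: cofree_eps_def eq_or_leq_def)

lemma gam_bcls:
  assumes t: "wfb H n t"
  shows "app (cofree_gam H) n (bcls H n t) = cls (cofree_ob H) n (beh_step H n t)"
proof -
  have "cls (cofree_ob H) n (beh_step H n (dec (bcls H n t))) = cls (cofree_ob H) n (beh_step H n t)"
    using brel_step[OF brel_sym[OF brel_dec_bcls[OF t]]] by (simp add: cls_eq_iff colim_rel_def)
  then show ?thesis using bcls_carr[OF t] by (simp add: cofree_gam_def)
qed

lemma plus_act_beh_step:
  assumes f: "f \<in> law Sg n m" and t: "wfb H m t"
  shows "tag_map (plus_act (cofree_ob H) n m f) (beh_step H m t) = beh_step H n (tact H n m f t)"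
proof -
  have "image (plus_act (cofree_ob H) n m f (ext t)) ` kid_classes H m t =
      image (bcls H (n + ext t)) ` kidset (tact H n m f t)"
    unfolding kidset_tact image_image plus_act_def
    by (intro image_cong refl act_cofree[OF law_plus_law[OF f]]) (rule wfb_kid[OF t])
  then show ?thesis
    unfolding beh_step_def tag_map_pp[OF image_bcls_kidset[OF t]] by simp
qed

lemma cofree_eps_trans: "is_trans Sg (cofree_eps H)"
proof (rule is_transI, simp_all add: H cofree_ofunctor)
  show "app (cofree_eps H) n \<in> extensional (el (cofree_ob H) n)" for n
    by (simp add: cofree_eps_def)
  show "app (cofree_eps H) n x \<in> el H n" if "x \<in> el (cofree_ob H) n" for n x
    using that by (auto elim!: cofree_carrE simp: eps_bcls wfb_lab)
  show "leq (ob H n) (app (cofree_eps H) n x) (app (cofree_eps H) n y)"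
    if xy: "x \<in> el (cofree_ob H) n" "y \<in> el (cofree_ob H) n" "leq (ob (cofree_ob H) n) x y" for n x y
  proof -
    obtain t where t: "wfb H n t" "x = bcls H n t" by (rule cofree_carrE[OF xy(1)])
    obtain u where u: "wfb H n u" "y = bcls H n u" by (rule cofree_carrE[OF xy(2)])
    have "brel False H n t u" using xy(3) t u by (simp add: leq_cofree)
    from brelD(3)[OF this] show ?thesis by (simp add: t u eps_bcls eq_or_leq_def)
  qed
  have eq: "act H n m f (app (cofree_eps H) m x) = app (cofree_eps H) n (act (cofree_ob H) n m f x)"
    if f: "f \<in> law Sg n m" and x: "x \<in> el (cofree_ob H) m" for n m f x
    using x by (auto elim!: cofree_carrE simp: eps_bcls act_cofree[OF f] wfb_tact[OF H f])
  show "leq (ob H n) (act H n m f (app (cofree_eps H) m x)) (app (cofree_eps H) n (act (cofree_ob H) n m f x))"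
    if f: "f \<in> law Sg n m" and x: "x \<in> el (cofree_ob H) m" for n m f x
    unfolding eq[OF that, symmetric] using x
    by (intro leq_refl[OF H] act_carr[OF H f]) (auto elim!: cofree_carrE simp: eps_bcls wfb_lab)
  show "ren H n m i (app (cofree_eps H) n x) = app (cofree_eps H) m (ren (cofree_ob H) n m i x)"
    if "i \<in> injections n m" "x \<in> el (cofree_ob H) n" for n m i x
    unfolding ren_def using eq[OF injections_J_law] that by blast
qed

lemma cofree_gam_trans: "is_trans Sg (cofree_gam H)"
proof (rule is_transI, simp_all add: Pff_ob_ofunctor cofree_ofunctor)
  show "app (cofree_gam H) n \<in> extensional (el (cofree_ob H) n)" for n
    by (simp add: cofree_gam_def)
  show "app (cofree_gam H) n x \<in> carr (colim (cofree_ob H) n)" if "x \<in> el (cofree_ob H) n" for n x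
    using that by (auto elim!: cofree_carrE simp: gam_bcls beh_step_summands cls_carr)
  show "leq (colim (cofree_ob H) n) (app (cofree_gam H) n x) (app (cofree_gam H) n y)"
    if xy: "x \<in> el (cofree_ob H) n" "y \<in> el (cofree_ob H) n" "leq (ob (cofree_ob H) n) x y" for n x y
  proof -
    obtain t where t: "wfb H n t" "x = bcls H n t" by (rule cofree_carrE[OF xy(1)])
    obtain u where u: "wfb H n u" "y = bcls H n u" by (rule cofree_carrE[OF xy(2)])
    have "brel False H n t u" using xy(3) t u by (simp add: leq_cofree)
    from brel_step[OF this] show ?thesis by (simp add: t u gam_bcls colim_leq_cls colim_rel_def)
  qed
  have eq: "act (Pff_ob (cofree_ob H)) n m f (app (cofree_gam H) m x) = app (cofree_gam H) n (act (cofree_ob H) n m f x)"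
    if f: "f \<in> law Sg n m" and x: "x \<in> el (cofree_ob H) m" for n m f x
  proof -
    obtain t where t: "wfb H m t" "x = bcls H m t" by (rule cofree_carrE[OF x])
    show ?thesis
      by (simp add: t gam_bcls act_cofree[OF f] wfb_tact[OF H f] act_Pff_cls[OF cofree_ofunctor f]
          beh_step_summands plus_act_beh_step[OF f])
  qed
  show "leq (colim (cofree_ob H) n) (act (Pff_ob (cofree_ob H)) n m f (app (cofree_gam H) m x)) (app (cofree_gam H) n (act (cofree_ob H) n m f x))"
    if "f \<in> law Sg n m" "x \<in> el (cofree_ob H) m" for n m f x
    unfolding eq[OF that] by (rule colim_leq_refl)
  show "ren (Pff_ob (cofree_ob H)) n m i (app (cofree_gam H) n x) = app (cofree_gam H) m (ren (cofree_ob H) n m i x)"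
    if "i \<in> injections n m" "x \<in> el (cofree_ob H) n" for n m i x
    unfolding ren_def using eq[OF injections_J_law] that by blast
qed

end

section \<open>Bisimulation and finality\<close>

text \<open>For the order, the chain is: act after \<open>\<alpha>\<close> lies below
  \<open>\<alpha>\<close> after act by laxness, then monotonicity, then strictness. The right side
  admits only a renaming, since laxness points the wrong way there; for equality the left side needs
  a renaming too.\<close>

lemma app_mixed:
  assumes \<alpha>: "is_trans Sg \<alpha>" "src \<alpha> = Y" "tgt \<alpha> = Z"
    and f: "f \<in> law Sg N n" "x \<in> el Y n" and i: "i \<in> injections m N" "y \<in> el Y m"
    and e: "e \<Longrightarrow> \<exists>i'\<in>injections n N. f = J n i'"
    and rel: "eq_or_leq e Y N (act Y N n f x) (ren Y m N i y)"
  shows "eq_or_leq e Z N (act Z N n f (app \<alpha> n x)) (ren Z m N i (app \<alpha> m y))"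
proof -
  note Y = src_ofunctor[OF \<alpha>(1), unfolded \<alpha>(2)] and Z = tgt_ofunctor[OF \<alpha>(1), unfolded \<alpha>(3)]
  have fx: "act Y N n f x \<in> el Y N" using act_carr[OF Y f] .
  have ax: "app \<alpha> n x \<in> el Z n" using app_carr[OF \<alpha>(1)] f(2) \<alpha>(2,3) by auto
  have "eq_or_leq e Z N (act Z N n f (app \<alpha> n x)) (app \<alpha> N (act Y N n f x))"
  proof (cases e)
    case True
    then have "act Z N n f (app \<alpha> n x) = app \<alpha> N (act Y N n f x)"
      using e app_strict[OF \<alpha>(1)] f(2) \<alpha>(2,3) unfolding ren_def by metis
    then show ?thesis using eq_or_leq_refl[OF Z act_carr[OF Z f(1) ax]] by simp
  next
    case False
    then show ?thesis
      using app_lax[OF \<alpha>(1) f(1)] f(2) \<alpha>(2,3) act_carr[OF Z f(1) ax] app_carr[OF \<alpha>(1)] fx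
      by (auto simp: eq_or_leq_def)
  qed
  moreover have "eq_or_leq e Z N (app \<alpha> N (act Y N n f x)) (app \<alpha> N (ren Y m N i y))"
    using app_eq_or_leq[OF \<alpha>(1)] rel \<alpha>(2,3) by auto
  moreover have "app \<alpha> N (ren Y m N i y) = ren Z m N i (app \<alpha> m y)"
    using app_strict[OF \<alpha>(1) i(1)] i(2) \<alpha>(2,3) by auto
  ultimately show ?thesis using eq_or_leq_trans[OF Z] by metis
qed

definition tag_of :: "('f, 'p, 'a) univ \<Rightarrow> nat" where
  "tag_of u = (case u of Tag k S \<Rightarrow> k)"

text \<open>Any enumeration of the family will do: the choice affects the tree only up to
  bisimilarity.\<close>

definition list_of :: "('f, 'p, 'a) univ \<Rightarrow> ('f, 'p, 'a) univ list list" where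
  "list_of u = (SOME xss. set ` set xss = (case u of Tag k S \<Rightarrow> unpp S))"

primcorec unfold ::
  "(nat \<Rightarrow> ('f, 'p, 'a) univ \<Rightarrow> ('f, 'p, 'a) univ) \<Rightarrow> (nat \<Rightarrow> ('f, 'p, 'a) univ \<Rightarrow> ('f, 'p, 'a) univ) \<Rightarrow>
    nat \<Rightarrow> ('f, 'p, 'a) univ \<Rightarrow> ('f, 'p, 'a) univ beh" where
  "lab (unfold c l n y) = l n y"
| "ext (unfold c l n y) = tag_of (c n y)"
| "kids (unfold c l n y) = map (map (unfold c l (n + tag_of (c n y)))) (list_of (c n y))"

lemma ex_list_list:
  assumes "finite SS" "\<And>s. s \<in> SS \<Longrightarrow> finite s"
  shows "\<exists>xss. set ` set xss = SS"
  using assms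
proof (induction rule: finite_induct)
  case (insert s SS)
  obtain xss where "set ` set xss = SS" using insert by auto
  moreover obtain xs where "set xs = s" using insert.prems finite_list by blast
  ultimately have "set ` set (xs # xss) = insert s SS" by simp
  then show ?case by blast
qed simp

lemma unfold_step:
  assumes SS: "SS \<in> finite_finite X" and c: "c n y = Tag k (pp SS)"
  shows "ext (unfold c l n y) = k" "kidset (unfold c l n y) = image (unfold c l (n + k)) ` SS"
proof -
  have k: "tag_of (c n y) = k" by (simp add: c tag_of_def)
  have SS': "set ` set (list_of (c n y)) = SS"
    unfolding list_of_def c univ.case unpp_pp[OF SS]
    using SS by (intro someI_ex[OF ex_list_list]) (auto simp: finite_finite_def)
  have "kidset (unfold c l n y) =
      image (unfold c l (n + tag_of (c n y))) ` set ` set (list_of (c n y))"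
    by (simp add: kidset_def image_image)
  then show "kidset (unfold c l n y) = image (unfold c l (n + k)) ` SS" by (simp only: SS' k)
  show "ext (unfold c l n y) = k" by (simp add: k)
qed

context
  fixes Sg :: "('f, 'q) sig" and H :: "('f, 'p, 'a) ufunctor"
  assumes H: "is_ofunctor Sg H"
begin

text \<open>Coinduction on elements of the cofree coalgebra. A cospan moves subtrees into larger
  contexts, while \<open>R\<close> need not be closed under renaming; so bisimilarity is proved for
  \<open>R'\<close>, which relates trees whose classes are a common renaming of an
  \<open>R\<close>-related pair.\<close>

theorem cofree_bisimulation:
  assumes R: "\<And>n x y. R n x y \<Longrightarrow> x \<in> el (cofree_ob H) n \<and> y \<in> el (cofree_ob H) n \<and>
      app (cofree_eps H) n x = app (cofree_eps H) n y \<and>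
      (\<exists>k S T. S \<in> fsets (cofree_ob H) (n + k) \<and> T \<in> fsets (cofree_ob H) (n + k) \<and>
        app (cofree_gam H) n x = cls (cofree_ob H) n (Tag k (pp S)) \<and>
        app (cofree_gam H) n y = cls (cofree_ob H) n (Tag k (pp T)) \<and> nest True (R (n + k)) S T)"
    and xy: "R n x y"
  shows "x = y"
proof -
  note C = cofree_ofunctor[OF H] and B = beh_functor[OF H]
  note inj = inj_underD(1)
  define R' where "R' N t t' \<longleftrightarrow> wfb H N t \<and> wfb H N t' \<and> (\<exists>n x y i. R n x y \<and> i \<in> injections n N \<and>
    bcls H N t = ren (cofree_ob H) n N i x \<and> bcls H N t' = ren (cofree_ob H) n N i y)" for N t t'
  \<comment> \<open>One side of the step: the subtrees of \<open>t\<close> and the given family for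
    \<open>x\<close>, renamed along \<open>i\<close>, become equal in some context
    \<open>N + m\<close>.\<close>
  have cospan: "\<exists>m a b. a \<in> inj_under N (ext t) m \<and> b \<in> inj_under N k m \<and>
      image (bcls H (N + m)) ` ren_kids H N m a t =
        push (cofree_ob H) N k m b ` image (ren (cofree_ob H) (n + k) (N + k) (extend_injection n N i)) ` S"
    if t: "wfb H N t" and i: "i \<in> injections n N" and x: "x \<in> el (cofree_ob H) n"
      and S: "S \<in> fsets (cofree_ob H) (n + k)"
      and gam: "app (cofree_gam H) n x = cls (cofree_ob H) n (Tag k (pp S))" and tx: "bcls H N t = ren (cofree_ob H) n N i x"
    for N t n i x k S
  proof -
    let ?S = "image (ren (cofree_ob H) (n + k) (N + k) (extend_injection n N i)) ` S"
    have S': "?S \<in> fsets (cofree_ob H) (N + k)"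
      by (rule image_ren_finite_finite[OF C extend_injection[OF i] S])
    have "cls (cofree_ob H) N (beh_step H N t) = ren (Pff_ob (cofree_ob H)) n N i (app (cofree_gam H) n x)"
      using app_strict[OF cofree_gam_trans[OF H] i] x tx gam_bcls[OF H t] by simp
    also have "\<dots> = cls (cofree_ob H) N (tag_map (plus_act (cofree_ob H) N n (J n i)) (Tag k (pp S)))"
      unfolding gam ren_def by (rule act_Pff_cls[OF C injections_J_law[OF i] summandsI[OF S]])
    also have "\<dots> = cls (cofree_ob H) N (Tag k (pp ?S))"
      unfolding tag_map_pp[OF S] plus_act_def law_plus_J ren_def by simp
    finally have "colim_rel True (cofree_ob H) N (beh_step H N t) (Tag k (pp ?S))"
      by (simp add: cls_eq_iff colim_rel_def)
    then have "cospan_rel True (cofree_ob H) N (ext t) (kid_classes H N t) k ?S"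
      unfolding beh_step_def using colim_rel_iff[OF C image_bcls_kidset[OF t] S'] by blast
    then obtain m a b where a: "a \<in> inj_under N (ext t) m" and b: "b \<in> inj_under N k m"
      and nest: "nest True (eq_or_leq True (cofree_ob H) (N + m))
        (push (cofree_ob H) N (ext t) m a ` kid_classes H N t)
        (push (cofree_ob H) N k m b ` ?S)" unfolding cospan_rel_def by blast
    have "push (cofree_ob H) N (ext t) m a ` kid_classes H N t =
        push (cofree_ob H) N k m b ` ?S"
      by (rule nest_eqD[OF nest]) (simp add: eq_or_leq_def)
    moreover have "push (cofree_ob H) N (ext t) m a ` kid_classes H N t =
        image (bcls H (N + m)) ` ren_kids H N m a t"
      unfolding image_image by (intro image_cong refl ren_cofree[OF H inj[OF a]]) (rule wfb_kid[OF t])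
    ultimately show ?thesis using a b by auto
  qed
  have "R' N t t' \<Longrightarrow> brel True H N t t'" for N t t'
  proof (erule brel_coinduct_nest)
    fix N t t' assume "R' N t t'"
    then obtain n x y i where t: "wfb H N t" and t': "wfb H N t'" and r: "R n x y" and i: "i \<in> injections n N"
      and tx: "bcls H N t = ren (cofree_ob H) n N i x" and ty: "bcls H N t' = ren (cofree_ob H) n N i y"
      unfolding R'_def by blast
    have x: "x \<in> el (cofree_ob H) n" and y: "y \<in> el (cofree_ob H) n"
      and eps: "app (cofree_eps H) n x = app (cofree_eps H) n y" using R[OF r] by auto
    obtain k S T where S: "S \<in> fsets (cofree_ob H) (n + k)" and T: "T \<in> fsets (cofree_ob H) (n + k)"
      and gx: "app (cofree_gam H) n x = cls (cofree_ob H) n (Tag k (pp S))"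
      and gy: "app (cofree_gam H) n y = cls (cofree_ob H) n (Tag k (pp T))" and nest: "nest True (R (n + k)) S T"
      using R[OF r] by auto
    let ?i = "extend_injection n N i"
    note i' = extend_injection[OF i, of k]
    note St = image_ren_finite_finite[OF C i' S] and Tt = image_ren_finite_finite[OF C i' T]
    obtain m a b where a: "a \<in> inj_under N (ext t) m" and b: "b \<in> inj_under N k m"
      and 1: "image (bcls H (N + m)) ` ren_kids H N m a t =
        push (cofree_ob H) N k m b ` image (ren (cofree_ob H) (n + k) (N + k) ?i) ` S"
      using cospan[OF t i x S gx tx] by auto
    obtain m' a' b' where a': "a' \<in> inj_under N (ext t') m'" and b': "b' \<in> inj_under N k m'"
      and 2: "image (bcls H (N + m')) ` ren_kids H N m' a' t' =
        push (cofree_ob H) N k m' b' ` image (ren (cofree_ob H) (n + k) (N + k) ?i) ` T"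
      using cospan[OF t' i y T gy ty] by auto
    \<comment> \<open>The cospans for \<open>t\<close> and \<open>t'\<close> are unrelated.
      Amalgamating \<open>b\<close> and \<open>b'\<close> ensures that \<open>S\<close> and
      \<open>T\<close> reach the final context by one and the same renaming \<open>?q\<close>, as
      \<open>R'\<close> demands.\<close>
    obtain p d d' where d: "d \<in> inj_under N m p" and d': "d' \<in> inj_under N m' p"
      and eq: "\<And>x. x < N + k \<Longrightarrow> d (b x) = d' (b' x)"
      by (rule amalgamation[OF b b']) (rule that)
    define K where "K = ren_kids H N p (\<lambda>x. d (a x)) t"
    define K' where "K' = ren_kids H N p (\<lambda>x. d' (a' x)) t'"
    have da: "(\<lambda>x. d (a x)) \<in> inj_under N (ext t) p"
      and da': "(\<lambda>x. d' (a' x)) \<in> inj_under N (ext t') p"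
      and db: "(\<lambda>x. d (b x)) \<in> inj_under N k p"
      using inj_under_comp a a' b d d' by blast+
    have push: "image (bcls H (N + p)) ` ren_kids H N p (\<lambda>x. g (h x)) u =
        push (cofree_ob H) N l p g ` image (bcls H (N + l)) ` ren_kids H N l h u"
      if u: "wfb H N u" and h: "h \<in> inj_under N (ext u) l" and g: "g \<in> inj_under N l p"
      for u g h l
      unfolding image_image
    proof (intro image_cong refl)
      fix s v assume "s \<in> kidset u" "v \<in> s"
      then have v: "wfb H (N + ext u) v" using wfb_kid[OF u] by blast
      show "bcls H (N + p) (bren H (N + ext u) (N + p) (\<lambda>x. g (h x)) v) =
          ren (cofree_ob H) (N + l) (N + p) g (bcls H (N + l) (bren H (N + ext u) (N + l) h v))"
        using ren_ren[OF B inj[OF h] inj[OF g]] v ren_cofree[OF H inj[OF g] ren_wfb[OF H inj[OF h] v]] by simp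
    qed
    let ?q = "\<lambda>x. d (b (?i x))"
    have q: "?q \<in> injections (n + k) (N + p)" using injections_comp[OF i' inj[OF db]] .
    have KS: "image (bcls H (N + p)) ` K = image (ren (cofree_ob H) (n + k) (N + p) ?q) ` S"
      unfolding K_def push[OF t a d] 1
      by (simp add: image_ren_ren[OF C inj[OF b] inj[OF d] St] image_ren_ren[OF C i' inj[OF db] S])
    have c: "ren (cofree_ob H) (N + k) (N + p) (\<lambda>x. d' (b' x)) = ren (cofree_ob H) (N + k) (N + p) (\<lambda>x. d (b x))"
      by (rule ren_cong) (simp add: eq)
    have KT: "image (bcls H (N + p)) ` K' = image (ren (cofree_ob H) (n + k) (N + p) ?q) ` T"
      unfolding K'_def push[OF t' a' d'] 2
      by (simp add: image_ren_ren[OF C inj[OF b'] inj[OF d'] Tt] image_ren_ren[OF C i' inj[OF db] T] c)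
    let ?R = "\<lambda>z w. \<exists>x y. R (n + k) x y \<and> z = ren (cofree_ob H) (n + k) (N + p) ?q x \<and> w = ren (cofree_ob H) (n + k) (N + p) ?q y"
    have "nest True ?R (image (ren (cofree_ob H) (n + k) (N + p) ?q) ` S) (image (ren (cofree_ob H) (n + k) (N + p) ?q) ` T)"
      unfolding nest_image by (rule nest_mono_strong[OF nest]) blast
    then have "nest True (\<lambda>z w. ?R (bcls H (N + p) z) (bcls H (N + p) w)) K K'"
      unfolding KS[symmetric] KT[symmetric] nest_image .
    then have "nest True (R' (N + p)) K K'"
    proof (rule nest_mono_strong)
      fix s s' z w assume s: "s \<in> K" "s' \<in> K'" "z \<in> s" "w \<in> s'" and zw: "?R (bcls H (N + p) z) (bcls H (N + p) w)"
      have "wfb H (N + p) z" "wfb H (N + p) w"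
        using s ren_wfb[OF H inj[OF da]] ren_wfb[OF H inj[OF da']] wfb_kid[OF t] wfb_kid[OF t']
        unfolding K_def K'_def by auto
      then show "R' (N + p) z w" unfolding R'_def using zw q by blast
    qed
    moreover have "lab t = ren H n N i (app (cofree_eps H) n x)"
      using app_strict[OF cofree_eps_trans[OF H] i, of x] x eps_bcls[OF H t] unfolding tx by simp
    moreover have "lab t' = ren H n N i (app (cofree_eps H) n y)"
      using app_strict[OF cofree_eps_trans[OF H] i, of y] y eps_bcls[OF H t'] unfolding ty by simp
    ultimately have 3: "nest True (R' (N + p)) K K'" "lab t = lab t'" using eps by simp_all
    then have "eq_or_leq True H N (lab t) (lab t')" using wfb_lab[OF t] by (simp add: eq_or_leq_def)
    with 3 show "progress True H R' N t t'"
    unfolding progress_def using t t' da da' unfolding K_def K'_def by blast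
  qed
  moreover obtain t where t: "wfb H n t" "x = bcls H n t" using R[OF xy] cofree_carrE by blast
  moreover obtain t' where t': "wfb H n t'" "y = bcls H n t'" using R[OF xy] cofree_carrE by blast
  moreover have "R' n t t'"
    unfolding R'_def using t t' xy ren_id[OF C] R[OF xy] injections_id by metis
  ultimately show ?thesis using bcls_eq_iff[OF H] by blast
qed

section \<open>The universal property of the cofree coalgebra\<close>

context
  fixes Y :: "('f, 'p, 'a) ufunctor" and c l :: "('f, 'p, 'a) utrans"
  assumes c: "is_trans Sg c" "src c = Y" "tgt c = Pff_ob Y"
    and l: "is_trans Sg l" "src l = Y" "tgt l = H"
begin

lemma coalg_ofunctor: "is_ofunctor Sg Y"
  using src_ofunctor[OF c(1)] c(2) by simp

lemma coalgE:
  assumes "y \<in> el Y n"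
  obtains k SS where "SS \<in> fsets Y (n + k)" "app c n y = Tag k (pp SS)"
proof -
  have "app c n y \<in> carr (colim Y n)" using app_carr[OF c(1), of y n] assms c(2,3) by simp
  from summandsE[OF carr_colimD(1)[OF coalg_ofunctor this]] show ?thesis using that .
qed

lemma unfold_wfb: "y \<in> el Y n \<Longrightarrow> wfb H n (unfold (app c) (app l) n y)"
proof (coinduction arbitrary: n y)
  case wfb
  obtain k SS where SS: "SS \<in> fsets Y (n + k)" and cy: "app c n y = Tag k (pp SS)"
    by (rule coalgE[OF wfb])
  have "app l n y \<in> el H n" using app_carr[OF l(1)] wfb l(2,3) by auto
  moreover have "tag_of (app c n y) = k" by (simp add: cy tag_of_def)
  moreover have "\<exists>y'. u = unfold (app c) (app l) (n + k) y' \<and> y' \<in> el Y (n + k)"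
    if "s \<in> kidset (unfold (app c) (app l) n y)" "u \<in> s" for s u
    using that finite_finiteD[OF SS]
    unfolding unfold_step(2)[where c = "app c" and n = n and y = y, OF SS cy] by blast
  ultimately show ?case by auto
qed

text \<open>Passing to subtrees extends \<open>f\<close> and \<open>i\<close> by fresh variables and
  composes them with the legs of a cospan. A candidate closed under this has to allow any arrow on
  the left and any renaming on the right.\<close>

lemma unfold_brel:
  assumes "f \<in> law Sg N n" "x \<in> el Y n" "i \<in> injections m N" "y \<in> el Y m"
    "e \<Longrightarrow> \<exists>i'\<in>injections n N. f = J n i'" "eq_or_leq e Y N (act Y N n f x) (ren Y m N i y)"
  shows "brel e H N (tact H N n f (unfold (app c) (app l) n x)) (tact H N m (J m i) (unfold (app c) (app l) m y))"
proof -
  define R where "R N t t' \<longleftrightarrow> (\<exists>n m f i x y. t = tact H N n f (unfold (app c) (app l) n x) \<and> t' = tact H N m (J m i) (unfold (app c) (app l) m y) \<and>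
    f \<in> law Sg N n \<and> x \<in> el Y n \<and> i \<in> injections m N \<and> y \<in> el Y m \<and>
    (e \<longrightarrow> (\<exists>i'\<in>injections n N. f = J n i')) \<and> eq_or_leq e Y N (act Y N n f x) (ren Y m N i y))" for N t t'
  have "R N (tact H N n f (unfold (app c) (app l) n x)) (tact H N m (J m i) (unfold (app c) (app l) m y))"
    unfolding R_def using assms by blast
  then show ?thesis
  proof (rule brel_coinduct_nest)
    fix N t t' assume "R N t t'"
    then obtain n m f i x y where t: "t = tact H N n f (unfold (app c) (app l) n x)" and t': "t' = tact H N m (J m i) (unfold (app c) (app l) m y)"
      and f: "f \<in> law Sg N n" and x: "x \<in> el Y n" and i: "i \<in> injections m N" and y: "y \<in> el Y m"
      and e: "e \<Longrightarrow> \<exists>i'\<in>injections n N. f = J n i'" and rel: "eq_or_leq e Y N (act Y N n f x) (ren Y m N i y)"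
      unfolding R_def by blast
    note PY = Pff_ob_ofunctor[OF coalg_ofunctor]
    note Ji = injections_J_law[OF i]
    have wt: "wfb H N t" "wfb H N t'"
      unfolding t t' using wfb_tact[OF H f unfold_wfb[OF x]] wfb_tact[OF H Ji unfold_wfb[OF y]] by auto
    have "eq_or_leq e H N (lab t) (lab t')"
      using app_mixed[OF l f x i y e rel] by (simp add: t t' ren_def)
    moreover
    obtain k S where S: "S \<in> fsets Y (n + k)" and cx: "app c n x = Tag k (pp S)"
      by (rule coalgE[OF x])
    obtain k' T where T: "T \<in> fsets Y (m + k')" and cy: "app c m y = Tag k' (pp T)"
      by (rule coalgE[OF y])
    let ?S = "image (act Y (N + k) (n + k) (law_plus N f k)) ` S"
    let ?T = "image (act Y (N + k') (m + k') (law_plus N (J m i) k')) ` T"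
    have fin: "?S \<in> fsets Y (N + k)" "?T \<in> fsets Y (N + k')"
      using act_carr[OF coalg_ofunctor law_plus_law[OF f]] act_carr[OF coalg_ofunctor law_plus_law[OF Ji]]
        finite_finite_image[OF S] finite_finite_image[OF T] by blast+
    have "act (Pff_ob Y) N n f (app c n x) = cls Y N (Tag k (pp ?S))"
      "ren (Pff_ob Y) m N i (app c m y) = cls Y N (Tag k' (pp ?T))"
      unfolding ren_def cx cy act_Pff[OF summandsI[OF S]] act_Pff[OF summandsI[OF T]]
        tag_map_pp[OF S] tag_map_pp[OF T] plus_act_def by simp_all
    then have "eq_or_leq e (Pff_ob Y) N (cls Y N (Tag k (pp ?S))) (cls Y N (Tag k' (pp ?T)))"
      using app_mixed[OF c f x i y e rel] by simp
    then have "colim_rel e Y N (Tag k (pp ?S)) (Tag k' (pp ?T))"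
      by (auto simp: eq_or_leq_def colim_rel_def cls_eq_iff colim_leq_cls split: if_splits)
    then have "cospan_rel e Y N k ?S k' ?T"
      using colim_rel_iff[OF coalg_ofunctor fin] by blast
    then obtain p a b where a: "a \<in> inj_under N k p" and b: "b \<in> inj_under N k' p"
      and nest: "nest e (eq_or_leq e Y (N + p)) (push Y N k p a ` ?S)
        (push Y N k' p b ` ?T)" unfolding cospan_rel_def by blast
    note inj = inj_underD(1)
    have ext: "ext t = k" "ext t' = k'"
      unfolding t t' by (simp_all add: tag_of_def cx cy)
    have kt: "kidset t = image (\<lambda>z. tact H (N + k) (n + k) (law_plus N f k) (unfold (app c) (app l) (n + k) z)) ` S"
      unfolding t kidset_tact unfold_step[where c = "app c" and n = n and y = x, OF S cx] image_image ..
    have kt': "kidset t' = image (\<lambda>z. tact H (N + k') (m + k') (law_plus N (J m i) k') (unfold (app c) (app l) (m + k') z)) ` T"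
      unfolding t' kidset_tact unfold_step[where c = "app c" and n = m and y = y, OF T cy] image_image ..
    have "nest e (R (N + p)) (ren_kids H N p a t)
        (ren_kids H N p b t')"
      unfolding ext kt kt' nest_image using nest[unfolded nest_image]
    proof (rule nest_mono_strong)
      fix s s' z w assume s: "s \<in> S" "s' \<in> T" "z \<in> s" "w \<in> s'"
      \<comment> \<open>The renamings \<open>a\<close> and \<open>b\<close> are absorbed into the
        accumulated arrow and the accumulated renaming, so the pair has the form required by
        \<open>R\<close>.\<close>
      let ?f = "law_comp (law_plus N f k) (J (N + k) a)"
      let ?j = "\<lambda>x. b (extend_injection m N i x)"
      assume r: "eq_or_leq e Y (N + p)
        (ren Y (N + k) (N + p) a (act Y (N + k) (n + k) (law_plus N f k) z))
        (ren Y (N + k') (N + p) b (act Y (N + k') (m + k') (law_plus N (J m i) k') w))"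
      have z: "z \<in> el Y (n + k)" and w: "w \<in> el Y (m + k')"
        using finite_finiteD[OF S] finite_finiteD[OF T] s by blast+
      note Ja = injections_J_law[OF inj[OF a], of Sg]
      note fk = law_plus_law[OF f, of k]
      note i' = extend_injection[OF i, of k']
      have f': "?f \<in> law Sg (N + p) (n + k)" using law_comp_law[OF Ja fk] .
      have j': "?j \<in> injections (m + k') (N + p)" using injections_comp[OF i' inj[OF b]] .
      have "\<exists>i'\<in>injections (n + k) (N + p). ?f = J (n + k) i'" if e': e
      proof -
        obtain j where j: "j \<in> injections n N" "f = J n j" using e[OF e'] by blast
        note j' = extend_injection[OF j(1), of k]
        have "?f = J (n + k) (\<lambda>x. a (extend_injection n N j x))"
          unfolding j(2) law_plus_J using j' by (intro law_comp_J_J) (simp add: injections_def)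
        then show ?thesis using injections_comp[OF j' inj[OF a]] by blast
      qed
      moreover have "ren Y (N + k) (N + p) a (act Y (N + k) (n + k) (law_plus N f k) z) =
          act Y (N + p) (n + k) ?f z"
        unfolding ren_def using act_comp[OF coalg_ofunctor Ja fk z] by simp
      moreover have "ren Y (N + k') (N + p) b (act Y (N + k') (m + k') (law_plus N (J m i) k') w) =
          ren Y (m + k') (N + p) ?j w"
        using ren_ren[OF coalg_ofunctor i' inj[OF b] w] unfolding ren_def law_plus_J .
      moreover have "bren H (N + k) (N + p) a (tact H (N + k) (n + k) (law_plus N f k) (unfold (app c) (app l) (n + k) z)) =
          tact H (N + p) (n + k) ?f (unfold (app c) (app l) (n + k) z)"
        unfolding ren_def using tact_comp[OF H Ja fk unfold_wfb[OF z]] by simp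
      moreover have "bren H (N + k') (N + p) b
          (tact H (N + k') (m + k') (law_plus N (J m i) k') (unfold (app c) (app l) (m + k') w)) =
          tact H (N + p) (m + k') (J (m + k') ?j) (unfold (app c) (app l) (m + k') w)"
        using ren_ren[OF beh_functor[OF H] i' inj[OF b], of "unfold (app c) (app l) (m + k') w"] unfold_wfb[OF w]
        unfolding ren_def law_plus_J by simp
      ultimately show "R (N + p)
          (bren H (N + k) (N + p) a (tact H (N + k) (n + k) (law_plus N f k) (unfold (app c) (app l) (n + k) z)))
          (bren H (N + k') (N + p) b
            (tact H (N + k') (m + k') (law_plus N (J m i) k') (unfold (app c) (app l) (m + k') w)))"
        unfolding R_def using r f' j' z w by (intro exI) auto
    qed
    ultimately show "progress e H R N t t'"
    unfolding progress_def using wt a b unfolding ext by blast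
  qed
qed

definition behaviour :: "('f, 'p, 'a) utrans" where
  "behaviour = \<lparr>src = Y, tgt = (cofree_ob H), app = (\<lambda>n. restrict (\<lambda>y. bcls H n (unfold (app c) (app l) n y)) (el Y n))\<rparr>"

lemma behaviour_simps [simp]: "src behaviour = Y" "tgt behaviour = (cofree_ob H)"
  "y \<in> el Y n \<Longrightarrow> app behaviour n y = bcls H n (unfold (app c) (app l) n y)"
  by (simp_all add: behaviour_def)

text \<open>One statement for three properties of \<open>behaviour\<close>: the identity arrow gives
  monotonicity, \<open>y = act Y N n f x\<close> gives laxness, and a renaming with \<open>e\<close>
  gives strictness.\<close>

lemma behaviour_mixed:
  assumes "f \<in> law Sg N n" "x \<in> el Y n" "y \<in> el Y N"
    "e \<Longrightarrow> \<exists>i'\<in>injections n N. f = J n i'" "eq_or_leq e Y N (act Y N n f x) y"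
  shows "eq_or_leq e (cofree_ob H) N (act (cofree_ob H) N n f (app behaviour n x)) (app behaviour N y)"
proof -
  have "brel e H N (tact H N n f (unfold (app c) (app l) n x)) (tact H N N (J N (\<lambda>x. x)) (unfold (app c) (app l) N y))"
    by (rule unfold_brel) (use assms ren_id[OF coalg_ofunctor] injections_id in auto)
  then show ?thesis
    using assms(2,3) unfold_wfb wfb_tact[OF H assms(1)]
    by (simp add: act_cofree[OF H assms(1)] eq_or_leq_cofree[OF H] J_id tact_id[OF H])
qed

lemma behaviour_trans: "is_trans Sg behaviour"
proof (rule is_transI)
  show "is_ofunctor Sg (src behaviour)" "is_ofunctor Sg (tgt behaviour)"
    using coalg_ofunctor cofree_ofunctor[OF H] by simp_all
  show "app behaviour n \<in> extensional (el (src behaviour) n)" for n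
    by (simp add: behaviour_def)
  show "app behaviour n y \<in> el (tgt behaviour) n" if "y \<in> el (src behaviour) n" for n y
    using that by (simp add: bcls_carr unfold_wfb)
  show "leq (ob (tgt behaviour) n) (app behaviour n x) (app behaviour n y)"
    if "x \<in> el (src behaviour) n" "y \<in> el (src behaviour) n" "leq (ob (src behaviour) n) x y" for n x y
  proof -
    have "eq_or_leq False (cofree_ob H) n (act (cofree_ob H) n n (law_id n) (app behaviour n x)) (app behaviour n y)"
      by (rule behaviour_mixed[OF law_id_law]) (use that act_id[OF coalg_ofunctor] in \<open>simp_all add: eq_or_leq_def\<close>)
    then show ?thesis
      using that by (simp add: eq_or_leq_def act_id[OF cofree_ofunctor[OF H]] bcls_carr unfold_wfb)
  qed
  show "leq (ob (tgt behaviour) n) (act (tgt behaviour) n m f (app behaviour m y))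
      (app behaviour n (act (src behaviour) n m f y))"
    if f: "f \<in> law Sg n m" and y: "y \<in> el (src behaviour) m" for n m f y
  proof -
    have fy: "act Y n m f y \<in> el Y n" using act_carr[OF coalg_ofunctor f] y by simp
    have "eq_or_leq False (cofree_ob H) n (act (cofree_ob H) n m f (app behaviour m y)) (app behaviour n (act Y n m f y))"
      by (rule behaviour_mixed[OF f _ fy]) (use y fy leq_refl[OF coalg_ofunctor fy] in \<open>simp_all add: eq_or_leq_def\<close>)
    then show ?thesis by (simp add: eq_or_leq_def)
  qed
  show "ren (tgt behaviour) n m i (app behaviour n y) = app behaviour m (ren (src behaviour) n m i y)"
    if i: "i \<in> injections n m" and y: "y \<in> el (src behaviour) n" for n m i y
  proof -
    have iy: "ren Y n m i y \<in> el Y m" using ren_carr[OF coalg_ofunctor i] y by simp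
    have "eq_or_leq True (cofree_ob H) m (act (cofree_ob H) m n (J n i) (app behaviour n y)) (app behaviour m (ren Y n m i y))"
      by (rule behaviour_mixed[OF injections_J_law[OF i] _ iy])
        (use y iy i in \<open>auto simp: eq_or_leq_def ren_def\<close>)
    then show ?thesis by (simp add: eq_or_leq_def ren_def)
  qed
qed

lemma gam_behaviour:
  "Comp (Lax_Inj Sg) (cofree_gam H) behaviour = Comp (Lax_Inj Sg) (Pff_arr behaviour) c"
proof (rule trans_eqI)
  show "is_trans Sg (Comp (Lax_Inj Sg) (cofree_gam H) behaviour)"
    by (rule Comp_trans[OF behaviour_trans cofree_gam_trans[OF H]]) simp
  show "is_trans Sg (Comp (Lax_Inj Sg) (Pff_arr behaviour) c)"
    by (rule Comp_trans[OF c(1) Pff_arr_trans[OF behaviour_trans]]) (simp add: c(3))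
  fix n y assume "y \<in> el (src (Comp (Lax_Inj Sg) (cofree_gam H) behaviour)) n"
  then have y: "y \<in> el Y n" by simp
  obtain k S where S: "S \<in> fsets Y (n + k)" and cy: "app c n y = Tag k (pp S)"
    by (rule coalgE[OF y])
  have "image (bcls H (n + k)) ` image (unfold (app c) (app l) (n + k)) ` S = image (app behaviour (n + k)) ` S"
    unfolding image_image
    by (intro image_cong refl behaviour_simps(3)[symmetric]) (rule finite_finiteD[OF S])
  then have "beh_step H n (unfold (app c) (app l) n y) = tag_map (\<lambda>k. app behaviour (n + k)) (app c n y)"
    unfolding beh_step_def unfold_step[where c = "app c" and n = n and y = y, OF S cy] cy tag_map_pp[OF S] by simp
  moreover have "app c n y \<in> carr (colim (src behaviour) n)"
    using app_carr[OF c(1), of y n] y c(2,3) by simp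
  ultimately show "app (Comp (Lax_Inj Sg) (cofree_gam H) behaviour) n y =
      app (Comp (Lax_Inj Sg) (Pff_arr behaviour) c) n y"
    using y app_Pff[OF behaviour_trans] by (simp add: c(2) gam_bcls[OF H unfold_wfb])
qed (simp_all add: c)

lemma eps_behaviour: "Comp (Lax_Inj Sg) (cofree_eps H) behaviour = l"
proof (rule trans_eqI[OF _ l(1)])
  show "is_trans Sg (Comp (Lax_Inj Sg) (cofree_eps H) behaviour)"
    by (rule Comp_trans[OF behaviour_trans cofree_eps_trans[OF H]]) simp
qed (simp_all add: l eps_bcls[OF H unfold_wfb])

text \<open>The pairs of values of \<open>g\<close> and \<open>behaviour\<close> at a common
  argument form a bisimulation: both maps send the argument to images of one family \<open>S\<close>
  under \<open>gam\<close>, and both are labelled by \<open>l\<close>.\<close>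

lemma behaviour_unique:
  assumes g: "is_trans Sg g" "src g = Y" "tgt g = (cofree_ob H)"
    and gam: "Comp (Lax_Inj Sg) (cofree_gam H) g = Comp (Lax_Inj Sg) (Pff_arr g) c"
    and eps: "Comp (Lax_Inj Sg) (cofree_eps H) g = l"
  shows "g = behaviour"
proof (rule trans_eqI[OF g(1) behaviour_trans])
  fix n y assume "y \<in> el (src g) n"
  then have y: "y \<in> el Y n" using g by simp
  define R where "R n x x' \<longleftrightarrow> (\<exists>y\<in>el Y n. x = app g n y \<and> x' = app behaviour n y)" for n x x'
  have step: "app h n y \<in> el (cofree_ob H) n \<and> app (cofree_eps H) n (app h n y) = app l n y \<and>
      image (app h (n + k)) ` S \<in> fsets (cofree_ob H) (n + k) \<and>
      app (cofree_gam H) n (app h n y) = cls (cofree_ob H) n (Tag k (pp (image (app h (n + k)) ` S)))"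
    if h: "is_trans Sg h" "src h = Y" "tgt h = (cofree_ob H)"
      and gam: "Comp (Lax_Inj Sg) (cofree_gam H) h = Comp (Lax_Inj Sg) (Pff_arr h) c"
      and eps: "Comp (Lax_Inj Sg) (cofree_eps H) h = l"
      and y: "y \<in> el Y n" and S: "S \<in> fsets Y (n + k)" and cy: "app c n y = Tag k (pp S)"
    for h n y k S
  proof -
    have hc: "app h n y \<in> el (cofree_ob H) n" if "y \<in> el Y n" for n y
      using app_carr[OF h(1)] h(2,3) that by auto
    have "app (cofree_gam H) n (app h n y) = app (Pff_arr h) n (app c n y)"
      using arg_cong[OF gam, of "\<lambda>t. app t n y"] y h c by simp
    also have "\<dots> = cls (cofree_ob H) n (tag_map (\<lambda>k. app h (n + k)) (app c n y))"
      using app_Pff[OF h(1), of "app c n y" n] app_carr[OF c(1), of y n] y h(2,3) c(2,3) by simp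
    finally have "app (cofree_gam H) n (app h n y) = cls (cofree_ob H) n (Tag k (pp (image (app h (n + k)) ` S)))"
      by (simp add: cy tag_map_pp[OF S])
    moreover have "app (cofree_eps H) n (app h n y) = app l n y"
      using arg_cong[OF eps, of "\<lambda>t. app t n y"] y h by simp
    ultimately show ?thesis using hc y finite_finite_image[OF S] by blast
  qed
  have "R n (app g n y) (app behaviour n y)" using y unfolding R_def by blast
  then show "app g n y = app behaviour n y"
  proof (rule cofree_bisimulation[rotated])
    fix n x x' assume "R n x x'"
    then obtain y where y: "y \<in> el Y n" "x = app g n y" "x' = app behaviour n y"
      unfolding R_def by blast
    obtain k S where S: "S \<in> fsets Y (n + k)" and cy: "app c n y = Tag k (pp S)"
      by (rule coalgE[OF y(1)])
    have "nest True (R (n + k)) (image (app g (n + k)) ` S) (image (app behaviour (n + k)) ` S)"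
      unfolding nest_image R_def using finite_finiteD[OF S] by (intro nest_refl) blast
    then show "x \<in> el (cofree_ob H) n \<and> x' \<in> el (cofree_ob H) n \<and>
      app (cofree_eps H) n x = app (cofree_eps H) n x' \<and>
      (\<exists>k S T. S \<in> fsets (cofree_ob H) (n + k) \<and> T \<in> fsets (cofree_ob H) (n + k) \<and>
        app (cofree_gam H) n x = cls (cofree_ob H) n (Tag k (pp S)) \<and>
        app (cofree_gam H) n x' = cls (cofree_ob H) n (Tag k (pp T)) \<and> nest True (R (n + k)) S T)"
      using step[OF g gam eps y(1) S cy]
        step[OF behaviour_trans behaviour_simps(1,2) gam_behaviour eps_behaviour y(1) S cy]
      unfolding y(2,3) by auto
  qed
qed (simp_all add: g)

end

end

theorem cofree_coalgebras_Lax_Inj: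
  fixes Sg :: "('f, 'q) sig"
  shows "cofree_coalgebras (Lax_Inj Sg)
    (Pff_ob :: ('f, 'p, 'a) ufunctor \<Rightarrow> ('f, 'p, 'a) ufunctor) Pff_arr
    cofree_ob cofree_eps cofree_gam"
proof (intro cofree_coalgebras.intro[OF endofunctor_Pff] cofree_coalgebras_axioms.intro)
  fix H Y :: "('f, 'p, 'a) ufunctor" and c l
  assume "H \<in> Obj (Lax_Inj Sg)" "c \<in> hom (Lax_Inj Sg) Y (Pff_ob Y)" "l \<in> hom (Lax_Inj Sg) Y H"
  then have H: "is_ofunctor Sg H" and c: "is_trans Sg c" "src c = Y" "tgt c = Pff_ob Y"
    and l: "is_trans Sg l" "src l = Y" "tgt l = H" by (simp_all add: hom_Lax_Inj Obj_Lax_Inj)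
  show "\<exists>!h. h \<in> hom (Lax_Inj Sg) Y (cofree_ob H) \<and>
      Comp (Lax_Inj Sg) (cofree_gam H) h = Comp (Lax_Inj Sg) (Pff_arr h) c \<and>
      Comp (Lax_Inj Sg) (cofree_eps H) h = l" (is "\<exists>!h. ?Q h")
  proof (rule ex1I[of _ "behaviour H Y c l"])
    show "?Q (behaviour H Y c l)"
      unfolding hom_Lax_Inj
      using behaviour_trans[OF H c l] behaviour_simps(1,2)[OF H c l] gam_behaviour[OF H c l]
        eps_behaviour[OF H c l] by (intro conjI)
    show "h = behaviour H Y c l" if "?Q h" for h
      using that behaviour_unique[OF H c l] unfolding hom_Lax_Inj by blast
  qed
next
  fix H :: "('f, 'p, 'a) ufunctor" assume "H \<in> Obj (Lax_Inj Sg)"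
  then have H: "is_ofunctor Sg H" by (simp add: Obj_Lax_Inj)
  show "cofree_ob H \<in> Obj (Lax_Inj Sg)" by (simp add: Obj_Lax_Inj cofree_ofunctor[OF H])
  show "cofree_eps H \<in> hom (Lax_Inj Sg) (cofree_ob H) H"
    by (simp add: hom_Lax_Inj cofree_eps_trans[OF H])
  show "cofree_gam H \<in> hom (Lax_Inj Sg) (cofree_ob H) (Pff_ob (cofree_ob H))"
    by (simp add: hom_Lax_Inj cofree_gam_trans[OF H])
qed

section \<open>Matching\<close>

lemma finite_vars: "finite (vars t)"
  by (induction t) auto

lemma finite_avars: "finite (avars A)"
  by (cases A) (simp add: finite_vars)

lemma subst_eq_iff: "subst \<sigma> t = subst \<tau> t \<longleftrightarrow> (\<forall>x\<in>vars t. \<sigma> x = \<tau> x)"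
  by (induction t) auto

lemma asubst_eq_iff: "asubst \<sigma> A = asubst \<tau> A \<longleftrightarrow> (\<forall>x\<in>avars A. \<sigma> x = \<tau> x)"
  by (cases A) (auto simp: subst_eq_iff)

lemma asubst_asubst: "asubst \<sigma> (asubst \<tau> A) = asubst (\<lambda>x. subst \<sigma> (\<tau> x)) A"
  by (cases A) (simp add: subst_subst)

lemma asubst_Var: "(\<And>x. x \<in> avars A \<Longrightarrow> \<sigma> x = Var x) \<Longrightarrow> asubst \<sigma> A = A"
  by (cases A) (auto intro!: map_idI subst_Var)

lemma avars_asubst: "avars (asubst \<sigma> A) = (\<Union>x\<in>avars A. vars (\<sigma> x))"
  by (cases A) (simp add: vars_subst)

lemma wf_trm_subst_iff: "wf_trm Sg (subst \<sigma> t) \<longleftrightarrow> wf_trm Sg t \<and> (\<forall>x\<in>vars t. wf_trm Sg (\<sigma> x))"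
  by (induction t) auto

lemma wf_atom_asubst_iff: "wf_atom Sg (asubst \<sigma> A) \<longleftrightarrow> wf_atom Sg A \<and> (\<forall>x\<in>avars A. wf_trm Sg (\<sigma> x))"
  by (cases A) (auto simp: wf_trm_subst_iff)

lemma asubst_atoms:
  "wf_atom Sg A \<Longrightarrow> (\<And>x. x \<in> avars A \<Longrightarrow> wf_trm Sg (\<sigma> x) \<and> vars (\<sigma> x) \<subseteq> {..<n}) \<Longrightarrow> asubst \<sigma> A \<in> atoms Sg n"
  by (auto simp: atoms_def wf_atom_asubst_iff avars_asubst)

lemma set_body_only_vars: "set (body_only_vars c) = (\<Union>B\<in>set (body c). avars B) - avars (head c)"
  by (simp add: body_only_vars_def finite_avars)

lemma distinct_body_only_vars: "distinct (body_only_vars c)"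
  by (simp add: body_only_vars_def)

lemma body_vars_cases:
  assumes "B \<in> set (body c)" "x \<in> avars B"
  obtains "x \<in> avars (head c)"
  | i where "i < length (body_only_vars c)" "x = body_only_vars c ! i"
  using assms set_body_only_vars[of c] by (metis DiffI UN_I in_set_conv_nth)

text \<open>
  The variables that do not occur in the clause are shifted beyond all others, since a most general
  matcher has to be most general on these variables as well.
\<close>

lemma ex_fresh_mgm:
  assumes \<sigma>: "asubst \<sigma> (head c) = A" and A: "avars A \<subseteq> {..<n}"
  shows "\<exists>\<theta>. fresh_mgm n \<theta> c A"
proof -
  define xs where "xs = body_only_vars c"
  define N where "N = n + length xs"
  define idx where "idx = the_inv_into {..<length xs} ((!) xs)"
  have idx: "idx (xs ! i) = i" if "i < length xs" for i
    unfolding idx_def using that distinct_body_only_vars[of c]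
    by (intro the_inv_into_f_f) (auto simp: xs_def inj_on_nth)
  define \<theta> where "\<theta> x = (if x \<in> avars (head c) then \<sigma> x else if x \<in> set xs then Var (n + idx x) else Var (N + x))" for x
  have xs: "x \<notin> avars (head c)" if "x \<in> set xs" for x
    using that by (simp add: xs_def set_body_only_vars)
  have \<theta>_idx: "\<theta> (xs ! i) = Var (n + i)" if "i < length xs" for i
    using that xs idx by (simp add: \<theta>_def)
  have "matcher \<theta> (head c) A"
    unfolding matcher_def \<sigma>[symmetric] asubst_eq_iff by (simp add: \<theta>_def)
  moreover have "\<exists>\<rho>. \<forall>x. \<tau> x = subst \<rho> (\<theta> x)" if \<tau>: "matcher \<tau> (head c) A" for \<tau>
  proof (intro exI allI)
    \<comment> \<open>Inverts \<open>\<theta>\<close> by ranges: variables of \<open>A\<close> are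
      kept, those in the fresh block return to the body-only variables, and those from
      \<open>N\<close> on to the variables foreign to the clause.\<close>
    define \<rho> where "\<rho> y = (if y < n then Var y else if y < N then \<tau> (xs ! (y - n)) else \<tau> (y - N))" for y
    have agree: "\<tau> x = \<sigma> x" if "x \<in> avars (head c)" for x
      using \<tau> \<sigma> that asubst_eq_iff unfolding matcher_def by metis
    fix x
    consider "x \<in> avars (head c)" | i where "i < length xs" "x = xs ! i" | "x \<notin> avars (head c)" "x \<notin> set xs"
      by (metis in_set_conv_nth)
    then show "\<tau> x = subst \<rho> (\<theta> x)"
    proof cases
      case 1
      then have "vars (\<sigma> x) \<subseteq> {..<n}" using A \<sigma> avars_asubst by blast
      then have "subst \<rho> (\<sigma> x) = \<sigma> x" by (intro subst_Var) (auto simp: \<rho>_def)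
      then show ?thesis using 1 agree by (simp add: \<theta>_def)
    next
      case 2
      then show ?thesis using \<theta>_idx by (simp add: \<rho>_def N_def)
    next
      case 3
      then show ?thesis by (simp add: \<theta>_def \<rho>_def N_def)
    qed
  qed
  moreover have "map \<theta> xs = map Var [n..<n + length xs]"
    by (rule nth_equalityI) (simp_all add: \<theta>_idx)
  ultimately show ?thesis unfolding fresh_mgm_def mgm_def xs_def by blast
qed

text \<open>A matcher can always be replaced by a most general one, so matching reduces to being an
  instance of the head.\<close>

lemma matches_iff: "matches c A \<longleftrightarrow> (\<exists>\<sigma>. asubst \<sigma> (head c) = A)"
proof
  assume "\<exists>\<sigma>. asubst \<sigma> (head c) = A"
  then obtain \<sigma> where \<sigma>: "asubst \<sigma> (head c) = A" by blast
  obtain n where "avars A \<subseteq> {..<n}"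
    using finite_avars[of A] unfolding finite_nat_set_iff_bounded by blast
  then show "matches c A" using ex_fresh_mgm[OF \<sigma>] unfolding matches_def fresh_mgm_def by blast
qed (auto simp: matches_def mgm_def matcher_def)

lemma fresh_mgm_head: "fresh_mgm n \<theta> c A \<Longrightarrow> asubst \<theta> (head c) = A"
  by (simp add: fresh_mgm_def mgm_def matcher_def)

lemma fresh_mgm_nth: "fresh_mgm n \<theta> c A \<Longrightarrow> i < length (body_only_vars c) \<Longrightarrow> \<theta> (body_only_vars c ! i) = Var (n + i)"
  unfolding fresh_mgm_def by (metis (no_types, lifting) add_diff_cancel_left' length_map length_upt nth_map nth_upt nat_add_left_cancel_less)

definition resolvent :: "nat \<Rightarrow> ('f, 'p) clause \<Rightarrow> ('f, 'p) atom \<Rightarrow> ('f, 'p) atom \<Rightarrow> ('f, 'p) atom" where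
  "resolvent n c A B = asubst (SOME \<theta>. fresh_mgm n \<theta> c A) B"

text \<open>On variables of the head \<open>\<theta>\<close> is forced by matching, on the others of
  the body by the naming of fresh variables; so the choice in \<open>resolvent\<close> does not
  matter.\<close>

lemma fresh_mgm_resolvent:
  assumes \<theta>: "fresh_mgm n \<theta> c A" and B: "B \<in> set (body c)"
  shows "asubst \<theta> B = resolvent n c A B"
proof -
  let ?\<theta> = "SOME \<theta>. fresh_mgm n \<theta> c A"
  have \<theta>': "fresh_mgm n ?\<theta> c A" using someI[of "\<lambda>\<theta>. fresh_mgm n \<theta> c A", OF \<theta>] .
  show ?thesis unfolding resolvent_def asubst_eq_iff
  proof
    fix x assume "x \<in> avars B"
    with B show "\<theta> x = ?\<theta> x"
    proof (cases rule: body_vars_cases)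
      case 1
      then show ?thesis using fresh_mgm_head[OF \<theta>] fresh_mgm_head[OF \<theta>'] asubst_eq_iff by metis
    next
      case (2 i)
      then show ?thesis using fresh_mgm_nth[OF \<theta>] fresh_mgm_nth[OF \<theta>'] by simp
    qed
  qed
qed

lemma length_le_num_fresh:
  assumes "c \<in> set P" "matches c A"
  shows "length (body_only_vars c) \<le> num_fresh P A"
proof -
  have "{length (body_only_vars c) |c. c \<in> set P \<and> matches c A} \<subseteq> (\<lambda>c. length (body_only_vars c)) ` set P"
    by blast
  then have "finite (insert 0 {length (body_only_vars c) |c. c \<in> set P \<and> matches c A})"
    using finite_subset by blast
  then show ?thesis unfolding num_fresh_def using assms by (intro Max_ge) auto
qed

lemma num_fresh_mono:
  assumes "\<And>c. c \<in> set P \<Longrightarrow> matches c A \<Longrightarrow> matches c A'"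
  shows "num_fresh P A \<le> num_fresh P A'"
proof -
  have "{length (body_only_vars c) |c. c \<in> set P \<and> matches c A'} \<subseteq> (\<lambda>c. length (body_only_vars c)) ` set P"
    by blast
  then have "finite (insert 0 {length (body_only_vars c) |c. c \<in> set P \<and> matches c A'})"
    using finite_subset by blast
  then show ?thesis unfolding num_fresh_def using assms by (intro Max_mono) auto
qed

lemma ex_fresh_mgm_atoms:
  "A \<in> atoms Sg n \<Longrightarrow> matches c A \<Longrightarrow> \<exists>\<theta>. fresh_mgm n \<theta> c A"
  unfolding matches_iff atoms_def using ex_fresh_mgm by blast

lemma resolvent_atoms:
  assumes P: "logic_program Sg P" and A: "A \<in> atoms Sg n" and c: "c \<in> set P" "matches c A"
    and B: "B \<in> set (body c)"
  shows "resolvent n c A B \<in> atoms Sg (n + num_fresh P A)"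
proof -
  obtain \<theta> where \<theta>: "fresh_mgm n \<theta> c A" using ex_fresh_mgm_atoms[OF A c(2)] by blast
  have "wf_trm Sg (\<theta> x) \<and> vars (\<theta> x) \<subseteq> {..<n + num_fresh P A}" if "x \<in> avars B" for x
    using B that
  proof (cases rule: body_vars_cases)
    case 1
    have "wf_atom Sg (asubst \<theta> (head c))" "avars (asubst \<theta> (head c)) \<subseteq> {..<n}"
      using A fresh_mgm_head[OF \<theta>] by (auto simp: atoms_def)
    then show ?thesis using 1 by (auto simp: wf_atom_asubst_iff avars_asubst subset_iff intro: trans_less_add1)
  next
    case (2 i)
    then show ?thesis using fresh_mgm_nth[OF \<theta>] length_le_num_fresh[OF c] by simp
  qed
  then show ?thesis
    using asubst_atoms[of Sg B] P c(1) B unfolding fresh_mgm_resolvent[OF \<theta> B, symmetric]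
    by (auto simp: logic_program_def)
qed

lemma matches_asubst: "matches c A \<Longrightarrow> matches c (asubst \<sigma> A)"
  unfolding matches_iff using asubst_asubst by metis

lemma tuple_subst_law_plus:
  assumes "length f = n"
  shows "x < n \<Longrightarrow> tuple_subst (law_plus n' f k) x = tuple_subst f x"
    "i < k \<Longrightarrow> tuple_subst (law_plus n' f k) (n + i) = Var (n' + i)"
  using assms by (simp_all add: tuple_subst_def law_plus_nth)

text \<open>Resolution commutes with instantiation: \<open>f + k\<close> sends the fresh variable
  \<open>n + i\<close> to \<open>n' + i\<close>, the name that the matcher for the instance uses.
  Any \<open>k\<close> large enough for this clause works.\<close>

lemma resolvent_asubst:
  assumes f: "f \<in> law Sg n' n" and A: "A \<in> atoms Sg n" "asubst (tuple_subst f) A \<in> atoms Sg n'"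
    and c: "matches c A" and B: "B \<in> set (body c)" and k: "length (body_only_vars c) \<le> k"
  shows "asubst (tuple_subst (law_plus n' f k)) (resolvent n c A B) = resolvent n' c (asubst (tuple_subst f) A) B"
proof -
  obtain \<theta> where \<theta>: "fresh_mgm n \<theta> c A" using ex_fresh_mgm_atoms[OF A(1) c] by blast
  obtain \<theta>' where \<theta>': "fresh_mgm n' \<theta>' c (asubst (tuple_subst f) A)"
    using ex_fresh_mgm_atoms[OF A(2) matches_asubst[OF c]] by blast
  show ?thesis
    unfolding fresh_mgm_resolvent[OF \<theta> B, symmetric] fresh_mgm_resolvent[OF \<theta>' B, symmetric]
      asubst_asubst asubst_eq_iff
  proof
    fix x assume "x \<in> avars B"
    with B show "subst (tuple_subst (law_plus n' f k)) (\<theta> x) = \<theta>' x"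
    proof (cases rule: body_vars_cases)
      case 1
      have "asubst (\<lambda>x. subst (tuple_subst f) (\<theta> x)) (head c) = asubst \<theta>' (head c)"
        using fresh_mgm_head[OF \<theta>] fresh_mgm_head[OF \<theta>'] asubst_asubst by metis
      then have "subst (tuple_subst f) (\<theta> x) = \<theta>' x" using 1 unfolding asubst_eq_iff by blast
      moreover have "vars (\<theta> x) \<subseteq> {..<n}"
        using 1 A(1) fresh_mgm_head[OF \<theta>] avars_asubst[of \<theta> "head c"] by (auto simp: atoms_def)
      then have "subst (tuple_subst (law_plus n' f k)) (\<theta> x) = subst (tuple_subst f) (\<theta> x)"
        by (intro subst_cong tuple_subst_law_plus(1)[OF law_length[OF f]]) auto
      ultimately show ?thesis by simp
    next
      case (2 i)
      then show ?thesis
        using fresh_mgm_nth[OF \<theta>] fresh_mgm_nth[OF \<theta>'] tuple_subst_law_plus(2)[OF law_length[OF f]] k by simp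
    qed
  qed
qed

section \<open>The coalgebra of a program\<close>

lemma nest_subset:
  assumes "X \<subseteq> Y" "\<And>s x. s \<in> X \<Longrightarrow> x \<in> s \<Longrightarrow> R x x"
  shows "nest False R X Y"
proof -
  have "\<exists>t\<in>Y. \<forall>x\<in>s. \<exists>y\<in>t. R x y" if "s \<in> X" for s
    using assms that by (intro bexI[of _ s]) auto
  then show ?thesis by (simp add: nest_def)
qed

lemma At_simps [simp]:
  "el (At Sg) n = Atm ` atoms Sg n"
  "leq (ob (At Sg) n) u v \<longleftrightarrow> u = v"
  "act (At Sg) n m f (Atm A) = Atm (asubst (tuple_subst f) A)"
  by (simp_all add: At_def)

lemma asubst_law_atoms:
  assumes f: "f \<in> law Sg n m" and A: "A \<in> atoms Sg m"
  shows "asubst (tuple_subst f) A \<in> atoms Sg n"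
proof (rule asubst_atoms)
  fix x assume "x \<in> avars A"
  then have "f ! x \<in> set f" using A law_length[OF f] by (auto simp: atoms_def)
  then show "wf_trm Sg (tuple_subst f x) \<and> vars (tuple_subst f x) \<subseteq> {..<n}"
    using f by (simp add: law_def tuple_subst_def)
qed (use A in \<open>simp add: atoms_def\<close>)

lemma asubst_law_id: "A \<in> atoms Sg n \<Longrightarrow> asubst (tuple_subst (law_id n)) A = A"
  by (rule asubst_Var) (auto simp: atoms_def tuple_subst_def law_id_def)

lemma asubst_law_comp:
  assumes "g \<in> law Sg m l" "A \<in> atoms Sg l"
  shows "asubst (tuple_subst (law_comp g f)) A = asubst (tuple_subst f) (asubst (tuple_subst g) A)"
  unfolding asubst_asubst asubst_eq_iff
  using assms law_length[OF assms(1)] by (auto simp: atoms_def law_comp_def tuple_subst_def subset_iff)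

lemma At_ofunctor: "is_ofunctor Sg (At Sg)"
  unfolding is_ofunctor_def is_ord_set_def monotone_map_def
  by (auto simp: asubst_law_atoms asubst_law_id asubst_law_comp intro!: reflp_onI transp_onI)

definition resolvent_sets ::
  "('f, 'p) clause list \<Rightarrow> nat \<Rightarrow> ('f, 'p) atom \<Rightarrow> ('f, 'p, 'a) univ set set" where
  "resolvent_sets P n A =
     (\<lambda>c. (\<lambda>B. Atm (resolvent n c A B)) ` set (body c)) ` {c \<in> set P. matches c A}"

lemma resolvents_pp:
  assumes "A \<in> atoms Sg n"
  shows "FinSet (Abs_fset (resolvents P n A)) = (pp (resolvent_sets P n A) :: ('f, 'p, 'a) univ)"
proof -
  have "(FinSet (fset_of_list (map (\<lambda>B. Atm (asubst \<theta> B)) (body c))) :: ('f, 'p, 'a) univ) =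
      FinSet (Abs_fset ((\<lambda>B. Atm (resolvent n c A B)) ` set (body c)))" if "fresh_mgm n \<theta> c A" for c \<theta>
  proof -
    have "(set (map (\<lambda>B. Atm (asubst \<theta> B)) (body c)) :: ('f, 'p, 'a) univ set) = (\<lambda>B. Atm (resolvent n c A B)) ` set (body c)"
      using fresh_mgm_resolvent[OF that] by (auto simp: image_iff)
    then show ?thesis by (metis fset_inverse fset_of_list.rep_eq)
  qed
  moreover have "matches c A" if "fresh_mgm n \<theta> c A" for c \<theta>
    using that unfolding matches_def fresh_mgm_def by blast
  ultimately have "(resolvents P n A :: ('f, 'p, 'a) univ set) = (\<lambda>s. FinSet (Abs_fset s)) ` resolvent_sets P n A"
    unfolding resolvents_def resolvent_sets_def
    using ex_fresh_mgm_atoms[OF assms] by (auto simp: image_iff) blast+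
  then show ?thesis by (simp add: pp_def)
qed

lemma resolvent_sets_finite_finite:
  "logic_program Sg P \<Longrightarrow> A \<in> atoms Sg n \<Longrightarrow>
    resolvent_sets P n A \<in> fsets (At Sg) (n + num_fresh P A)"
  by (auto simp: finite_finite_def resolvent_sets_def intro!: imageI resolvent_atoms)

lemma program_coalgebra_simps [simp]:
  "src (program_coalgebra Sg P) = At Sg" "tgt (program_coalgebra Sg P) = Pff_ob (At Sg)"
  by (simp_all add: program_coalgebra_def)

lemma app_program_coalgebra:
  "A \<in> atoms Sg n \<Longrightarrow> app (program_coalgebra Sg P) n (Atm A) =
    cls (At Sg) n (Tag (num_fresh P A) (pp (resolvent_sets P n A)))"
  by (simp add: program_coalgebra_def resolvents_pp)

lemma image_resolvent_sets:
  assumes P: "logic_program Sg P" and f: "f \<in> law Sg n m" and A: "A \<in> atoms Sg m"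
  shows "image (plus_act (At Sg) n m f (num_fresh P A)) ` resolvent_sets P m A =
    (\<lambda>c. (\<lambda>B. Atm (resolvent n c (asubst (tuple_subst f) A) B)) ` set (body c)) ` {c \<in> set P. matches c A}"
  unfolding resolvent_sets_def image_image plus_act_def At_simps
  using resolvent_asubst[OF f A asubst_law_atoms[OF f A] _ _ length_le_num_fresh]
  by (intro image_cong refl) simp

text \<open>A renaming can be undone by a substitution, so it creates no new matches; this gives the
  program coalgebra its strictness on injections.\<close>

lemma matches_renaming:
  assumes i: "i \<in> injections n m" and A: "A \<in> atoms Sg n" and c: "matches c (asubst (tuple_subst (J n i)) A)"
  shows "matches c A"
proof -
  define j where "j = the_inv_into {..<n} i"
  have j: "j (i x) = x" if "x < n" for x
    unfolding j_def using i that by (intro the_inv_into_f_f) (auto simp: injections_def)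
  have "asubst (\<lambda>y. Var (j y)) (asubst (tuple_subst (J n i)) A) = A"
    unfolding asubst_asubst using A j by (intro asubst_Var) (auto simp: atoms_def tuple_subst_def J_def)
  then show ?thesis using matches_asubst[OF c] by metis
qed

text \<open>Instantiating an atom keeps all matching clauses and may add others, so the resolvents
  form a larger set: the coalgebra is lax. Under a renaming the matching clauses and the number of
  fresh variables are unchanged.\<close>

lemma program_coalgebra_trans:
  assumes P: "logic_program Sg P"
  shows "is_trans Sg (program_coalgebra Sg P :: ('f, 'p, 'a) utrans)"
proof (rule is_transI)
  let ?p = "program_coalgebra Sg P :: ('f, 'p, 'a) utrans"
  let ?At = "At Sg :: ('f, 'p, 'a) ufunctor"
  note rs = resolvent_sets_finite_finite[OF P]
  show "is_ofunctor Sg (src ?p)" "is_ofunctor Sg (tgt ?p)"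
    by (simp_all add: At_ofunctor Pff_ob_ofunctor)
  show "app ?p n \<in> extensional (el (src ?p) n)" for n
    by (simp add: program_coalgebra_def)
  show "app ?p n u \<in> el (tgt ?p) n" if "u \<in> el (src ?p) n" for n u
    using that cls_carr[OF summandsI[OF rs]] by (auto simp: app_program_coalgebra)
  show "leq (ob (tgt ?p) n) (app ?p n u) (app ?p n v)"
    if "u \<in> el (src ?p) n" "v \<in> el (src ?p) n" "leq (ob (src ?p) n) u v" for n u v
    using that by (simp add: colim_leq_refl)
  have act_p: "act (Pff_ob ?At) n m f (app ?p m (Atm A)) = cls ?At n (Tag (num_fresh P A) (pp
      ((\<lambda>c. (\<lambda>B. Atm (resolvent n c (asubst (tuple_subst f) A) B)) ` set (body c)) ` {c \<in> set P. matches c A})))"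
    if f: "f \<in> law Sg n m" and A: "A \<in> atoms Sg m" for n m f A
    unfolding app_program_coalgebra[OF A] act_Pff_cls[OF At_ofunctor f summandsI[OF rs[OF A]]]
      tag_map_pp[OF rs[OF A]] image_resolvent_sets[OF P f A] ..
  show "leq (ob (tgt ?p) n) (act (tgt ?p) n m f (app ?p m u)) (app ?p n (act (src ?p) n m f u))"
    if f: "f \<in> law Sg n m" and u: "u \<in> el (src ?p) m" for n m f u
  proof -
    obtain A where A: "A \<in> atoms Sg m" "u = Atm A" using u by auto
    let ?A = "asubst (tuple_subst f) A"
    let ?k = "num_fresh P A" and ?k' = "num_fresh P ?A"
    have A': "?A \<in> atoms Sg n" using asubst_law_atoms[OF f A(1)] .
    have k: "?k \<le> ?k'" by (rule num_fresh_mono) (rule matches_asubst)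
    let ?S = "(\<lambda>c. (\<lambda>B. Atm (resolvent n c ?A B)) ` set (body c)) ` {c \<in> set P. matches c A} :: ('f, 'p, 'a) univ set set"
    have S: "?S \<in> fsets ?At (n + ?k)"
      unfolding image_resolvent_sets[OF P f A(1), symmetric]
      by (rule summand_map_finite_finite[OF summand_map_plus_act[OF At_ofunctor f] rs[OF A(1)]])
    have T: "resolvent_sets P n ?A \<in> fsets ?At (n + ?k')" by (rule rs[OF A'])
    \<comment> \<open>The instance may need more fresh variables, but these are named from
      \<open>n\<close> on in both cases; so moving from summand \<open>?k\<close> to
      \<open>?k'\<close> leaves the atoms as they are.\<close>
    have id: "ren ?At (n + ?k) (n + ?k') (\<lambda>x. x) v = v" if "v \<in> el ?At (n + ?k)" for v
      using that by (auto simp: ren_def J_id asubst_law_id)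
    have "image (ren ?At (n + ?k) (n + ?k') (\<lambda>x. x)) ` ?S = image (\<lambda>x. x) ` ?S"
      by (intro image_cong refl id) (rule finite_finiteD[OF S])
    then have S': "image (ren ?At (n + ?k) (n + ?k') (\<lambda>x. x)) ` ?S = ?S" by simp
    have sub: "?S \<subseteq> resolvent_sets P n ?A"
      unfolding resolvent_sets_def using matches_asubst by blast
    have "nest False (eq_or_leq False ?At (n + ?k')) ?S (resolvent_sets P n ?A)"
      using sub by (rule nest_subset) (rule eq_or_leq_refl[OF At_ofunctor finite_finiteD[OF T subsetD[OF sub]]])
    then have "cospan_rel False ?At n ?k ?S ?k' (resolvent_sets P n ?A)"
      unfolding cospan_rel_def using inj_under_id[OF k] inj_under_id[of ?k' ?k']
        S' image_ren_id[OF At_ofunctor T] by (intro exI[of _ ?k'] exI[of _ "\<lambda>x. x"]) simp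
    then have "colim_rel False ?At n (Tag ?k (pp ?S)) (Tag ?k' (pp (resolvent_sets P n ?A)))"
      unfolding colim_rel_iff[OF At_ofunctor S T] .
    then show ?thesis
      by (simp add: A(2) act_p[OF f A(1)] app_program_coalgebra[OF A'] colim_leq_cls colim_rel_def)
  qed
  show "ren (tgt ?p) n m i (app ?p n u) = app ?p m (ren (src ?p) n m i u)"
    if i: "i \<in> injections n m" and u: "u \<in> el (src ?p) n" for n m i u
  proof -
    obtain A where A: "A \<in> atoms Sg n" "u = Atm A" using u by auto
    note f = injections_J_law[OF i, of Sg]
    let ?A = "asubst (tuple_subst (J n i)) A"
    have A': "?A \<in> atoms Sg m" using asubst_law_atoms[OF f A(1)] .
    have eq: "matches c ?A \<longleftrightarrow> matches c A" for c
      using matches_renaming[OF i A(1)] matches_asubst by blast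
    show ?thesis
      by (simp add: A(2) ren_def act_p[OF f A(1)] app_program_coalgebra[OF A'] resolvent_sets_def eq num_fresh_def)
  qed
qed

section \<open>Coinductive trees\<close>

text \<open>A canonical coinductive tree, with \<open>resolvent\<close> supplying the matchers; for
  well-formed atoms it turns out to be the only one.\<close>

primcorec ctree :: "('f, 'p) clause list \<Rightarrow> nat \<Rightarrow> ('f, 'p) atom \<Rightarrow> (nat \<times> ('f, 'p) atom) and_tree" where
  "root (ctree P n A) = (n, A)"
| "or_nodes (ctree P n A) = map (map (ctree P (n + num_fresh P A)))
     (map (\<lambda>c. map (resolvent n c A) (body c)) (filter (\<lambda>c. matches c A) (remdups P)))"

lemma coinductive_tree_ctree:
  assumes P: "logic_program Sg P"
  shows "A \<in> atoms Sg n \<Longrightarrow> coinductive_tree P (ctree P n A)"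
proof (coinduction arbitrary: n A)
  case coinductive_tree
  note A = coinductive_tree
  let ?kids = "\<lambda>c. map (\<lambda>B. ctree P (n + num_fresh P A) (resolvent n c A B)) (body c)"
  let ?cs = "filter (\<lambda>c. matches c A) (remdups P)"
  let ?Q = "\<lambda>c ts. \<exists>\<theta>. fresh_mgm n \<theta> c A \<and>
    list_all2 (\<lambda>B t. root t = (n + num_fresh P A, asubst \<theta> B) \<and>
      ((\<exists>n A. t = ctree P n A \<and> A \<in> atoms Sg n) \<or> coinductive_tree P t)) (body c) ts"
  have "?Q c (?kids c)" if "c \<in> set ?cs" for c
  proof -
    have c: "c \<in> set P" "matches c A" using that by auto
    obtain \<theta> where \<theta>: "fresh_mgm n \<theta> c A" using ex_fresh_mgm_atoms[OF A c(2)] by blast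
    moreover have "list_all2 (\<lambda>B t. root t = (n + num_fresh P A, asubst \<theta> B) \<and>
        ((\<exists>n A. t = ctree P n A \<and> A \<in> atoms Sg n) \<or> coinductive_tree P t)) (body c) (?kids c)"
      unfolding list_all2_map2
    proof (rule list.rel_refl_strong)
      fix B assume B: "B \<in> set (body c)"
      show "root (ctree P (n + num_fresh P A) (resolvent n c A B)) = (n + num_fresh P A, asubst \<theta> B) \<and>
          ((\<exists>m A'. ctree P (n + num_fresh P A) (resolvent n c A B) = ctree P m A' \<and> A' \<in> atoms Sg m) \<or>
            coinductive_tree P (ctree P (n + num_fresh P A) (resolvent n c A B)))"
        using fresh_mgm_resolvent[OF \<theta> B] resolvent_atoms[OF P A c B] by auto
    qed
    ultimately show ?thesis by blast
  qed
  then have "list_all2 ?Q ?cs (map ?kids ?cs)"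
    unfolding list_all2_map2 by (rule list.rel_refl_strong)
  moreover have "ctree P n A = And_Node (n, A) (map ?kids ?cs)"
    by (rule and_tree.expand) (simp add: comp_def)
  ultimately show ?case by blast
qed

lemma coinductive_tree_unique:
  assumes P: "logic_program Sg P"
  shows "A \<in> atoms Sg n \<Longrightarrow> root T = (n, A) \<Longrightarrow> coinductive_tree P T \<Longrightarrow> T = ctree P n A"
proof (coinduction arbitrary: n A T)
  case (Eq_and_tree n A T)
  note A = Eq_and_tree(1) and r = Eq_and_tree(2)
  let ?R = "\<lambda>T T'. \<exists>n A. T' = ctree P n A \<and> A \<in> atoms Sg n \<and> root T = (n, A) \<and> coinductive_tree P T"
  let ?cs = "filter (\<lambda>c. matches c A) (remdups P)"
  have "list_all2 (\<lambda>c ts. \<exists>\<theta>. fresh_mgm n \<theta> c A \<and>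
        list_all2 (\<lambda>B t. root t = (n + num_fresh P A, asubst \<theta> B) \<and> coinductive_tree P t) (body c) ts)
     ?cs (or_nodes T)"
    using Eq_and_tree(3) r by (cases rule: coinductive_tree.cases) simp
  then have "list_all2 (\<lambda>c ts. list_all2 (\<lambda>B t. ?R t (ctree P (n + num_fresh P A) (resolvent n c A B))) (body c) ts)
     ?cs (or_nodes T)"
  proof (rule list.rel_mono_strong)
    fix c ts assume "c \<in> set ?cs" and "\<exists>\<theta>. fresh_mgm n \<theta> c A \<and>
        list_all2 (\<lambda>B t. root t = (n + num_fresh P A, asubst \<theta> B) \<and> coinductive_tree P t) (body c) ts"
    then obtain \<theta> where c: "c \<in> set P" "matches c A" and \<theta>: "fresh_mgm n \<theta> c A" and
      ts: "list_all2 (\<lambda>B t. root t = (n + num_fresh P A, asubst \<theta> B) \<and> coinductive_tree P t) (body c) ts"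
      by auto
    show "list_all2 (\<lambda>B t. ?R t (ctree P (n + num_fresh P A) (resolvent n c A B))) (body c) ts"
      by (rule list.rel_mono_strong[OF ts])
        (use fresh_mgm_resolvent[OF \<theta>] resolvent_atoms[OF P A c] in auto)
  qed
  then have "list_all2 (list_all2 ?R) (or_nodes T) (or_nodes (ctree P n A))"
    by (auto simp: list_all2_conv_all_nth)
  then show ?case using r by auto
qed

theorem coinductive_tree_for_iff:
  assumes "logic_program Sg P" "A \<in> atoms Sg n"
  shows "coinductive_tree_for P n A T \<longleftrightarrow> T = ctree P n A"
  using coinductive_tree_ctree[OF assms] coinductive_tree_unique[OF assms]
  by (auto simp: coinductive_tree_for_def)

section \<open>Identification of elements with trees\<close>

text \<open>Translates the condition in \<open>identified\<close>, phrased with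
  \<open>FinSet\<close> and lists, into \<open>nest\<close> on plain sets.\<close>

lemma nest_or_nodes:
  assumes SS: "SS \<in> finite_finite X" and S: "pp SS = FinSet S"
  shows "rel_set (\<lambda>u ts. \<exists>s. u = FinSet s \<and> rel_set Q (fset s) (set ts)) (fset S) (set tss) \<longleftrightarrow>
    nest True Q SS (set ` set tss)"
proof -
  let ?f = "\<lambda>s. FinSet (Abs_fset s)" and ?Q = "\<lambda>u ts. \<exists>s. u = FinSet s \<and> rel_set Q (fset s) (set ts)"
  have fin: "finite SS" "\<And>s. s \<in> SS \<Longrightarrow> finite s" using SS by (auto simp: finite_finite_def)
  have "S = Abs_fset (?f ` SS)" using S by (simp add: pp_def)
  then have fS: "fset S = ?f ` SS" using fin(1) by (simp add: Abs_fset_inverse)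
  have Q: "?Q (?f s) ts \<longleftrightarrow> rel_set Q s (set ts)" if "s \<in> SS" for s ts
    using fin(2)[OF that] by (simp add: Abs_fset_inverse)
  have "rel_set ?Q (fset S) (set tss) \<longleftrightarrow>
      (\<forall>s\<in>SS. \<exists>ts\<in>set tss. ?Q (?f s) ts) \<and> (\<forall>ts\<in>set tss. \<exists>s\<in>SS. ?Q (?f s) ts)"
    unfolding rel_set_def[of ?Q] fS by simp
  also have "\<dots> \<longleftrightarrow> (\<forall>s\<in>SS. \<exists>ts\<in>set tss. rel_set Q s (set ts)) \<and>
      (\<forall>ts\<in>set tss. \<exists>s\<in>SS. rel_set Q s (set ts))"
    by (intro conj_cong ball_cong bex_cong refl Q)
  also have "\<dots> \<longleftrightarrow> nest True Q SS (set ` set tss)"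
    by (simp add: nest_def rel_set_def[of "rel_set Q"])
  finally show ?thesis .
qed

lemma Tag_summandsE:
  assumes "Tag k (FinSet S) \<in> summands X n"
  obtains SS where "SS \<in> fsets X (n + k)" "pp SS = FinSet S"
  using assms unfolding summands_pp by auto

lemma identifiedE:
  assumes "identified X eps gam n x T"
  obtains A k SS where "x \<in> el X n" "app eps n x = Atm A" "root T = (n, A)"
    "SS \<in> fsets X (n + k)" "app gam n x = cls X n (Tag k (pp SS))"
    "nest True (identified X eps gam (n + k)) SS (set ` set (or_nodes T))"
  using assms
proof (cases rule: identified.cases)
  case (1 A k S tss)
  obtain SS where SS: "SS \<in> fsets X (n + k)" "pp SS = FinSet S"
    by (rule Tag_summandsE[OF 1(4)])
  have "nest True (identified X eps gam (n + k)) SS (set ` set tss)"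
    using 1(6) unfolding nest_or_nodes[OF SS] .
  then show ?thesis using that[of A SS k] 1 SS by simp
qed

lemma identified_coinduct:
  assumes "R n x T"
    and "\<And>n x T. R n x T \<Longrightarrow> \<exists>A k SS. x \<in> el X n \<and> app eps n x = Atm A \<and> root T = (n, A) \<and>
      SS \<in> fsets X (n + k) \<and> app gam n x = cls X n (Tag k (pp SS)) \<and>
      nest True (R (n + k)) SS (set ` set (or_nodes T))"
  shows "identified X eps gam n x T"
  using assms(1)
proof (coinduct rule: identified.coinduct)
  case (identified n x T)
  obtain A k SS where *: "x \<in> el X n" "app eps n x = Atm A" "root T = (n, A)"
    "SS \<in> fsets X (n + k)" "app gam n x = cls X n (Tag k (pp SS))"
    and nest: "nest True (R (n + k)) SS (set ` set (or_nodes T))"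
    using assms(2)[OF identified] by blast
  obtain S where S: "pp SS = FinSet S" by (simp add: pp_def)
  have "nest True (\<lambda>y t. R (n + k) y t \<or> identified X eps gam (n + k) y t) SS (set ` set (or_nodes T))"
    by (rule nest_mono_strong[OF nest]) simp
  then have "rel_set (\<lambda>u ts. \<exists>s. u = FinSet s \<and>
      rel_set (\<lambda>y t. R (n + k) y t \<or> identified X eps gam (n + k) y t) (fset s) (set ts)) (fset S) (set (or_nodes T))"
    unfolding nest_or_nodes[OF *(4) S] .
  moreover have "T = And_Node (n, A) (or_nodes T)" using *(3) by (metis and_tree.collapse)
  moreover have "Tag k (FinSet S) \<in> summands X n" using summandsI[OF *(4)] by (simp add: S)
  ultimately show ?case using * S by auto
qed

text \<open>Identification depends only on labels and on the structure map, and \<open>h\<close>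
  preserves both.\<close>

lemma identified_hom:
  assumes h: "is_trans Sg h" "src h = X" "tgt h = X'"
    and gam: "src gam = X" "tgt gam = Pff_ob X" "is_trans Sg gam"
    and gam_h: "Comp (Lax_Inj Sg) gam' h = Comp (Lax_Inj Sg) (Pff_arr h) gam"
    and eps_h: "Comp (Lax_Inj Sg) eps' h = eps"
    and x: "identified X eps gam n x T"
  shows "identified X' eps' gam' n (app h n x) T"
proof (rule identified_coinduct[where R = "\<lambda>n x' T. \<exists>x. x' = app h n x \<and> identified X eps gam n x T"])
  fix n x' T assume "\<exists>x. x' = app h n x \<and> identified X eps gam n x T"
  then obtain x where x': "x' = app h n x" and x: "identified X eps gam n x T" by blast
  obtain A k SS where *: "x \<in> el X n" "app eps n x = Atm A" "root T = (n, A)"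
    and SS: "SS \<in> fsets X (n + k)" and g: "app gam n x = cls X n (Tag k (pp SS))"
    and nest: "nest True (identified X eps gam (n + k)) SS (set ` set (or_nodes T))"
    by (rule identifiedE[OF x])
  have hc: "app h n z \<in> el X' n" if "z \<in> el X n" for n z
    using app_carr[OF h(1), of z n] h(2,3) that by simp
  have "app eps' n (app h n x) = app eps n x"
    using arg_cong[OF eps_h, of "\<lambda>t. app t n x"] *(1) h by simp
  moreover have "app gam' n (app h n x) = app (Pff_arr h) n (app gam n x)"
    using arg_cong[OF gam_h, of "\<lambda>t. app t n x"] *(1) h gam by simp
  then have "app gam' n (app h n x) = cls X' n (Tag k (pp (image (app h (n + k)) ` SS)))"
    using app_Pff_cls[OF h(1), of "Tag k (pp SS)" n] summandsI[OF SS] h(2,3)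
    by (simp add: g tag_map_pp[OF SS])
  moreover have "nest True (\<lambda>x' T. \<exists>x. x' = app h (n + k) x \<and> identified X eps gam (n + k) x T)
      (image (app h (n + k)) ` SS) (image (\<lambda>t. t) ` set ` set (or_nodes T))"
    unfolding nest_image by (rule nest_mono_strong[OF nest]) blast
  moreover have "image (app h (n + k)) ` SS \<in> fsets X' (n + k)"
    by (rule finite_finite_image[OF SS]) (rule hc)
  ultimately show "\<exists>A k SS. x' \<in> el X' n \<and> app eps' n x' = Atm A \<and> root T = (n, A) \<and>
      SS \<in> fsets X' (n + k) \<and> app gam' n x' = cls X' n (Tag k (pp SS)) \<and>
      nest True (\<lambda>x' T. \<exists>x. x' = app h (n + k) x \<and> identified X eps gam (n + k) x T)
        SS (set ` set (or_nodes T))"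
    unfolding x' using * hc[OF *(1)] by (intro exI[of _ A] exI[of _ k] exI[of _ "image (app h (n + k)) ` SS"]) simp
qed (use x in blast)

text \<open>The candidate pairs the value at each atom with its tree. Since \<open>h\<close> is a
  coalgebra map, \<open>gam\<close> sends that value to the \<open>h\<close>-image of the resolvents
  of the atom, and these are the labels of the and-nodes one level down.\<close>

lemma identified_ctree:
  assumes P: "logic_program Sg P"
    and h: "is_trans Sg h" "src h = At Sg" "tgt h = X"
    and gam_h: "Comp (Lax_Inj Sg) gam h = Comp (Lax_Inj Sg) (Pff_arr h) (program_coalgebra Sg P)"
    and eps_h: "Comp (Lax_Inj Sg) eps h = Id (Lax_Inj Sg) (At Sg)"
    and A: "A \<in> atoms Sg n"
  shows "identified X eps gam n (app h n (Atm A)) (ctree P n A)"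
proof (rule identified_coinduct[where
      R = "\<lambda>n x T. \<exists>A\<in>atoms Sg n. x = app h n (Atm A) \<and> T = ctree P n A"])
  fix n x T assume "\<exists>A\<in>atoms Sg n. x = app h n (Atm A) \<and> T = ctree P n A"
  then obtain A where A: "A \<in> atoms Sg n" and x: "x = app h n (Atm A)" and T: "T = ctree P n A" by blast
  let ?k = "num_fresh P A"
  let ?R = "\<lambda>x T. \<exists>A\<in>atoms Sg (n + ?k). x = app h (n + ?k) (Atm A) \<and> T = ctree P (n + ?k) A"
  let ?SS = "image (app h (n + ?k)) ` resolvent_sets P n A"
  note rs = resolvent_sets_finite_finite[OF P A]
  have hc: "app h n z \<in> el X n" if "z \<in> Atm ` atoms Sg n" for n z
    using app_carr[OF h(1), of z n] h(2,3) that by simp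
  have "app eps n x = Atm A"
    using arg_cong[OF eps_h, of "\<lambda>t. app t n (Atm A)"] A h by (simp add: x)
  moreover have "app gam n x = app (Pff_arr h) n (app (program_coalgebra Sg P) n (Atm A))"
    using arg_cong[OF gam_h, of "\<lambda>t. app t n (Atm A)"] A h by (simp add: x)
  then have "app gam n x = cls X n (Tag ?k (pp ?SS))"
    using app_Pff_cls[OF h(1), of "Tag ?k (pp (resolvent_sets P n A))" n] summandsI[OF rs] h(2,3)
    by (simp add: app_program_coalgebra[OF A] tag_map_pp[OF rs])
  moreover have "nest True ?R ?SS (set ` set (or_nodes T))"
  proof -
    let ?C = "{c \<in> set P. matches c A}"
    have SS: "?SS = (\<lambda>c. (\<lambda>B. app h (n + ?k) (Atm (resolvent n c A B))) ` set (body c)) ` ?C"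
      by (simp add: resolvent_sets_def image_image)
    \<comment> \<open>Order and repetition of clauses vanish in the set, so \<open>remdups\<close>
      leaves no trace.\<close>
    have TT: "set ` set (or_nodes T) = (\<lambda>c. (\<lambda>B. ctree P (n + ?k) (resolvent n c A B)) ` set (body c)) ` ?C"
      by (simp add: T image_image)
    have "rel_set ?R ((\<lambda>B. app h (n + ?k) (Atm (resolvent n c A B))) ` set (body c))
        ((\<lambda>B. ctree P (n + ?k) (resolvent n c A B)) ` set (body c))" if "c \<in> ?C" for c
      using resolvent_atoms[OF P A] that by (intro rel_setI) blast+
    then show ?thesis unfolding SS TT nest_def if_True by (intro rel_setI) blast+
  qed
  moreover have "?SS \<in> fsets X (n + ?k)"
    by (rule finite_finite_image[OF rs]) (use hc in simp)
  moreover have "x \<in> el X n" using hc A x by blast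
  moreover have "root T = (n, A)" by (simp add: T)
  ultimately show "\<exists>A k SS. x \<in> el X n \<and> app eps n x = Atm A \<and> root T = (n, A) \<and>
      SS \<in> fsets X (n + k) \<and> app gam n x = cls X n (Tag k (pp SS)) \<and>
      nest True (\<lambda>x T. \<exists>A\<in>atoms Sg (n + k). x = app h (n + k) (Atm A) \<and> T = ctree P (n + k) A)
        SS (set ` set (or_nodes T))"
    by blast
qed (use A in blast)

section \<open>Uniqueness of the element identified with a tree\<close>

lemma nest_covered:
  assumes "nest True R X Y" "t \<in> Y" "y \<in> t"
  shows "\<exists>x. R x y"
proof -
  have "rel_set (rel_set R) X Y" using assms(1) by (simp add: nest_def)
  from rel_setD2[OF this assms(2)] obtain s where "rel_set R s t" by blast
  from rel_setD2[OF this assms(3)] show ?thesis by blast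
qed

text \<open>Being identified with a common tree is a bisimulation. The difficulty is that the two
  identifications may use different numbers of fresh variables. A single and-node one level down
  excludes this; without one, all families below are empty and can be placed in any large enough
  summand.\<close>

lemma identified_cofree_unique:
  fixes Sg :: "('f, 'q) sig" and H :: "('f, 'p, 'a) ufunctor"
  assumes H: "is_ofunctor Sg H"
    and "identified (cofree_ob H) (cofree_eps H) (cofree_gam H) n x T"
    and "identified (cofree_ob H) (cofree_eps H) (cofree_gam H) n x' T"
  shows "x = x'"
proof -
  let ?C = "cofree_ob H"
  let ?id = "identified ?C (cofree_eps H) (cofree_gam H)"
  note C = cofree_ofunctor[OF H]
  define R where "R n x x' \<longleftrightarrow> (\<exists>T. ?id n x T \<and> ?id n x' T)" for n x x'
  have "R n x x'" unfolding R_def using assms(2,3) by blast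
  then show ?thesis
  proof (rule cofree_bisimulation[OF H, rotated])
    fix n x x' assume "R n x x'"
    then obtain T where T: "?id n x T" "?id n x' T" unfolding R_def by blast
    obtain A k SS where x: "x \<in> el ?C n" "app (cofree_eps H) n x = Atm A" "root T = (n, A)"
      and SS: "SS \<in> fsets ?C (n + k)"
      and g: "app (cofree_gam H) n x = cls ?C n (Tag k (pp SS))"
      and nest: "nest True (?id (n + k)) SS (set ` set (or_nodes T))" by (rule identifiedE[OF T(1)])
    obtain A' k' SS' where x': "x' \<in> el ?C n" "app (cofree_eps H) n x' = Atm A'" "root T = (n, A')"
      and SS': "SS' \<in> fsets ?C (n + k')"
      and g': "app (cofree_gam H) n x' = cls ?C n (Tag k' (pp SS'))"
      and nest': "nest True (?id (n + k')) SS' (set ` set (or_nodes T))" by (rule identifiedE[OF T(2)])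
    have "\<exists>k S S'. S \<in> fsets ?C (n + k) \<and> S' \<in> fsets ?C (n + k) \<and>
        app (cofree_gam H) n x = cls ?C n (Tag k (pp S)) \<and>
        app (cofree_gam H) n x' = cls ?C n (Tag k (pp S')) \<and> nest True (R (n + k)) S S'"
    proof (cases "k = k'")
      case True
      have "nest True (R (n + k)) SS SS'"
        by (rule nest_trans[OF nest nest_flip[OF nest'[folded True]]]) (auto simp: R_def)
      then show ?thesis using SS SS' g g' True by blast
    next
      case False
      text \<open>The labels of the and-nodes below the root determine the number of fresh variables.\<close>
      have root: "fst (root t) = m" if "?id m y t" for m y t
        using that by (rule identifiedE) simp
      have "s = {}" if s: "s \<in> set ` set (or_nodes T)" for s
      proof (rule ccontr)
        assume "s \<noteq> {}"
        then obtain t where t: "t \<in> s" by blast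
        obtain y where y: "?id (n + k) y t" using nest_covered[OF nest s t] by blast
        obtain y' where y': "?id (n + k') y' t" using nest_covered[OF nest' s t] by blast
        show False using root[OF y] root[OF y'] False by simp
      qed
      then have empty: "set ` set (or_nodes T) \<subseteq> {{}}" by blast
      have emp: "S \<subseteq> {{}} \<and> (S = {} \<longleftrightarrow> or_nodes T = [])"
        if S: "nest True Q S (set ` set (or_nodes T))" for Q and S :: "('f, 'p, 'a) univ set set"
      proof -
        have Q: "rel_set Q s {} \<longleftrightarrow> s = {}" for s by (auto simp: rel_set_def)
        have rel: "rel_set (rel_set Q) S (set ` set (or_nodes T))" using S by (simp add: nest_def)
        have "s = {}" if "s \<in> S" for s using rel_setD1[OF rel that] empty Q by auto
        moreover have "S = {} \<longleftrightarrow> or_nodes T = []"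
          using rel by (auto simp: rel_set_def)
        ultimately show ?thesis by blast
      qed
      \<comment> \<open>Both families contain at most the empty set, and each is empty exactly if
        there are no or-nodes; so they coincide.\<close>
      define E :: "('f, 'p, 'a) univ set set" where "E = SS"
      have E: "E \<subseteq> {{}}" "SS = E" "SS' = E"
        using emp[OF nest] emp[OF nest'] unfolding E_def by auto
      have fin: "E \<in> finite_finite X" for X using E(1) by (auto simp: finite_finite_def intro: finite_subset)
      \<comment> \<open>Renaming does nothing to a family without elements, so the inclusion changes
        only the tag.\<close>
      have lift: "cls ?C n (Tag l (pp E)) = cls ?C n (Tag (max k k') (pp E))" if l: "l \<le> max k k'" for l
      proof -
        have "image (ren ?C (n + l) (n + max k k') (\<lambda>x. x)) ` E = E"
          using E(1) by (auto simp: subset_singleton_iff)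
        then have "inj_step ?C n (Tag l (pp E)) (Tag (max k k') (pp E))"
          unfolding inj_step_pp using inj_under_id[OF l, of n] fin by metis
        then show ?thesis unfolding cls_eq_iff by (rule r_into_equivclp)
      qed
      have "nest True (R (n + max k k')) E E" by (rule nest_refl) (use E(1) in auto)
      then show ?thesis using lift[of k] lift[of k'] g g' fin unfolding E(2,3) by auto
    qed
    then show "x \<in> el ?C n \<and> x' \<in> el ?C n \<and>
      app (cofree_eps H) n x = app (cofree_eps H) n x' \<and>
      (\<exists>k S T. S \<in> fsets ?C (n + k) \<and> T \<in> fsets ?C (n + k) \<and>
        app (cofree_gam H) n x = cls ?C n (Tag k (pp S)) \<and>
        app (cofree_gam H) n x' = cls ?C n (Tag k (pp T)) \<and> nest True (R (n + k)) S T)"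
      using x x' by simp
  qed
qed

text \<open>Transfers uniqueness from the constructed coalgebra to any other along the comparison
  map \<open>\<phi>\<close>. Identification is carried forward by \<open>\<phi>\<close>, and the
  left inverse \<open>\<psi>\<close> makes \<open>\<phi>\<close> injective.\<close>

lemma cofree_comonad_identified_unique:
  fixes Sg :: "('f, 'q) sig" and H :: "('f, 'p, 'a) ufunctor"
  assumes co: "cofree_comonad (Lax_Inj Sg) (Pff_ob :: ('f, 'p, 'a) ufunctor \<Rightarrow> _) Pff_arr CO CA eps delta gam"
    and H: "is_ofunctor Sg H"
    and x: "identified (CO H) (eps H) (gam H) n x T" and x': "identified (CO H) (eps H) (gam H) n x' T"
  shows "x = x'"
proof -
  let ?K = "Lax_Inj Sg :: (('f, 'p, 'a) ufunctor, ('f, 'p, 'a) utrans) cat"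
  interpret co: cofree_comonad ?K Pff_ob Pff_arr CO CA eps delta gam by (rule co)
  interpret std: cofree_coalgebras ?K Pff_ob Pff_arr cofree_ob cofree_eps cofree_gam
    by (rule cofree_coalgebras_Lax_Inj)
  have H': "H \<in> Obj ?K" using H by (simp add: Obj_Lax_Inj)
  note g = co.gam_hom[OF H'] and e = co.eps_hom[OF H']
  obtain \<phi> where \<phi>: "std.coalg_hom H (CO H) (gam H) \<phi>" "Comp ?K (cofree_eps H) \<phi> = eps H"
    using std.ex_coalg_hom[OF H' g e] by blast
  obtain \<psi> where \<psi>: "co.cof.coalg_hom H (cofree_ob H) (cofree_gam H) \<psi>" "Comp ?K (eps H) \<psi> = cofree_eps H"
    using co.cof.ex_coalg_hom[OF H' std.ga_hom[OF H'] std.ep_hom[OF H']] by blast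
  have \<phi>h: "\<phi> \<in> hom ?K (CO H) (cofree_ob H)" and \<psi>h: "\<psi> \<in> hom ?K (cofree_ob H) (CO H)"
    and \<phi>g: "Comp ?K (cofree_gam H) \<phi> = Comp ?K (Pff_arr \<phi>) (gam H)"
    using \<phi>(1) \<psi>(1) by (auto simp: std.coalg_hom_def co.cof.coalg_hom_def)
  have "Comp ?K \<psi> \<phi> = Id ?K (CO H)"
  proof (rule co.cof.coalg_hom_unique[OF H' g])
    show "co.cof.coalg_hom H (CO H) (gam H) (Comp ?K \<psi> \<phi>)"
      by (rule co.cof.coalg_hom_comp[OF H' H' g std.ga_hom[OF H'] \<psi>(1) \<phi>h \<phi>g])
    show "co.cof.coalg_hom H (CO H) (gam H) (Id ?K (CO H))" by (rule co.cof.coalg_hom_Id[OF H'])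
    show "Comp ?K (eps H) (Comp ?K \<psi> \<phi>) = Comp ?K (eps H) (Id ?K (CO H))"
      using co.base.assoc[OF \<phi>h \<psi>h e] \<psi>(2) \<phi>(2) co.base.Comp_Id[OF e] by simp
  qed
  from arg_cong[OF this, of "\<lambda>t. app t n"]
  have inv: "app \<psi> n (app \<phi> n z) = z" if "z \<in> el (CO H) n" for z
    using that \<phi>h Comp_Lax_Inj(3)[of z \<phi> n Sg \<psi>] by (simp add: hom_Lax_Inj)
  have "is_trans Sg \<phi>" "src \<phi> = CO H" "tgt \<phi> = cofree_ob H"
    "src (gam H) = CO H" "tgt (gam H) = Pff_ob (CO H)" "is_trans Sg (gam H)"
    using \<phi>h g by (simp_all add: hom_Lax_Inj)
  note hom = identified_hom[OF this \<phi>g \<phi>(2)]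
  have "app \<phi> n x = app \<phi> n x'"
    by (rule identified_cofree_unique[OF H hom[OF x] hom[OF x']])
  moreover have "x \<in> el (CO H) n" "x' \<in> el (CO H) n"
    using x x' by (auto elim: identifiedE)
  ultimately show ?thesis using inv by metis
qed

theorem theorem3:
  fixes Sg :: "('f, 'p) sig"
  shows "let K = (Lax_Inj Sg ::
      (('f, ('f, 'p, 'a) univ) ofunctor, ('f, ('f, 'p, 'a) univ) trans) cat) in
    category K \<and>
    endofunctor K Pff_ob Pff_arr \<and>
    (\<exists>CO CA eps delta gam. cofree_comonad K Pff_ob Pff_arr CO CA eps delta gam) \<and>
    (\<forall>CO CA eps delta gam P.
      cofree_comonad K Pff_ob Pff_arr CO CA eps delta gam \<and> logic_program Sg P \<longrightarrow>
      program_coalgebra Sg P \<in> hom K (At Sg) (Pff_ob (At Sg)) \<and>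
      (\<exists>!pbar. corresponding_coalgebra K Pff_arr CO CA eps delta gam
         (At Sg) (program_coalgebra Sg P) pbar) \<and>
      (\<forall>pbar. corresponding_coalgebra K Pff_arr CO CA eps delta gam
           (At Sg) (program_coalgebra Sg P) pbar \<longrightarrow>
         (\<forall>n. \<forall>A\<in>atoms Sg n.
            (\<exists>!T. coinductive_tree_for P n A T) \<and>
            (\<forall>T. coinductive_tree_for P n A T \<longrightarrow>
              (\<forall>x\<in>carr (ob (CO (At Sg)) n).
                 identified (CO (At Sg)) (eps (At Sg)) (gam (At Sg)) n x T \<longleftrightarrow>
                 x = app pbar n (Atm A))))))"
  unfolding Let_def
proof (intro conjI allI impI)
  let ?K = "Lax_Inj Sg :: (('f, ('f, 'p, 'a) univ) ofunctor, ('f, ('f, 'p, 'a) univ) trans) cat"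
  let ?At = "At Sg :: ('f, ('f, 'p, 'a) univ) ofunctor"
  show "category ?K" by (rule category_Lax_Inj)
  show "endofunctor ?K Pff_ob Pff_arr" by (rule endofunctor_Pff)
  show "\<exists>CO CA eps delta gam. cofree_comonad ?K Pff_ob Pff_arr CO CA eps delta gam"
    using cofree_coalgebras.cofree_comonad[OF cofree_coalgebras_Lax_Inj] by blast
  fix CO CA eps delta gam P
  assume asm: "cofree_comonad ?K Pff_ob Pff_arr CO CA eps delta gam \<and> logic_program Sg P"
  let ?p = "program_coalgebra Sg P :: ('f, ('f, 'p, 'a) univ) trans"
  interpret co: cofree_comonad ?K Pff_ob Pff_arr CO CA eps delta gam using asm by blast
  have P: "logic_program Sg P" using asm by blast
  have At: "?At \<in> Obj ?K" by (simp add: Obj_Lax_Inj At_ofunctor)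
  show p: "?p \<in> hom ?K ?At (Pff_ob ?At)"
    by (simp add: hom_Lax_Inj program_coalgebra_trans[OF P])
  show "\<exists>!pbar. corresponding_coalgebra ?K Pff_arr CO CA eps delta gam ?At ?p pbar"
    by (rule co.ex1_corresponding_coalgebra[OF At p])
  fix pbar assume "corresponding_coalgebra ?K Pff_arr CO CA eps delta gam ?At ?p pbar"
  then have "co.cof.coalg_hom ?At ?At ?p pbar" and eps: "Comp ?K (eps ?At) pbar = Id ?K ?At"
    unfolding co.corresponding_coalgebra_iff[OF At p] by blast+
  then have pbar: "is_trans Sg pbar" "src pbar = ?At" "tgt pbar = CO ?At"
    and gam: "Comp ?K (gam ?At) pbar = Comp ?K (Pff_arr pbar) ?p"
    by (simp_all add: co.cof.coalg_hom_def hom_Lax_Inj)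
  fix n
  show "\<forall>A\<in>atoms Sg n. (\<exists>!T. coinductive_tree_for P n A T) \<and>
      (\<forall>T. coinductive_tree_for P n A T \<longrightarrow> (\<forall>x\<in>el (CO ?At) n.
         identified (CO ?At) (eps ?At) (gam ?At) n x T \<longleftrightarrow> x = app pbar n (Atm A)))"
    \<comment> \<open>The tree is \<open>ctree P n A\<close>. The value of \<open>pbar\<close> is
      identified with it, and by uniqueness no other element is.\<close>
    using identified_ctree[OF P pbar gam eps]
      cofree_comonad_identified_unique[OF co.cofree_comonad_axioms At_ofunctor]
    by (auto simp: coinductive_tree_for_iff[OF P])
qed

end
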